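(* Let $m,n\ge1$. Then $K_m\vee P_n$ is determined by its $A_\alpha$-spectrum for every $\alpha\in(1/2,1)$.
   Context: All graphs are finite, simple and undirected. $A_\alpha(G)=\alpha D(G)+(1-\alpha)A(G)$ with $A(G)$ the adjacency and $D(G)$ the degree matrix. A graph is determined by its $A_\alpha$-spectrum if every graph whose $A_\alpha$ matrix has the same multiset of eigenvalues is isomorphic to it. $K_m$ is the complete graph, $P_n$ the path on $n$ vertices, and $\vee$ the join (disjoint union plus all edges between the two vertex sets). *)

theory Defs
  imports "Jordan_Normal_Form.Char_Poly"
begin

definition simple_graph :: "nat \<Rightarrow> (nat \<Rightarrow> nat \<Rightarrow> bool) \<Rightarrow> bool" where
  "simple_graph N E \<longleftrightarrow>
     (\<forall>i j. E i j \<longrightarrow> i < N \<and> j < N) \<and> (\<forall>i. \<not> E i i) \<and> (\<forall>i j. E i j \<longrightarrow> E j i)"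

definition degree :: "nat \<Rightarrow> (nat \<Rightarrow> nat \<Rightarrow> bool) \<Rightarrow> nat \<Rightarrow> nat" where
  "degree N E i = card {j \<in> {0..<N}. E i j}"

definition A_alpha :: "real \<Rightarrow> nat \<Rightarrow> (nat \<Rightarrow> nat \<Rightarrow> bool) \<Rightarrow> real mat" where
  "A_alpha \<alpha> N E = mat N N (\<lambda>(i, j).
      \<alpha> * (if i = j then real (degree N E i) else 0)
      + (1 - \<alpha>) * (if E i j then 1 else 0))"

text \<open>Spectrum: multiset of eigenvalues (with algebraic multiplicity), i.e. the
  multiset of roots of the characteristic polynomial. A_alpha is real symmetric,
  so its characteristic polynomial splits over the reals.\<close>
definition A_alpha_spectrum :: "real \<Rightarrow> nat \<Rightarrow> (nat \<Rightarrow> nat \<Rightarrow> bool) \<Rightarrow> real multiset" where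
  "A_alpha_spectrum \<alpha> N E = proots (char_poly (A_alpha \<alpha> N E))"

definition graph_iso :: "nat \<Rightarrow> (nat \<Rightarrow> nat \<Rightarrow> bool) \<Rightarrow> nat \<Rightarrow> (nat \<Rightarrow> nat \<Rightarrow> bool) \<Rightarrow> bool" where
  "graph_iso N E M F \<longleftrightarrow> (\<exists>f. bij_betw f {0..<N} {0..<M} \<and>
      (\<forall>i \<in> {0..<N}. \<forall>j \<in> {0..<N}. E i j \<longleftrightarrow> F (f i) (f j)))"

definition determined_by_A_alpha_spectrum :: "real \<Rightarrow> nat \<Rightarrow> (nat \<Rightarrow> nat \<Rightarrow> bool) \<Rightarrow> bool" where
  "determined_by_A_alpha_spectrum \<alpha> N E \<longleftrightarrow>
     (\<forall>M F. simple_graph M F \<and> A_alpha_spectrum \<alpha> M F = A_alpha_spectrum \<alpha> N E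
        \<longrightarrow> graph_iso M F N E)"

definition complete_graph :: "nat \<Rightarrow> nat \<Rightarrow> nat \<Rightarrow> bool" where
  "complete_graph m i j \<longleftrightarrow> i < m \<and> j < m \<and> i \<noteq> j"

definition path_graph :: "nat \<Rightarrow> nat \<Rightarrow> nat \<Rightarrow> bool" where
  "path_graph n i j \<longleftrightarrow> i < n \<and> j < n \<and> (i + 1 = j \<or> j + 1 = i)"

definition graph_join :: "nat \<Rightarrow> (nat \<Rightarrow> nat \<Rightarrow> bool) \<Rightarrow> nat \<Rightarrow> (nat \<Rightarrow> nat \<Rightarrow> bool)
    \<Rightarrow> nat \<Rightarrow> nat \<Rightarrow> bool" where
  "graph_join m G n H i j \<longleftrightarrow>
     (i < m \<and> j < m \<and> G i j)
   \<or> (m \<le> i \<and> i < m + n \<and> m \<le> j \<and> j < m + n \<and> H (i - m) (j - m))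
   \<or> (i < m \<and> m \<le> j \<and> j < m + n)
   \<or> (m \<le> i \<and> i < m + n \<and> j < m)"

end

theory Submission
  imports Defs "Jordan_Normal_Form.Schur_Decomposition"
begin

text \<open>
  The traces of the first three powers of \<open>A\<^sub>\<alpha>\<close> give the vertex number, the sums of degrees and of squared
  degrees, and one relation between the cubed degrees and the triangles. For \<open>\<alpha> > 1/2\<close> the matrix
  \<open>A\<^sub>\<alpha>\<close> of the complement is positive semidefinite with kernel supported on its isolated vertices, so for
  \<open>m \<ge> 2\<close> the \<open>m\<close> eigenvalues of \<open>K\<^sub>m \<or> P\<^sub>n\<close> that are at least \<open>\<alpha> N - 1\<close> force \<open>m\<close> universal vertices in every
  cospectral graph. For \<open>m = 1\<close> only one eigenvalue is at least \<open>2 + \<alpha>\<close>, so at most one vertex has degree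
  above 5, and then the moments force that vertex to be universal.

  Removing \<open>m\<close> universal vertices leaves a graph with \<open>\<Sum>(d - 2) = -2\<close> and \<open>\<Sum>(d - 2)\<^sup>2 = 2\<close>, that is, a path
  together with disjoint cycles. A cycle of length \<open>l\<close> makes \<open>\<alpha> (m + 2) + 2 (1 - \<alpha>) cos (2 \<pi> / l)\<close> a double
  eigenvalue. In \<open>K\<^sub>m \<or> P\<^sub>n\<close> this would yield an eigenvector vanishing on \<open>K\<^sub>m\<close>, hence antisymmetric on the
  path, and the boundary condition of the resulting trigonometric recurrence fails because
  \<open>\<alpha> / (1 - \<alpha>) > 1\<close>.
\<close>

section \<open>Spectral theorem for real symmetric matrices\<close>

text \<open>Why \<open>m = 1\<close> is a case of its own: the comparison with the complement only
  works on vectors of coordinate sum zero, and that condition costs one dimension. A universal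
  vertex gives it back, since a sum-zero vector supported on one vertex is zero; if there is none, a
  single large eigenvalue yields nothing. For \<open>m = 1\<close> the moments know \<alpha> only
  through \<open>(1 - \<alpha>)^3 < \<alpha>^3\<close>: a cospectral graph has at least the cube sum
  of the fan, or falls short of it by less than its surplus of triangles, each counted six times.
  With all degrees but one at most 5, this is impossible for \<open>n > 10\<close> if no vertex is
  universal. The finite rest leaves three pairs of \<open>n\<close> and largest degree, which are
  excluded by hand. In the cycle step, multiplicity two is what allows an eigenvector to be chosen
  that vanishes at one clique vertex. Its equation there gives coordinate sum zero, and from this
  follow both the vanishing on the whole clique and the antisymmetry at the two path ends.\<close>

lemma real_symmetric_char_poly_splits:
  fixes A :: "real mat"
  assumes A: "A \<in> carrier_mat N N"
    and sym: "\<And>i j. i < N \<Longrightarrow> j < N \<Longrightarrow> A $$ (i, j) = A $$ (j, i)"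
  shows "\<exists>es. char_poly A = (\<Prod>e\<leftarrow>es. [:- e, 1:])"
proof -
  interpret of_real_poly: map_poly_inj_idom_hom complex_of_real ..
  define C where "C = map_mat complex_of_real A"
  have C: "C \<in> carrier_mat N N" using A by (simp add: C_def)
  obtain as where as: "char_poly C = (\<Prod>a\<leftarrow>as. [:- a, 1:])"
    using char_poly_factorized[OF C] by blast
  \<comment> \<open>For an eigenvector \<open>v\<close> of the root \<open>a\<close>, the Hermitian
    form \<open>S\<close> equals \<open>a * r\<close> with \<open>r\<close> the squared norm.
    Symmetry of the real matrix gives \<open>cnj S = S\<close>, and \<open>r \<noteq> 0\<close> then
    makes \<open>a\<close> real.\<close>
  have real: "a \<in> \<real>" if "a \<in> set as" for a
  proof -
    have "poly (char_poly C) a = 0" unfolding as using that by (rule linear_poly_root)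
    then have "eigenvalue C a" using eigenvalue_root_char_poly[OF C] by simp
    then obtain v where v: "v \<in> carrier_vec N" "v \<noteq> 0\<^sub>v N" "C *\<^sub>v v = a \<cdot>\<^sub>v v"
      unfolding eigenvalue_def eigenvector_def using C by auto
    have row: "(\<Sum>j<N. of_real (A $$ (i, j)) * v $ j) = a * v $ i" if "i < N" for i
    proof -
      have "(C *\<^sub>v v) $ i = (a \<cdot>\<^sub>v v) $ i" using v by simp
      then show ?thesis using that v(1) A C
        by (simp add: C_def scalar_prod_def lessThan_atLeast0)
    qed
    define S where "S = (\<Sum>i<N. \<Sum>j<N. of_real (A $$ (i, j)) * v $ j * cnj (v $ i))"
    define r where "r = (\<Sum>i<N. (cmod (v $ i))\<^sup>2)"
    have "S = (\<Sum>i<N. (\<Sum>j<N. of_real (A $$ (i, j)) * v $ j) * cnj (v $ i))"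
      by (simp add: S_def sum_distrib_right)
    also have "\<dots> = (\<Sum>i<N. a * (v $ i * cnj (v $ i)))"
      by (intro sum.cong refl) (simp add: row mult.assoc)
    also have "\<dots> = a * of_real r"
      by (simp add: r_def sum_distrib_left complex_norm_square del: of_real_power)
    finally have S1: "S = a * of_real r" .
    have "cnj S = (\<Sum>i<N. \<Sum>j<N. of_real (A $$ (i, j)) * cnj (v $ j) * v $ i)"
      by (simp add: S_def)
    also have "\<dots> = (\<Sum>j<N. \<Sum>i<N. of_real (A $$ (i, j)) * cnj (v $ j) * v $ i)"
      by (rule sum.swap)
    also have "\<dots> = S"
      unfolding S_def by (intro sum.cong refl) (simp add: sym algebra_simps)
    finally have "cnj S = S" .
    obtain i where i: "i < N" "v $ i \<noteq> 0" using v(1,2) by (auto simp: vec_eq_iff)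
    have "r \<noteq> 0"
    proof
      assume "r = 0"
      then have "\<forall>i<N. (cmod (v $ i))\<^sup>2 = 0"
        unfolding r_def by (subst (asm) sum_nonneg_eq_0_iff) auto
      then show False using i by simp
    qed
    have "cnj a = a" using \<open>cnj S = S\<close> \<open>r \<noteq> 0\<close> by (simp add: S1)
    then show ?thesis by (simp add: Reals_cnj_iff)
  qed
  define es where "es = map Re as"
  have as_es: "as = map complex_of_real es"
    unfolding es_def using real by (induction as) auto
  have "map_poly complex_of_real (char_poly A) = char_poly C"
    unfolding C_def by (rule of_real_hom.char_poly_hom[OF A, symmetric])
  also have "\<dots> = map_poly complex_of_real (\<Prod>e\<leftarrow>es. [:- e, 1:])"
    unfolding as as_es
    by (induction es) (simp_all add: of_real_poly.hom_mult map_poly_pCons del: mult_pCons_left)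
  finally have "char_poly A = (\<Prod>e\<leftarrow>es. [:- e, 1:])"
    by simp
  then show ?thesis by blast
qed

text \<open>In triangularising coordinates, a vector of \<open>W\<close> whose last nonzero coordinate comes as early as
  possible is killed by \<open>A - b\<close> for the corresponding diagonal entry \<open>b\<close>.\<close>
lemma eigenvector_in_invariant_set:
  fixes A :: "real mat"
  assumes wit: "similar_mat_wit A B P Q" and B: "upper_triangular B"
    and A: "A \<in> carrier_mat N N" and W: "W \<subseteq> carrier_vec N"
    and w0: "w0 \<in> W" "w0 \<noteq> 0\<^sub>v N"
    and inv: "\<And>w c. w \<in> W \<Longrightarrow> A *\<^sub>v w - c \<cdot>\<^sub>v w \<in> W"
  shows "\<exists>w\<in>W. \<exists>e. w \<noteq> 0\<^sub>v N \<and> A *\<^sub>v w = e \<cdot>\<^sub>v w"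
proof -
  from similar_mat_witD2[OF A wit]
  have BPQ: "B \<in> carrier_mat N N" "P \<in> carrier_mat N N" "Q \<in> carrier_mat N N"
    and PQ: "P * Q = 1\<^sub>m N" "Q * P = 1\<^sub>m N" and APB: "A = P * B * Q" by auto
  define low where "low h \<longleftrightarrow> (\<exists>w\<in>W. w \<noteq> 0\<^sub>v N \<and> (\<forall>i<N. h \<le> i \<longrightarrow> (Q *\<^sub>v w) $ i = 0))" for h
  have "low N" using w0 by (auto simp: low_def)
  define h where "h = (LEAST h. low h)"
  have "low h" unfolding h_def using \<open>low N\<close> by (rule LeastI)
  then obtain w where w: "w \<in> W" "w \<noteq> 0\<^sub>v N" "\<And>i. i < N \<Longrightarrow> h \<le> i \<Longrightarrow> (Q *\<^sub>v w) $ i = 0"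
    by (auto simp: low_def)
  have wc: "w \<in> carrier_vec N" using w W by auto
  define z where "z = Q *\<^sub>v w"
  have zc: "z \<in> carrier_vec N" using BPQ wc by (simp add: z_def)
  have Pz: "w = P *\<^sub>v z" unfolding z_def
    using BPQ wc PQ by (metis assoc_mult_mat_vec one_mult_mat_vec)
  have "h \<noteq> 0"
  proof
    assume "h = 0"
    then have "z $ i = 0" if "i < N" for i using w(3)[of i] that by (simp add: z_def)
    then have "z = 0\<^sub>v N" using zc by (intro eq_vecI) auto
    then have "w = 0\<^sub>v N" unfolding Pz using BPQ by (intro eq_vecI) (auto simp: scalar_prod_def)
    with w(2) show False by simp
  qed
  define b where "b = B $$ (h - 1, h - 1)"
  define w' where "w' = A *\<^sub>v w - b \<cdot>\<^sub>v w"
  have w': "w' \<in> W" unfolding w'_def by (rule inv[OF w(1)])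
  have Aw: "A *\<^sub>v w \<in> carrier_vec N" using A wc by simp
  have "Q *\<^sub>v (A *\<^sub>v w) = B *\<^sub>v z"
  proof -
    have "Q * A = B * Q"
    proof -
      have "Q * A = Q * (P * (B * Q))" using APB BPQ by simp
      also have "\<dots> = (Q * P) * (B * Q)" using BPQ by (metis assoc_mult_mat mult_carrier_mat)
      finally show ?thesis using BPQ PQ by simp
    qed
    then show ?thesis using A BPQ wc unfolding z_def
      by (metis assoc_mult_mat_vec)
  qed
  then have Qw': "Q *\<^sub>v w' = B *\<^sub>v z - b \<cdot>\<^sub>v z"
    unfolding w'_def z_def using BPQ wc Aw
    by (metis mult_minus_distrib_mat_vec mult_mat_vec smult_carrier_vec)
  have "(Q *\<^sub>v w') $ i = 0" if i: "i < N" "h - 1 \<le> i" for i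
  proof -
    have zero: "z $ j = 0" if "h \<le> j" "j < N" for j using w(3)[of j] that by (simp add: z_def)
    \<comment> \<open>Row \<open>i \<ge> h - 1\<close> of \<open>B\<close> meets \<open>z\<close>
      only on the diagonal: to the left \<open>B\<close> vanishes by triangularity, to the right
      \<open>z\<close> does. At \<open>i = h - 1\<close> the factor is \<open>b\<close>, and further
      down \<open>z\<close> is already 0.\<close>
    have "(\<Sum>j<N. B $$ (i, j) * z $ j) = (\<Sum>j<N. if j = i then B $$ (i, i) * z $ i else 0)"
    proof (intro sum.cong refl)
      fix j assume j: "j \<in> {..<N}"
      show "B $$ (i, j) * z $ j = (if j = i then B $$ (i, i) * z $ i else 0)"
      proof (cases "j < i")
        case True
        then show ?thesis using B BPQ i by (auto simp: upper_triangular_def)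
      next
        case False
        then show ?thesis using zero[of j] j i \<open>h \<noteq> 0\<close> by auto
      qed
    qed
    also have "\<dots> = B $$ (i, i) * z $ i" using i by simp
    finally have "(B *\<^sub>v z) $ i = B $$ (i, i) * z $ i"
      using BPQ zc i by (simp add: scalar_prod_def lessThan_atLeast0)
    moreover have "B $$ (i, i) * z $ i = b * z $ i"
      using zero[of i] i \<open>h \<noteq> 0\<close> by (cases "i = h - 1") (auto simp: b_def)
    ultimately show ?thesis unfolding Qw' using i zc BPQ by simp
  qed
  then have "w' \<noteq> 0\<^sub>v N \<Longrightarrow> low (h - 1)" using w' by (auto simp: low_def)
  then have "w' = 0\<^sub>v N" using not_less_Least[of "h - 1" low] \<open>h \<noteq> 0\<close> by (auto simp: h_def)
  have "A *\<^sub>v w = b \<cdot>\<^sub>v w"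
  proof (rule eq_vecI)
    fix i assume "i < dim_vec (b \<cdot>\<^sub>v w)"
    then have i: "i < N" using wc by simp
    have "w' $ i = 0" using \<open>w' = 0\<^sub>v N\<close> i by simp
    then show "(A *\<^sub>v w) $ i = (b \<cdot>\<^sub>v w) $ i" unfolding w'_def using i wc Aw A by simp
  qed (use A wc in auto)
  then show ?thesis using w by blast
qed

lemma nonzero_orthogonal_vector:
  fixes F :: "(nat \<Rightarrow> real) set"
  assumes "finite F" and "card F < N"
  shows "\<exists>x. (\<exists>i<N. x i \<noteq> 0) \<and> (\<forall>w\<in>F. (\<Sum>i<N. w i * x i) = 0)"
proof -
  obtain ws where ws: "set ws = F" "distinct ws" using finite_distinct_list[OF assms(1)] by blast
  have len: "length ws < N" using ws assms(2) by (metis distinct_card)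
  define c where "c i = (if i < length ws then vec N (ws ! i) else 0\<^sub>v N)" for i
  \<comment> \<open>The functionals become the first rows of a square matrix. As there are fewer
    than \<open>N\<close> of them, its last row is zero, so the determinant vanishes and there is a
    kernel vector.\<close>
  define M where "M = mat\<^sub>r N N (\<lambda>i. if i = N - 1 then 0\<^sub>v N else c i)"
  have M: "M \<in> carrier_mat N N" by (simp add: M_def)
  have "det M = 0" unfolding M_def
    by (rule det_row_0) (use len in \<open>auto simp: c_def\<close>)
  then obtain v where v: "v \<in> carrier_vec N" "v \<noteq> 0\<^sub>v N" "M *\<^sub>v v = 0\<^sub>v N"
    using det_0_iff_vec_prod_zero_field[OF M] by blast
  obtain i where i: "i < N" "v $ i \<noteq> 0" using v(1,2) by (auto simp: vec_eq_iff)
  have "(\<Sum>i<N. w i * v $ i) = 0" if "w \<in> F" for w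
  proof -
    have "w \<in> set ws" using that ws by simp
    then obtain k where k: "k < length ws" "ws ! k = w" by (auto simp: in_set_conv_nth)
    have "c k = vec N w" "k \<noteq> N - Suc 0" using k len by (auto simp: c_def)
    moreover have "(M *\<^sub>v v) $ k = 0" using v k len by simp
    ultimately show ?thesis using k len v(1)
      by (simp add: M_def scalar_prod_def lessThan_atLeast0)
  qed
  then show ?thesis using i by blast
qed

definition orthonormal_eigenvectors ::
    "nat \<Rightarrow> real mat \<Rightarrow> nat \<Rightarrow> (nat \<Rightarrow> real) \<Rightarrow> (nat \<Rightarrow> nat \<Rightarrow> real) \<Rightarrow> bool" where
  "orthonormal_eigenvectors N A r lam u \<longleftrightarrow>
     (\<forall>k<r. \<forall>l<r. (\<Sum>i<N. u k i * u l i) = of_bool (k = l)) \<and>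
     (\<forall>k<r. \<forall>i<N. (\<Sum>j<N. A $$ (i, j) * u k j) = lam k * u k i)"

text \<open>The orthogonal complement \<open>W\<close> of the vectors found so far is nonzero
  because \<open>r < N\<close>, and symmetry makes it invariant under \<open>A - c\<close> for every
  \<open>c\<close>. It therefore contains another eigenvector, which only has to be
  normalised.\<close>

lemma orthonormal_eigenvectors_extend:
  fixes A :: "real mat"
  assumes A: "A \<in> carrier_mat N N"
    and sym: "\<And>i j. i < N \<Longrightarrow> j < N \<Longrightarrow> A $$ (i, j) = A $$ (j, i)"
    and ortho: "orthonormal_eigenvectors N A r lam u" and r: "r < N"
  shows "\<exists>lam' u'. orthonormal_eigenvectors N A (Suc r) lam' u'"
proof -
  obtain es where "char_poly A = (\<Prod>e\<leftarrow>es. [:- e, 1:])"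
    using real_symmetric_char_poly_splits[OF A sym] by blast
  moreover obtain B P Q where "schur_decomposition A es = (B, P, Q)"
    by (cases "schur_decomposition A es") auto
  ultimately have schur: "similar_mat_wit A B P Q" "upper_triangular B"
    using schur_decomposition[OF A] by blast+
  have u: "\<And>k l. k < r \<Longrightarrow> l < r \<Longrightarrow> (\<Sum>i<N. u k i * u l i) = of_bool (k = l)"
    and eig: "\<And>k i. k < r \<Longrightarrow> i < N \<Longrightarrow> (\<Sum>j<N. A $$ (i, j) * u k j) = lam k * u k i"
    using ortho by (auto simp: orthonormal_eigenvectors_def)
  define W where "W = {w \<in> carrier_vec N. \<forall>k<r. (\<Sum>i<N. u k i * w $ i) = 0}"
  have "card (u ` {..<r}) < N" using card_image_le[of "{..<r}" u] r by simp
  then obtain x where x: "\<exists>i<N. x i \<noteq> 0" "\<forall>k<r. (\<Sum>i<N. u k i * x i) = 0"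
    using nonzero_orthogonal_vector[of "u ` {..<r}" N] by auto
  have w0: "vec N x \<in> W" "vec N x \<noteq> 0\<^sub>v N"
    using x by (auto simp: W_def vec_eq_iff)
  have Aw: "(A *\<^sub>v w) $ i = (\<Sum>j<N. A $$ (i, j) * w $ j)" if "w \<in> carrier_vec N" "i < N" for w i
    using that A by (simp add: scalar_prod_def lessThan_atLeast0)
  have inv: "A *\<^sub>v w - c \<cdot>\<^sub>v w \<in> W" if w: "w \<in> W" for w c
  proof -
    have wc: "w \<in> carrier_vec N" using w by (simp add: W_def)
    have "(\<Sum>i<N. u k i * (A *\<^sub>v w - c \<cdot>\<^sub>v w) $ i) = 0" if k: "k < r" for k
    proof -
      have "(\<Sum>i<N. u k i * (A *\<^sub>v w - c \<cdot>\<^sub>v w) $ i)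
          = (\<Sum>i<N. (\<Sum>j<N. u k i * A $$ (i, j) * w $ j) - c * (u k i * w $ i))"
        using A wc by (intro sum.cong refl) (simp add: Aw[OF wc] sum_distrib_left algebra_simps del: index_mult_mat_vec)
      also have "\<dots> = (\<Sum>i<N. \<Sum>j<N. u k i * A $$ (i, j) * w $ j) - c * (\<Sum>i<N. u k i * w $ i)"
        by (simp add: sum_subtractf sum_distrib_left)
      also have "(\<Sum>i<N. \<Sum>j<N. u k i * A $$ (i, j) * w $ j)
          = (\<Sum>j<N. \<Sum>i<N. u k i * A $$ (i, j) * w $ j)"
        by (rule sum.swap)
      also have "\<dots> = (\<Sum>j<N. (\<Sum>i<N. A $$ (j, i) * u k i) * w $ j)"
        by (intro sum.cong refl) (subst sum_distrib_right, intro sum.cong refl, simp add: sym)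
      also have "\<dots> = lam k * (\<Sum>j<N. u k j * w $ j)"
        by (simp add: eig[OF k] sum_distrib_left mult.assoc)
      finally show ?thesis using w k by (simp add: W_def)
    qed
    then show ?thesis using A wc by (auto simp: W_def)
  qed
  have "W \<subseteq> carrier_vec N" by (auto simp: W_def)
  then obtain w e where w: "w \<in> W" "w \<noteq> 0\<^sub>v N" "A *\<^sub>v w = e \<cdot>\<^sub>v w"
    using eigenvector_in_invariant_set[OF schur A _ w0 inv] by blast
  have wc: "w \<in> carrier_vec N" using w by (simp add: W_def)
  define s where "s = (\<Sum>i<N. (w $ i)\<^sup>2)"
  have "s \<noteq> 0"
  proof
    assume "s = 0"
    then have "\<forall>i<N. w $ i = 0"
      unfolding s_def by (subst (asm) sum_nonneg_eq_0_iff) auto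
    then have "w = 0\<^sub>v N" using wc by (intro eq_vecI) auto
    with w(2) show False by simp
  qed
  have "s \<ge> 0" unfolding s_def by (intro sum_nonneg) auto
  define y where "y i = w $ i / sqrt s" for i
  have "(\<Sum>i<N. y i * y i) = (\<Sum>i<N. (w $ i)\<^sup>2) / s"
    using \<open>s \<ge> 0\<close> by (simp add: y_def sum_divide_distrib power2_eq_square)
  then have yy: "(\<Sum>i<N. y i * y i) = 1" using \<open>s \<noteq> 0\<close> by (simp add: s_def)
  have uy: "(\<Sum>i<N. u k i * y i) = 0" if "k < r" for k
  proof -
    have "(\<Sum>i<N. u k i * y i) = (\<Sum>i<N. u k i * w $ i) / sqrt s"
      by (simp add: y_def sum_divide_distrib)
    then show ?thesis using w(1) that by (simp add: W_def)
  qed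
  then have yu: "(\<Sum>i<N. y i * u k i) = 0" if "k < r" for k
    using that by (simp add: mult.commute)
  have Ay: "(\<Sum>j<N. A $$ (i, j) * y j) = e * y i" if "i < N" for i
  proof -
    have "(\<Sum>j<N. A $$ (i, j) * y j) = (A *\<^sub>v w) $ i / sqrt s"
      using Aw[OF wc that] by (simp add: y_def sum_divide_distrib)
    then show ?thesis using w(3) that wc by (simp add: y_def)
  qed
  have "orthonormal_eigenvectors N A (Suc r) (lam(r := e)) (u(r := y))"
    unfolding orthonormal_eigenvectors_def
    by (auto simp: less_Suc_eq u eig yy uy yu Ay)
  then show ?thesis by blast
qed

theorem real_symmetric_spectral:
  fixes A :: "real mat"
  assumes A: "A \<in> carrier_mat N N"
    and sym: "\<And>i j. i < N \<Longrightarrow> j < N \<Longrightarrow> A $$ (i, j) = A $$ (j, i)"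
  obtains lam u where "orthonormal_eigenvectors N A N lam u"
    and "proots (char_poly A) = image_mset lam (mset_set {..<N})"
    and "\<And>i j. i < N \<Longrightarrow> j < N \<Longrightarrow> (\<Sum>k<N. u k i * u k j) = of_bool (i = j)"
proof -
  have "\<exists>lam u. orthonormal_eigenvectors N A r lam u" if "r \<le> N" for r
    using that
  proof (induction r)
    case 0
    then show ?case by (simp add: orthonormal_eigenvectors_def)
  next
    case (Suc r)
    then obtain lam u where "orthonormal_eigenvectors N A r lam u" by auto
    from orthonormal_eigenvectors_extend[OF A sym this] show ?case using Suc by simp
  qed
  then obtain lam u where ou: "orthonormal_eigenvectors N A N lam u" by blast
  then have u: "\<And>k l. k < N \<Longrightarrow> l < N \<Longrightarrow> (\<Sum>i<N. u k i * u l i) = of_bool (k = l)"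
    and eig: "\<And>k i. k < N \<Longrightarrow> i < N \<Longrightarrow> (\<Sum>j<N. A $$ (i, j) * u k j) = lam k * u k i"
    by (auto simp: orthonormal_eigenvectors_def)
  define U where "U = mat N N (\<lambda>(k, i). u k i)"
  define D where "D = mat N N (\<lambda>(i, j). if i = j then lam i else 0)"
  have c: "U \<in> carrier_mat N N" "U\<^sup>T \<in> carrier_mat N N" "D \<in> carrier_mat N N"
    by (auto simp: U_def D_def)
  have UUT: "U * U\<^sup>T = 1\<^sub>m N"
    by (rule eq_matI) (auto simp: U_def scalar_prod_def u lessThan_atLeast0[symmetric])
  \<comment> \<open>A right inverse of a square matrix is a left inverse: orthonormal rows have
    orthonormal columns, which is the completeness relation.\<close>
  have UTU: "U\<^sup>T * U = 1\<^sub>m N" by (rule mat_mult_left_right_inverse[OF c(1,2) UUT])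
  have compl: "(\<Sum>k<N. u k i * u k j) = of_bool (i = j)" if "i < N" "j < N" for i j
  proof -
    have "(U\<^sup>T * U) $$ (i, j) = (\<Sum>k<N. u k i * u k j)"
      using that by (simp add: U_def scalar_prod_def lessThan_atLeast0)
    then show ?thesis using that by (auto simp: UTU)
  qed
  have "A * U\<^sup>T = U\<^sup>T * D"
  proof (rule eq_matI)
    fix i k assume "i < dim_row (U\<^sup>T * D)" "k < dim_col (U\<^sup>T * D)"
    then have ik: "i < N" "k < N" using c by auto
    have "(A * U\<^sup>T) $$ (i, k) = (\<Sum>j<N. A $$ (i, j) * u k j)"
      using ik A by (simp add: U_def scalar_prod_def lessThan_atLeast0)
    also have "\<dots> = u k i * lam k" using ik by (simp add: eig)
    also have "\<dots> = (\<Sum>j<N. u j i * (if j = k then lam j else 0))"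
      using ik by (simp add: if_distrib[of "\<lambda>x. _ * x"] cong: if_cong)
    also have "\<dots> = (U\<^sup>T * D) $$ (i, k)"
      using ik by (simp add: U_def D_def scalar_prod_def lessThan_atLeast0)
    finally show "(A * U\<^sup>T) $$ (i, k) = (U\<^sup>T * D) $$ (i, k)" .
  qed (use A c in auto)
  then have "A * U\<^sup>T * U = U\<^sup>T * D * U" by simp
  then have "A = U\<^sup>T * D * U" using A c UTU
    by (metis assoc_mult_mat right_mult_one_mat)
  then have "similar_mat_wit A D U\<^sup>T U"
    by (intro similar_mat_witI[of _ _ N]) (use A c UUT UTU in auto)
  then have "char_poly A = char_poly D"
    by (intro char_poly_similar) (auto simp: similar_mat_def)
  also have "\<dots> = (\<Prod>a\<leftarrow>diag_mat D. [:- a, 1:])"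
    by (rule char_poly_upper_triangular[OF c(3)]) (auto simp: D_def upper_triangular_def)
  also have "diag_mat D = map lam [0..<N]"
    by (auto simp: diag_mat_def D_def)
  finally have cp: "char_poly A = (\<Prod>a\<leftarrow>map lam [0..<N]. [:- a, 1:])" .
  have pr: "proots (\<Prod>a\<leftarrow>as. [:- a, 1:]) = mset as" for as :: "real list"
  proof (induction as)
    case (Cons a as)
    have "(\<Prod>a\<leftarrow>as. [:- a, 1:]) \<noteq> 0" by (auto simp: prod_list_zero_iff)
    then show ?case using Cons by (simp add: proots_mult del: mult_pCons_left)
  qed simp
  have "proots (char_poly A) = image_mset lam (mset_set {..<N})"
    unfolding cp pr by (simp add: lessThan_atLeast0)
  with ou compl show ?thesis using that by blast
qed

section \<open>Quadratic forms, traces and eigenvalue counts in an orthonormal eigenbasis\<close>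

locale eigenbasis =
  fixes N :: nat and A :: "real mat" and lam :: "nat \<Rightarrow> real" and u :: "nat \<Rightarrow> nat \<Rightarrow> real"
  assumes eigenvectors: "orthonormal_eigenvectors N A N lam u"
    and complete: "\<And>i j. i < N \<Longrightarrow> j < N \<Longrightarrow> (\<Sum>k<N. u k i * u k j) = of_bool (i = j)"
    and sym: "\<And>i j. i < N \<Longrightarrow> j < N \<Longrightarrow> A $$ (i, j) = A $$ (j, i)"
begin

lemma orth: "k < N \<Longrightarrow> l < N \<Longrightarrow> (\<Sum>i<N. u k i * u l i) = of_bool (k = l)"
  and eig: "k < N \<Longrightarrow> i < N \<Longrightarrow> (\<Sum>j<N. A $$ (i, j) * u k j) = lam k * u k i"
  using eigenvectors by (auto simp: orthonormal_eigenvectors_def)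

definition coef :: "(nat \<Rightarrow> real) \<Rightarrow> nat \<Rightarrow> real" where
  "coef x k = (\<Sum>i<N. u k i * x i)"

lemma expand:
  assumes "j < N"
  shows "x j = (\<Sum>k<N. coef x k * u k j)"
proof -
  have "(\<Sum>k<N. coef x k * u k j) = (\<Sum>k<N. \<Sum>i<N. x i * (u k i * u k j))"
    by (simp add: coef_def sum_distrib_right sum_distrib_left ac_simps)
  also have "\<dots> = (\<Sum>i<N. x i * (\<Sum>k<N. u k i * u k j))"
    by (subst sum.swap) (simp add: sum_distrib_left)
  also have "\<dots> = (\<Sum>i<N. if i = j then x i else 0)"
    using assms by (intro sum.cong refl) (simp add: complete)
  finally show ?thesis using assms by simp
qed

lemma parseval: "(\<Sum>i<N. (x i)\<^sup>2) = (\<Sum>k<N. (coef x k)\<^sup>2)"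
proof -
  have "(\<Sum>i<N. (x i)\<^sup>2) = (\<Sum>i<N. \<Sum>k<N. coef x k * (u k i * x i))"
  proof (intro sum.cong refl)
    fix i assume "i \<in> {..<N}"
    then have "x i * x i = (\<Sum>k<N. coef x k * u k i) * x i"
      using expand[of i x] by simp
    then show "(x i)\<^sup>2 = (\<Sum>k<N. coef x k * (u k i * x i))"
      by (simp add: power2_eq_square sum_distrib_right mult.assoc)
  qed
  also have "\<dots> = (\<Sum>k<N. coef x k * (\<Sum>i<N. u k i * x i))"
    by (subst sum.swap) (simp add: sum_distrib_left)
  finally show ?thesis by (simp add: coef_def power2_eq_square)
qed

lemma entry:
  assumes "i < N" "j < N"
  shows "A $$ (i, j) = (\<Sum>k<N. lam k * (u k i * u k j))"
proof -
  have "(\<Sum>k<N. lam k * (u k i * u k j)) = (\<Sum>k<N. (\<Sum>l<N. A $$ (i, l) * u k l) * u k j)"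
    using assms by (intro sum.cong refl) (simp add: eig)
  also have "\<dots> = (\<Sum>l<N. A $$ (i, l) * (\<Sum>k<N. u k l * u k j))"
    by (simp add: sum_distrib_left sum_distrib_right mult.assoc) (rule sum.swap)
  also have "\<dots> = (\<Sum>l<N. if l = j then A $$ (i, l) else 0)"
    using assms by (intro sum.cong refl) (simp add: complete)
  finally show ?thesis using assms by simp
qed

lemma quadratic_form:
  "(\<Sum>i<N. \<Sum>j<N. A $$ (i, j) * x i * x j) = (\<Sum>k<N. lam k * (coef x k)\<^sup>2)"
proof -
  have "(\<Sum>i<N. \<Sum>j<N. A $$ (i, j) * x i * x j)
      = (\<Sum>i<N. \<Sum>j<N. \<Sum>k<N. lam k * ((u k i * x i) * (u k j * x j)))"
    by (intro sum.cong refl) (simp add: entry sum_distrib_right sum_distrib_left mult_ac)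
  also have "\<dots> = (\<Sum>i<N. \<Sum>k<N. \<Sum>j<N. lam k * ((u k i * x i) * (u k j * x j)))"
    by (intro sum.cong refl sum.swap)
  also have "\<dots> = (\<Sum>k<N. \<Sum>i<N. \<Sum>j<N. lam k * ((u k i * x i) * (u k j * x j)))"
    by (rule sum.swap)
  also have "\<dots> = (\<Sum>k<N. lam k * (coef x k)\<^sup>2)"
    unfolding coef_def power2_eq_square sum_product by (simp add: sum_distrib_left)
  finally show ?thesis .
qed

text \<open>Matrices that are diagonal in the basis \<open>u\<close> multiply like their
  eigenvalues. Starting from \<open>entry\<close> this yields the powers of \<open>A\<close>, whose
  traces are then the power sums of \<open>lam\<close>.\<close>

lemma product_entry:
  assumes X: "\<And>i j. i < N \<Longrightarrow> j < N \<Longrightarrow> X i j = (\<Sum>k<N. p k * (u k i * u k j))"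
    and Y: "\<And>i j. i < N \<Longrightarrow> j < N \<Longrightarrow> Y i j = (\<Sum>k<N. q k * (u k i * u k j))"
    and ij: "i < N" "j < N"
  shows "(\<Sum>l<N. X i l * Y l j) = (\<Sum>k<N. (p k * q k) * (u k i * u k j))"
proof -
  have "(\<Sum>l<N. X i l * Y l j)
      = (\<Sum>l<N. \<Sum>k<N. \<Sum>h<N. p k * q h * u k i * u h j * (u k l * u h l))"
    using ij by (intro sum.cong refl) (simp add: X Y sum_product mult_ac)
  also have "\<dots> = (\<Sum>k<N. \<Sum>l<N. \<Sum>h<N. p k * q h * u k i * u h j * (u k l * u h l))"
    by (rule sum.swap)
  also have "\<dots> = (\<Sum>k<N. \<Sum>h<N. \<Sum>l<N. p k * q h * u k i * u h j * (u k l * u h l))"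
    by (intro sum.cong refl sum.swap)
  also have "\<dots> = (\<Sum>k<N. \<Sum>h<N. if k = h then (p k * q k) * (u k i * u k j) else 0)"
  proof (intro sum.cong refl)
    fix k h assume "k \<in> {..<N}" "h \<in> {..<N}"
    then show "(\<Sum>l<N. p k * q h * u k i * u h j * (u k l * u h l))
        = (if k = h then (p k * q k) * (u k i * u k j) else 0)"
      unfolding sum_distrib_left[symmetric] by (simp add: orth)
  qed
  finally show ?thesis by simp
qed

lemma trace_entry:
  assumes X: "\<And>i j. i < N \<Longrightarrow> j < N \<Longrightarrow> X i j = (\<Sum>k<N. p k * (u k i * u k j))"
  shows "(\<Sum>i<N. X i i) = (\<Sum>k<N. p k)"
proof -
  have "(\<Sum>i<N. X i i) = (\<Sum>i<N. \<Sum>k<N. p k * (u k i * u k i))"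
    by (intro sum.cong refl) (simp add: X)
  also have "\<dots> = (\<Sum>k<N. p k * (\<Sum>i<N. u k i * u k i))"
    by (subst sum.swap) (simp add: sum_distrib_left)
  finally show ?thesis by (simp add: orth)
qed

lemma trace1: "(\<Sum>i<N. A $$ (i, i)) = (\<Sum>k<N. lam k)"
  by (rule trace_entry[of "\<lambda>i j. A $$ (i, j)"]) (rule entry)

lemma trace2: "(\<Sum>i<N. \<Sum>j<N. A $$ (i, j) * A $$ (j, i)) = (\<Sum>k<N. (lam k)\<^sup>2)"
  unfolding power2_eq_square
  by (rule trace_entry[of "\<lambda>i l. \<Sum>j<N. A $$ (i, j) * A $$ (j, l)"])
    (intro product_entry entry; assumption)

lemma trace3:
  "(\<Sum>i<N. \<Sum>l<N. (\<Sum>j<N. A $$ (i, j) * A $$ (j, l)) * A $$ (l, i)) = (\<Sum>k<N. (lam k)^3)"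
proof (rule trace_entry[of "\<lambda>i h. \<Sum>l<N. (\<Sum>j<N. A $$ (i, j) * A $$ (j, l)) * A $$ (l, h)"])
  fix i h assume ih: "i < N" "h < N"
  have "(\<Sum>j<N. A $$ (i, j) * A $$ (j, l)) = (\<Sum>k<N. (lam k * lam k) * (u k i * u k l))"
    if "i < N" "l < N" for i l
    using that by (intro product_entry entry)
  from product_entry[OF this entry ih]
  show "(\<Sum>l<N. (\<Sum>j<N. A $$ (i, j) * A $$ (j, l)) * A $$ (l, h)) = (\<Sum>k<N. lam k ^ 3 * (u k i * u k h))"
    by (simp add: power3_eq_cube)
qed

text \<open>Dimension count: the eigenvectors with index in \<open>K\<close> span a space of
  dimension \<open>card K\<close>, where fewer than \<open>card K\<close> linear conditions have a
  common nonzero solution. Lying in that span is itself imposed by the functionals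
  \<open>u k\<close> with \<open>k \<notin> K\<close>.\<close>

lemma exists_vector:
  assumes "K \<subseteq> {..<N}" "finite F" "card F < card K"
  obtains x where "\<exists>i<N. x i \<noteq> 0" "\<And>w. w \<in> F \<Longrightarrow> (\<Sum>i<N. w i * x i) = 0"
    "\<And>k. k < N \<Longrightarrow> k \<notin> K \<Longrightarrow> coef x k = 0"
proof -
  let ?F = "F \<union> u ` ({..<N} - K)"
  have "card ?F \<le> card F + card ({..<N} - K)"
    using card_Un_le[of F "u ` ({..<N} - K)"] card_image_le[of "{..<N} - K" u] by simp
  also have "card ({..<N} - K) = N - card K"
    using assms(1) by (subst card_Diff_subset) (auto intro: finite_subset)
  also have "card F + (N - card K) < N"
    using assms card_mono[of "{..<N}" K] by simp
  finally obtain x where "\<exists>i<N. x i \<noteq> 0" "\<forall>w\<in>?F. (\<Sum>i<N. w i * x i) = 0"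
    using nonzero_orthogonal_vector[of ?F N] assms(2) by auto
  then show thesis by (intro that[of x]) (auto simp: coef_def)
qed

text \<open>One half of the Courant-Fischer principle, for coordinate subspaces. If fewer than
  \<open>card S\<close> eigenvalues were at least \<open>c\<close>, some nonzero vector supported on
  \<open>S\<close> would be orthogonal to all their eigenvectors, and its form would be strictly
  below \<open>c\<close> times its squared norm.\<close>

lemma card_eigenvalues_ge:
  assumes S: "S \<subseteq> {..<N}"
    and form: "\<And>x. (\<And>i. i < N \<Longrightarrow> i \<notin> S \<Longrightarrow> x i = 0) \<Longrightarrow>
      c * (\<Sum>i<N. (x i)\<^sup>2) \<le> (\<Sum>i<N. \<Sum>j<N. A $$ (i, j) * x i * x j)"
  shows "card S \<le> card {k \<in> {..<N}. c \<le> lam k}"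
proof (rule ccontr)
  define K where "K = {k \<in> {..<N}. c \<le> lam k}"
  assume "\<not> card S \<le> card {k \<in> {..<N}. c \<le> lam k}"
  then have less: "card K < card S" by (simp add: K_def)
  define F where "F = (\<lambda>i j. of_bool (i = j) :: real) ` ({..<N} - S) \<union> u ` K"
  have "card F \<le> card ({..<N} - S) + card K"
    unfolding F_def using card_Un_le[of "(\<lambda>i j. of_bool (i = j) :: real) ` ({..<N} - S)" "u ` K"]
      card_image_le[of "{..<N} - S" "\<lambda>i j. of_bool (i = j) :: real"] card_image_le[of K u]
    by (simp add: K_def)
  also have "card ({..<N} - S) = N - card S"
    using S by (subst card_Diff_subset) (auto intro: finite_subset)
  also have "N - card S + card K < N"
    using less card_mono[of "{..<N}" S] S by simp
  finally have "card F < N" .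
  moreover have "finite F" by (simp add: F_def K_def)
  ultimately obtain x where x: "\<exists>i<N. x i \<noteq> 0" "\<forall>w\<in>F. (\<Sum>i<N. w i * x i) = 0"
    using nonzero_orthogonal_vector[of F N] by auto
  have "x i = 0" if "i < N" "i \<notin> S" for i
  proof -
    have "(\<lambda>j. of_bool (i = j) :: real) \<in> F" using that by (auto simp: F_def)
    from x(2)[rule_format, OF this] have "(\<Sum>j<N. if i = j then x j else 0) = 0"
      by (simp add: of_bool_def if_distrib[of "\<lambda>a. a * _"] cong: if_cong)
    then show ?thesis using that by simp
  qed
  then have "c * (\<Sum>i<N. (x i)\<^sup>2) \<le> (\<Sum>i<N. \<Sum>j<N. A $$ (i, j) * x i * x j)" by (rule form)
  then have le: "(\<Sum>k<N. c * (coef x k)\<^sup>2) \<le> (\<Sum>k<N. lam k * (coef x k)\<^sup>2)"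
    unfolding quadratic_form parseval[of x] sum_distrib_left .
  have zero: "coef x k = 0" if "k \<in> K" for k
    using that x(2) by (auto simp: coef_def F_def)
  have le': "lam k * (coef x k)\<^sup>2 \<le> c * (coef x k)\<^sup>2" if "k < N" for k
  proof (cases "k \<in> K")
    case False
    then show ?thesis using that by (intro mult_right_mono) (auto simp: K_def)
  qed (simp add: zero)
  have "\<exists>k<N. coef x k \<noteq> 0"
  proof (rule ccontr)
    assume "\<not> ?thesis"
    then have "\<forall>i<N. x i = 0" using expand[of _ x] by simp
    with x(1) show False by blast
  qed
  then obtain k where k: "k < N" "coef x k \<noteq> 0" by blast
  then have "k \<notin> K" using zero by blast
  then have "lam k * (coef x k)\<^sup>2 < c * (coef x k)\<^sup>2"
    using k by (intro mult_strict_right_mono) (auto simp: K_def)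
  with k(1) have "\<exists>k\<in>{..<N}. lam k * (coef x k)\<^sup>2 < c * (coef x k)\<^sup>2" by blast
  then have "(\<Sum>k<N. lam k * (coef x k)\<^sup>2) < (\<Sum>k<N. c * (coef x k)\<^sup>2)"
    using le' by (intro sum_strict_mono_ex1) auto
  with le show False by simp
qed

lemma quadratic_form_ge:
  assumes "\<And>k. k < N \<Longrightarrow> lam k < c \<Longrightarrow> coef x k = 0"
  shows "c * (\<Sum>i<N. (x i)\<^sup>2) \<le> (\<Sum>i<N. \<Sum>j<N. A $$ (i, j) * x i * x j)"
  unfolding quadratic_form parseval[of x] sum_distrib_left
proof (rule sum_mono)
  fix k assume "k \<in> {..<N}"
  then show "c * (coef x k)\<^sup>2 \<le> lam k * (coef x k)\<^sup>2"
    using assms[of k] by (cases "lam k < c") (auto intro: mult_right_mono)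
qed

lemma eigenvector_if_coef:
  assumes "\<And>k. k < N \<Longrightarrow> lam k \<noteq> s \<Longrightarrow> coef x k = 0" and "i < N"
  shows "(\<Sum>j<N. A $$ (i, j) * x j) = s * x i"
proof -
  have "(\<Sum>j<N. A $$ (i, j) * x j) = (\<Sum>j<N. \<Sum>k<N. coef x k * (A $$ (i, j) * u k j))"
  proof (intro sum.cong refl)
    fix j assume "j \<in> {..<N}"
    then show "A $$ (i, j) * x j = (\<Sum>k<N. coef x k * (A $$ (i, j) * u k j))"
      using expand[of j x] by (simp add: sum_distrib_left mult_ac)
  qed
  also have "\<dots> = (\<Sum>k<N. coef x k * (\<Sum>j<N. A $$ (i, j) * u k j))"
    by (subst sum.swap) (simp add: sum_distrib_left)
  also have "\<dots> = (\<Sum>k<N. s * (coef x k * u k i))"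
  proof (intro sum.cong refl)
    fix k assume "k \<in> {..<N}"
    then show "coef x k * (\<Sum>j<N. A $$ (i, j) * u k j) = s * (coef x k * u k i)"
      using assms by (cases "lam k = s") (auto simp: eig)
  qed
  also have "\<dots> = s * x i" using expand[OF assms(2), of x] by (simp add: sum_distrib_left)
  finally show ?thesis .
qed

lemma coef_eigenvector:
  assumes "\<And>i. i < N \<Longrightarrow> (\<Sum>j<N. A $$ (i, j) * x j) = s * x i" and "k < N" and "lam k \<noteq> s"
  shows "coef x k = 0"
proof -
  have "s * coef x k = (\<Sum>i<N. u k i * (\<Sum>j<N. A $$ (i, j) * x j))"
    unfolding coef_def sum_distrib_left[of s] by (intro sum.cong refl) (simp add: assms(1))
  also have "\<dots> = (\<Sum>j<N. \<Sum>i<N. u k i * (A $$ (i, j) * x j))"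
    by (simp add: sum_distrib_left) (rule sum.swap)
  also have "\<dots> = (\<Sum>j<N. (\<Sum>i<N. A $$ (j, i) * u k i) * x j)"
    by (intro sum.cong refl) (subst sum_distrib_right, intro sum.cong refl, simp add: sym)
  also have "\<dots> = lam k * coef x k"
    using assms(2) by (simp add: eig coef_def sum_distrib_left mult.assoc)
  finally show ?thesis using assms(3) by simp
qed

lemma card_eigenvalue_ge_2:
  assumes x: "\<And>i. i < N \<Longrightarrow> (\<Sum>j<N. A $$ (i, j) * x j) = s * x i"
    and y: "\<And>i. i < N \<Longrightarrow> (\<Sum>j<N. A $$ (i, j) * y j) = s * y i"
    and indep: "\<And>a b. (\<And>i. i < N \<Longrightarrow> a * x i + b * y i = 0) \<Longrightarrow> a = 0 \<and> b = 0"
  shows "2 \<le> card {k \<in> {..<N}. lam k = s}"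
proof (rule ccontr)
  define K where "K = {k \<in> {..<N}. lam k = s}"
  assume "\<not> 2 \<le> card {k \<in> {..<N}. lam k = s}"
  then have "card K \<le> Suc 0" by (simp add: K_def)
  moreover have "finite K" by (simp add: K_def)
  ultimately have "\<forall>k\<in>K. \<forall>l\<in>K. k = l" by (simp add: card_le_Suc0_iff_eq)
  then obtain h where h: "K \<subseteq> {h}" by (cases "K = {}") auto
  have c: "coef (\<lambda>i. a * x i + b * y i) k = a * coef x k + b * coef y k" for a b k
    by (simp add: coef_def algebra_simps sum.distrib sum_distrib_left)
  have xh: "coef x k = 0" "coef y k = 0" if "k < N" "k \<noteq> h" for k
    using h that coef_eigenvector[OF x] coef_eigenvector[OF y] by (auto simp: K_def)
  have key: "a = 0 \<and> b = 0" if "a * coef x h + b * coef y h = 0" for a b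
  proof (rule indep)
    fix i assume "i < N"
    have "a * coef x k + b * coef y k = 0" if "k < N" for k
      using \<open>a * coef x h + b * coef y h = 0\<close> xh[OF that] by (cases "k = h") auto
    then show "a * x i + b * y i = 0"
      using expand[OF \<open>i < N\<close>, of "\<lambda>i. a * x i + b * y i"] by (simp add: c)
  qed
  \<comment> \<open>All components of \<open>x\<close> and \<open>y\<close> lie along
    \<open>u h\<close>, so this combination cancels. Independence makes its coefficients zero, and
    then \<open>x\<close> alone would be dependent.\<close>
  from key[of "coef y h" "- coef x h"] have "coef y h = 0" "coef x h = 0" by auto
  with key[of 1 0] show False by simp
qed

end

lemma sum_eq_of_image_mset_eq:
  fixes f :: "real \<Rightarrow> real" and lam lam' :: "nat \<Rightarrow> real"
  assumes "image_mset lam (mset_set {..<N}) = image_mset lam' (mset_set {..<M})"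
  shows "(\<Sum>k<N. f (lam k)) = (\<Sum>k<M. f (lam' k))"
proof -
  have "(\<Sum>k<N. f (lam k)) = sum_mset (image_mset f (image_mset lam (mset_set {..<N})))"
    by (simp add: sum_unfold_sum_mset image_mset.compositionality comp_def)
  also have "\<dots> = (\<Sum>k<M. f (lam' k))"
    unfolding assms by (simp add: sum_unfold_sum_mset image_mset.compositionality comp_def)
  finally show ?thesis .
qed

lemma card_eq_of_image_mset_eq:
  fixes lam lam' :: "nat \<Rightarrow> real"
  assumes "image_mset lam (mset_set {..<N}) = image_mset lam' (mset_set {..<M})"
  shows "card {k \<in> {..<N}. P (lam k)} = card {k \<in> {..<M}. P (lam' k)}"
proof -
  have eq: "(\<Sum>k<N. of_bool (P (lam k)) :: real) = (\<Sum>k<M. of_bool (P (lam' k)))"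
    by (rule sum_eq_of_image_mset_eq[OF assms, of "\<lambda>x. of_bool (P x)"])
  have card: "(\<Sum>k<n. of_bool (P (l k))) = real (card {k \<in> {..<n}. P (l k)})" for l and n :: nat
    by (simp add: sum_of_bool_eq Int_def)
  show ?thesis using eq unfolding card by simp
qed

section \<open>The matrix \<open>A\<^sub>\<alpha>\<close> and its traces\<close>

abbreviation adj :: "(nat \<Rightarrow> nat \<Rightarrow> bool) \<Rightarrow> nat \<Rightarrow> nat \<Rightarrow> real" where
  "adj E i j \<equiv> of_bool (E i j)"

abbreviation deg :: "nat \<Rightarrow> (nat \<Rightarrow> nat \<Rightarrow> bool) \<Rightarrow> nat \<Rightarrow> real" where
  "deg N E i \<equiv> real (Defs.degree N E i)"

text \<open>Each triangle at \<open>i\<close> is counted twice.\<close>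
definition triangles_at :: "nat \<Rightarrow> (nat \<Rightarrow> nat \<Rightarrow> bool) \<Rightarrow> nat \<Rightarrow> real" where
  "triangles_at N E i = (\<Sum>j<N. \<Sum>l<N. adj E i j * adj E j l * adj E l i)"

lemma deg_eq_sum: "deg N E i = (\<Sum>j<N. adj E i j)"
  by (simp add: Defs.degree_def sum_of_bool_eq Int_def lessThan_atLeast0)

lemma A_alpha_carrier [simp]: "A_alpha \<alpha> N E \<in> carrier_mat N N"
  by (simp add: A_alpha_def)

lemma A_alpha_index: "i < N \<Longrightarrow> j < N \<Longrightarrow>
    A_alpha \<alpha> N E $$ (i, j) = \<alpha> * (of_bool (i = j) * deg N E i) + (1 - \<alpha>) * adj E i j"
  by (simp add: A_alpha_def)

lemma simple_graph_sym: "simple_graph N E \<Longrightarrow> E i j = E j i"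
  by (auto simp: simple_graph_def)

lemma simple_graph_irrefl: "simple_graph N E \<Longrightarrow> \<not> E i i"
  by (auto simp: simple_graph_def)

lemma A_alpha_eigenbasis:
  assumes "simple_graph N E"
  obtains lam u where "eigenbasis N (A_alpha \<alpha> N E) lam u"
    and "A_alpha_spectrum \<alpha> N E = image_mset lam (mset_set {..<N})"
proof -
  have sym: "A_alpha \<alpha> N E $$ (i, j) = A_alpha \<alpha> N E $$ (j, i)" if "i < N" "j < N" for i j
    using that simple_graph_sym[OF assms, of i j] by (auto simp: A_alpha_index)
  obtain lam u where "orthonormal_eigenvectors N (A_alpha \<alpha> N E) N lam u"
    "proots (char_poly (A_alpha \<alpha> N E)) = image_mset lam (mset_set {..<N})"
    "\<And>i j. i < N \<Longrightarrow> j < N \<Longrightarrow> (\<Sum>k<N. u k i * u k j) = of_bool (i = j)"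
    using real_symmetric_spectral[OF A_alpha_carrier sym] by metis
  with sym show thesis
    by (intro that[of lam u]) (auto simp: A_alpha_spectrum_def intro!: eigenbasis.intro)
qed

lemma A_alpha_apply:
  assumes "i < N"
  shows "(\<Sum>j<N. A_alpha \<alpha> N E $$ (i, j) * x j)
    = \<alpha> * deg N E i * x i + (1 - \<alpha>) * (\<Sum>j<N. adj E i j * x j)"
proof -
  have "(\<Sum>j<N. A_alpha \<alpha> N E $$ (i, j) * x j)
      = (\<Sum>j<N. (if i = j then \<alpha> * deg N E i * x i else 0) + (1 - \<alpha>) * (adj E i j * x j))"
    using assms by (intro sum.cong refl) (auto simp: A_alpha_index algebra_simps)
  also have "\<dots> = (\<Sum>j<N. if i = j then \<alpha> * deg N E i * x i else 0)
      + (1 - \<alpha>) * (\<Sum>j<N. adj E i j * x j)"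
    by (simp only: sum.distrib sum_distrib_left)
  finally show ?thesis using assms by simp
qed

lemma A_alpha_form:
  "(\<Sum>i<N. \<Sum>j<N. A_alpha \<alpha> N E $$ (i, j) * x i * x j)
    = \<alpha> * (\<Sum>i<N. deg N E i * (x i)\<^sup>2) + (1 - \<alpha>) * (\<Sum>i<N. \<Sum>j<N. adj E i j * x i * x j)"
proof -
  have "(\<Sum>i<N. \<Sum>j<N. A_alpha \<alpha> N E $$ (i, j) * x i * x j)
      = (\<Sum>i<N. x i * (\<Sum>j<N. A_alpha \<alpha> N E $$ (i, j) * x j))"
    by (simp add: sum_distrib_left mult_ac)
  also have "\<dots> = (\<Sum>i<N. \<alpha> * (deg N E i * (x i)\<^sup>2) + (1 - \<alpha>) * (x i * (\<Sum>j<N. adj E i j * x j)))"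
    by (intro sum.cong refl) (simp only: A_alpha_apply lessThan_iff, simp only: algebra_simps power2_eq_square)
  also have "\<dots> = \<alpha> * (\<Sum>i<N. deg N E i * (x i)\<^sup>2) + (1 - \<alpha>) * (\<Sum>i<N. x i * (\<Sum>j<N. adj E i j * x j))"
    by (simp only: sum.distrib sum_distrib_left)
  also have "(\<Sum>i<N. x i * (\<Sum>j<N. adj E i j * x j)) = (\<Sum>i<N. \<Sum>j<N. adj E i j * x i * x j)"
    by (simp only: sum_distrib_left mult_ac)
  finally show ?thesis .
qed

lemma sum_adj_deg:
  assumes "simple_graph N E"
  shows "(\<Sum>i<N. \<Sum>j<N. adj E i j * f i) = (\<Sum>i<N. deg N E i * f i)"
    and "(\<Sum>i<N. \<Sum>j<N. adj E i j * f j) = (\<Sum>i<N. deg N E i * f i)"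
proof -
  show *: "(\<Sum>i<N. \<Sum>j<N. adj E i j * f i) = (\<Sum>i<N. deg N E i * f i)"
    by (simp add: deg_eq_sum sum_distrib_right)
  have "(\<Sum>i<N. \<Sum>j<N. adj E i j * f j) = (\<Sum>j<N. \<Sum>i<N. adj E i j * f j)"
    by (rule sum.swap)
  also have "\<dots> = (\<Sum>j<N. \<Sum>i<N. adj E j i * f j)"
    by (intro sum.cong refl) (simp add: simple_graph_sym[OF assms])
  finally show "(\<Sum>i<N. \<Sum>j<N. adj E i j * f j) = (\<Sum>i<N. deg N E i * f i)" using * by simp
qed

text \<open>Twice the quadratic forms of \<open>D + A\<close> and \<open>D - A\<close>, as every
  edge is counted in both directions. The first yields positive semidefiniteness for the complement,
  the second a sum of squares over the edges of the join.\<close>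

lemma edge_squares:
  assumes "simple_graph N E"
  shows "(\<Sum>i<N. \<Sum>j<N. adj E i j * (x i + x j)\<^sup>2)
      = 2 * (\<Sum>i<N. deg N E i * (x i)\<^sup>2) + 2 * (\<Sum>i<N. \<Sum>j<N. adj E i j * x i * x j)"
    and "(\<Sum>i<N. \<Sum>j<N. adj E i j * (x i - x j)\<^sup>2)
      = 2 * (\<Sum>i<N. deg N E i * (x i)\<^sup>2) - 2 * (\<Sum>i<N. \<Sum>j<N. adj E i j * x i * x j)"
proof -
  have "(\<Sum>i<N. \<Sum>j<N. adj E i j * (x i + x j)\<^sup>2)
      = (\<Sum>i<N. \<Sum>j<N. adj E i j * (x i)\<^sup>2 + adj E i j * (x j)\<^sup>2 + 2 * (adj E i j * x i * x j))"
    by (intro sum.cong refl) (simp add: algebra_simps power2_eq_square)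
  then show "(\<Sum>i<N. \<Sum>j<N. adj E i j * (x i + x j)\<^sup>2)
      = 2 * (\<Sum>i<N. deg N E i * (x i)\<^sup>2) + 2 * (\<Sum>i<N. \<Sum>j<N. adj E i j * x i * x j)"
    by (simp only: sum.distrib sum_adj_deg[OF assms, of "\<lambda>i. (x i)\<^sup>2"]
        sum_distrib_left[symmetric])
  have "(\<Sum>i<N. \<Sum>j<N. adj E i j * (x i - x j)\<^sup>2)
      = (\<Sum>i<N. \<Sum>j<N. adj E i j * (x i)\<^sup>2 + adj E i j * (x j)\<^sup>2 - 2 * (adj E i j * x i * x j))"
    by (intro sum.cong refl) (simp add: algebra_simps power2_eq_square)
  then show "(\<Sum>i<N. \<Sum>j<N. adj E i j * (x i - x j)\<^sup>2)
      = 2 * (\<Sum>i<N. deg N E i * (x i)\<^sup>2) - 2 * (\<Sum>i<N. \<Sum>j<N. adj E i j * x i * x j)"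
    by (simp only: sum.distrib sum_subtractf sum_adj_deg[OF assms, of "\<lambda>i. (x i)\<^sup>2"]
        sum_distrib_left[symmetric])
qed

section \<open>Traces of the first three powers\<close>

lemma A_alpha_trace1:
  assumes "simple_graph N E"
  shows "(\<Sum>i<N. A_alpha \<alpha> N E $$ (i, i)) = \<alpha> * (\<Sum>i<N. deg N E i)"
  by (simp add: A_alpha_index simple_graph_irrefl[OF assms] sum_distrib_left)

lemma A_alpha_trace2:
  assumes "simple_graph N E"
  shows "(\<Sum>i<N. \<Sum>j<N. A_alpha \<alpha> N E $$ (i, j) * A_alpha \<alpha> N E $$ (j, i))
    = \<alpha>\<^sup>2 * (\<Sum>i<N. (deg N E i)\<^sup>2) + (1 - \<alpha>)\<^sup>2 * (\<Sum>i<N. deg N E i)"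
proof -
  have "(\<Sum>j<N. A_alpha \<alpha> N E $$ (i, j) * A_alpha \<alpha> N E $$ (j, i))
      = \<alpha>\<^sup>2 * (deg N E i)\<^sup>2 + (1 - \<alpha>)\<^sup>2 * deg N E i" if i: "i < N" for i
  proof -
    have "(\<Sum>j<N. A_alpha \<alpha> N E $$ (i, j) * A_alpha \<alpha> N E $$ (j, i))
        = (\<Sum>j<N. (if i = j then \<alpha>\<^sup>2 * (deg N E i)\<^sup>2 else 0) + (1 - \<alpha>)\<^sup>2 * adj E i j)"
      using i simple_graph_irrefl[OF assms] simple_graph_sym[OF assms]
      by (intro sum.cong refl) (auto simp: A_alpha_index power2_eq_square)
    then show ?thesis using i by (simp add: sum.distrib sum_distrib_left deg_eq_sum)
  qed
  then show ?thesis by (simp add: sum.distrib sum_distrib_left)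
qed

lemma A_alpha_trace3:
  assumes "simple_graph N E"
  shows "(\<Sum>i<N. \<Sum>l<N. (\<Sum>j<N. A_alpha \<alpha> N E $$ (i, j) * A_alpha \<alpha> N E $$ (j, l)) *
        A_alpha \<alpha> N E $$ (l, i))
    = \<alpha>^3 * (\<Sum>i<N. (deg N E i)^3) + 3 * \<alpha> * (1 - \<alpha>)\<^sup>2 * (\<Sum>i<N. (deg N E i)\<^sup>2)
      + (1 - \<alpha>)^3 * (\<Sum>i<N. triangles_at N E i)"
proof -
  define b where "b = 1 - \<alpha>"
  define P where "P i l = (\<Sum>j<N. adj E i j * adj E j l)" for i l
  let ?d = "deg N E"
  \<comment> \<open>The square of \<open>\<alpha> D + b A\<close>. In the trace of the cube, words
    with a single \<open>A\<close> die on the zero diagonal, each of the three words with two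
    \<open>A\<close> contributes \<open>\<alpha> * b\<^sup>2\<close> times the sum of squared
    degrees, and \<open>A^3\<close> counts closed walks of length three.\<close>
  have sq: "(\<Sum>j<N. A_alpha \<alpha> N E $$ (i, j) * A_alpha \<alpha> N E $$ (j, l))
      = of_bool (i = l) * \<alpha>\<^sup>2 * (?d i)\<^sup>2 + \<alpha> * b * (?d i + ?d l) * adj E i l + b\<^sup>2 * P i l"
    if il: "i < N" "l < N" for i l
  proof -
    have "(\<Sum>j<N. A_alpha \<alpha> N E $$ (i, j) * A_alpha \<alpha> N E $$ (j, l))
        = \<alpha> * ?d i * A_alpha \<alpha> N E $$ (i, l) + b * (\<Sum>j<N. adj E i j * A_alpha \<alpha> N E $$ (j, l))"
      unfolding b_def using il by (rule_tac A_alpha_apply)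
    also have "(\<Sum>j<N. adj E i j * A_alpha \<alpha> N E $$ (j, l))
        = (\<Sum>j<N. (if j = l then \<alpha> * ?d l * adj E i l else 0) + b * (adj E i j * adj E j l))"
      using il by (intro sum.cong refl) (auto simp: A_alpha_index b_def)
    also have "\<dots> = (\<Sum>j<N. if j = l then \<alpha> * ?d l * adj E i l else 0) + b * P i l"
      unfolding P_def by (simp only: sum.distrib sum_distrib_left)
    also have "\<dots> = \<alpha> * ?d l * adj E i l + b * P i l" using il by simp
    finally show ?thesis
      using il by (simp add: A_alpha_index b_def algebra_simps power2_eq_square)
  qed
  have Pd: "P i i = ?d i" if "i < N" for i
    unfolding P_def deg_eq_sum by (intro sum.cong refl) (use simple_graph_sym[OF assms] in auto)
  have "(\<Sum>l<N. (\<Sum>j<N. A_alpha \<alpha> N E $$ (i, j) * A_alpha \<alpha> N E $$ (j, l)) *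
        A_alpha \<alpha> N E $$ (l, i))
      = (\<alpha>^3 * (?d i)^3 + \<alpha> * b\<^sup>2 * (?d i)\<^sup>2) + \<alpha> * b\<^sup>2 * (\<Sum>l<N. adj E i l * ?d i)
        + \<alpha> * b\<^sup>2 * (\<Sum>l<N. adj E i l * ?d l) + b^3 * (\<Sum>l<N. P i l * adj E l i)"
    if i: "i < N" for i
  proof -
    have "(\<Sum>l<N. (\<Sum>j<N. A_alpha \<alpha> N E $$ (i, j) * A_alpha \<alpha> N E $$ (j, l)) *
          A_alpha \<alpha> N E $$ (l, i))
        = (\<Sum>l<N. (if i = l then \<alpha>^3 * (?d i)^3 + \<alpha> * b\<^sup>2 * (?d i)\<^sup>2 else 0)
            + \<alpha> * b\<^sup>2 * (adj E i l * ?d i) + \<alpha> * b\<^sup>2 * (adj E i l * ?d l) + b^3 * (P i l * adj E l i))"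
    proof (intro sum.cong refl)
      fix l assume "l \<in> {..<N}"
      then have l: "l < N" by simp
      show "(\<Sum>j<N. A_alpha \<alpha> N E $$ (i, j) * A_alpha \<alpha> N E $$ (j, l)) * A_alpha \<alpha> N E $$ (l, i)
        = (if i = l then \<alpha>^3 * (?d i)^3 + \<alpha> * b\<^sup>2 * (?d i)\<^sup>2 else 0)
            + \<alpha> * b\<^sup>2 * (adj E i l * ?d i) + \<alpha> * b\<^sup>2 * (adj E i l * ?d l) + b^3 * (P i l * adj E l i)"
        unfolding sq[OF i l] using i l simple_graph_irrefl[OF assms, of i] simple_graph_sym[OF assms, of i l]
        by (auto simp: A_alpha_index Pd power2_eq_square power3_eq_cube algebra_simps simp flip: b_def)
    qed
    also have "\<dots> = (\<Sum>l<N. if i = l then \<alpha>^3 * (?d i)^3 + \<alpha> * b\<^sup>2 * (?d i)\<^sup>2 else 0)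
        + \<alpha> * b\<^sup>2 * (\<Sum>l<N. adj E i l * ?d i)
        + \<alpha> * b\<^sup>2 * (\<Sum>l<N. adj E i l * ?d l) + b^3 * (\<Sum>l<N. P i l * adj E l i)"
      by (simp only: sum.distrib sum_distrib_left)
    finally show ?thesis using i by simp
  qed
  then have "(\<Sum>i<N. \<Sum>l<N. (\<Sum>j<N. A_alpha \<alpha> N E $$ (i, j) * A_alpha \<alpha> N E $$ (j, l)) *
        A_alpha \<alpha> N E $$ (l, i))
    = (\<Sum>i<N. (\<alpha>^3 * (?d i)^3 + \<alpha> * b\<^sup>2 * (?d i)\<^sup>2) + \<alpha> * b\<^sup>2 * (\<Sum>l<N. adj E i l * ?d i)
        + \<alpha> * b\<^sup>2 * (\<Sum>l<N. adj E i l * ?d l) + b^3 * (\<Sum>l<N. P i l * adj E l i))"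
    by (intro sum.cong refl) simp
  also have "\<dots> = \<alpha>^3 * (\<Sum>i<N. (?d i)^3) + \<alpha> * b\<^sup>2 * (\<Sum>i<N. (?d i)\<^sup>2)
      + \<alpha> * b\<^sup>2 * (\<Sum>i<N. \<Sum>l<N. adj E i l * ?d i) + \<alpha> * b\<^sup>2 * (\<Sum>i<N. \<Sum>l<N. adj E i l * ?d l)
      + b^3 * (\<Sum>i<N. \<Sum>l<N. P i l * adj E l i)"
    by (simp only: sum.distrib sum_distrib_left)
  also have "(\<Sum>i<N. \<Sum>l<N. adj E i l * ?d i) = (\<Sum>i<N. (?d i)\<^sup>2)"
    unfolding sum_adj_deg(1)[OF assms, of ?d] power2_eq_square ..
  also have "(\<Sum>i<N. \<Sum>l<N. adj E i l * ?d l) = (\<Sum>i<N. (?d i)\<^sup>2)"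
    unfolding sum_adj_deg(2)[OF assms, of ?d] power2_eq_square ..
  also have "(\<Sum>i<N. \<Sum>l<N. P i l * adj E l i) = (\<Sum>i<N. triangles_at N E i)"
    unfolding triangles_at_def P_def sum_distrib_right
    by (intro sum.cong refl sum.swap)
  finally show ?thesis by (simp add: b_def algebra_simps)
qed

lemma cospectral_invariants:
  assumes E: "simple_graph N E" and F: "simple_graph M F" and \<alpha>: "0 < \<alpha>"
    and spec: "A_alpha_spectrum \<alpha> M F = A_alpha_spectrum \<alpha> N E"
  shows "M = N"
    and "(\<Sum>i<M. deg M F i) = (\<Sum>i<N. deg N E i)"
    and "(\<Sum>i<M. (deg M F i)\<^sup>2) = (\<Sum>i<N. (deg N E i)\<^sup>2)"
    and "\<alpha>^3 * (\<Sum>i<M. (deg M F i)^3) + (1 - \<alpha>)^3 * (\<Sum>i<M. triangles_at M F i)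
       = \<alpha>^3 * (\<Sum>i<N. (deg N E i)^3) + (1 - \<alpha>)^3 * (\<Sum>i<N. triangles_at N E i)"
proof -
  obtain lE uE where lE: "eigenbasis N (A_alpha \<alpha> N E) lE uE"
    "A_alpha_spectrum \<alpha> N E = image_mset lE (mset_set {..<N})"
    using A_alpha_eigenbasis[OF E] .
  obtain lF uF where lF: "eigenbasis M (A_alpha \<alpha> M F) lF uF"
    "A_alpha_spectrum \<alpha> M F = image_mset lF (mset_set {..<M})"
    using A_alpha_eigenbasis[OF F] .
  note eq = sum_eq_of_image_mset_eq[OF spec[unfolded lE(2) lF(2)]]
  from eq[of "\<lambda>_. 1"] show "M = N" by simp
  from eq[of "\<lambda>x. x"] \<alpha> show 1: "(\<Sum>i<M. deg M F i) = (\<Sum>i<N. deg N E i)"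
    by (simp flip: eigenbasis.trace1[OF lE(1)] eigenbasis.trace1[OF lF(1)]
        add: A_alpha_trace1[OF E] A_alpha_trace1[OF F])
  from eq[of "\<lambda>x. x\<^sup>2"]
  have "\<alpha>\<^sup>2 * (\<Sum>i<M. (deg M F i)\<^sup>2) + (1 - \<alpha>)\<^sup>2 * (\<Sum>i<M. deg M F i)
      = \<alpha>\<^sup>2 * (\<Sum>i<N. (deg N E i)\<^sup>2) + (1 - \<alpha>)\<^sup>2 * (\<Sum>i<N. deg N E i)"
    unfolding eigenbasis.trace2[OF lE(1), symmetric] eigenbasis.trace2[OF lF(1), symmetric]
      A_alpha_trace2[OF E] A_alpha_trace2[OF F] .
  with 1 \<alpha> show 2: "(\<Sum>i<M. (deg M F i)\<^sup>2) = (\<Sum>i<N. (deg N E i)\<^sup>2)" by simp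
  from eq[of "\<lambda>x. x^3"]
  show "\<alpha>^3 * (\<Sum>i<M. (deg M F i)^3) + (1 - \<alpha>)^3 * (\<Sum>i<M. triangles_at M F i)
       = \<alpha>^3 * (\<Sum>i<N. (deg N E i)^3) + (1 - \<alpha>)^3 * (\<Sum>i<N. triangles_at N E i)"
    unfolding eigenbasis.trace3[OF lE(1), symmetric] eigenbasis.trace3[OF lF(1), symmetric]
      A_alpha_trace3[OF E] A_alpha_trace3[OF F] 2 by simp
qed

section \<open>The complement on vectors of coordinate sum zero\<close>

lemma simple_graph_complement:
  "simple_graph N (\<lambda>i j. i < N \<and> j < N \<and> i \<noteq> j \<and> \<not> E i j)" if "simple_graph N E"
  using that by (auto simp: simple_graph_def)

text \<open>The all-ones matrix vanishes on sum-zero vectors, so there the forms of the graph and of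
  its complement \<open>C\<close> add up to \<open>\<alpha> * N - 1\<close> times the squared norm.
  The hypothesis \<open>ge\<close> thus says that the form of \<open>C\<close> is at most 0. It
  equals \<open>(2 * \<alpha> - 1) * ?dC + (1 - \<alpha>) * (?dC + ?aC)\<close> with both summands
  nonnegative, so each term of \<open>?dC\<close> is 0.\<close>

lemma form_sum_zero_ge:
  assumes E: "simple_graph N E" and \<alpha>: "1/2 < \<alpha>" "\<alpha> < 1"
    and sum0: "(\<Sum>i<N. x i) = 0"
    and ge: "(\<alpha> * real N - 1) * (\<Sum>i<N. (x i)\<^sup>2) \<le> (\<Sum>i<N. \<Sum>j<N. A_alpha \<alpha> N E $$ (i, j) * x i * x j)"
    and i: "i < N" "deg N E i < real N - 1"
  shows "x i = 0"
proof -
  define C where "C i j \<longleftrightarrow> i < N \<and> j < N \<and> i \<noteq> j \<and> \<not> E i j" for i j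
  have C: "simple_graph N C" unfolding C_def by (rule simple_graph_complement[OF E])
  have adjC: "adj C i j = 1 - of_bool (i = j) - adj E i j" if "i < N" "j < N" for i j
    using that simple_graph_irrefl[OF E, of i] by (auto simp: C_def)
  have degC: "deg N C i = real N - 1 - deg N E i" if "i < N" for i
  proof -
    have "deg N C i = (\<Sum>j<N. 1 - (if i = j then 1 else 0) - adj E i j)"
      unfolding deg_eq_sum using that by (intro sum.cong refl) (simp add: adjC)
    then show ?thesis using that by (simp add: sum_subtractf deg_eq_sum)
  qed
  let ?n = "\<Sum>i<N. (x i)\<^sup>2"
  let ?dE = "\<Sum>i<N. deg N E i * (x i)\<^sup>2" and ?dC = "\<Sum>i<N. deg N C i * (x i)\<^sup>2"
  let ?aE = "\<Sum>i<N. \<Sum>j<N. adj E i j * x i * x j" and ?aC = "\<Sum>i<N. \<Sum>j<N. adj C i j * x i * x j"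
  have dC: "?dC = (real N - 1) * ?n - ?dE"
    by (simp add: degC left_diff_distrib sum_subtractf sum_distrib_left)
  have "?aC = (\<Sum>i<N. \<Sum>j<N. x i * x j - (if i = j then (x i)\<^sup>2 else 0) - adj E i j * x i * x j)"
    by (intro sum.cong refl) (auto simp: adjC algebra_simps power2_eq_square)
  also have "\<dots> = (\<Sum>i<N. x i) * (\<Sum>j<N. x j) - ?n - ?aE"
    by (simp add: sum_subtractf sum_product)
  finally have aC: "?aC = - ?n - ?aE" using sum0 by simp
  have "0 \<le> (\<Sum>i<N. \<Sum>j<N. adj C i j * (x i + x j)\<^sup>2)"
    by (intro sum_nonneg) auto
  then have nn: "0 \<le> ?dC + ?aC" unfolding edge_squares(1)[OF C] by simp
  have "(\<alpha> * real N - 1) * ?n \<le> \<alpha> * ?dE + (1 - \<alpha>) * ?aE" using ge by (simp only: A_alpha_form)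
  then have le0: "\<alpha> * ?dC + (1 - \<alpha>) * ?aC \<le> 0" unfolding dC aC by (simp add: algebra_simps)
  have "(2 * \<alpha> - 1) * ?dC + (1 - \<alpha>) * (?dC + ?aC) \<le> 0" using le0 by (simp add: algebra_simps)
  moreover have "0 \<le> (1 - \<alpha>) * (?dC + ?aC)" using nn \<alpha> by simp
  ultimately have "(2 * \<alpha> - 1) * ?dC \<le> 0" by linarith
  then have "?dC \<le> 0" using \<alpha> by (simp add: mult_le_0_iff)
  moreover have "deg N C i * (x i)\<^sup>2 \<le> ?dC"
    using i by (intro member_le_sum) auto
  ultimately have "deg N C i * (x i)\<^sup>2 \<le> 0" by linarith
  moreover have "deg N C i > 0" using i degC by simp
  ultimately show ?thesis by (simp add: mult_le_0_iff)
qed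

section \<open>The graph \<open>K\<^sub>m \<or> P\<^sub>n\<close>\<close>

text \<open>Solving the recurrence, \<open>z 1 \<noteq> 0\<close> would force \<open>sin ((n + 1) \<pi> / l) + \<rho> sin ((n - 1) \<pi> / l) = 0\<close>.
  The two sines can have opposite signs only if \<open>l\<close> divides \<open>n\<close>, and then their ratio is \<open>-1\<close>.\<close>
lemma path_recurrence_trivial:
  fixes z :: "nat \<Rightarrow> real"
  assumes l: "3 \<le> l" and \<rho>: "1 < \<rho>" and n: "1 \<le> n"
    and rec: "\<And>i. 1 \<le> i \<Longrightarrow> i \<le> n \<Longrightarrow> z (Suc i) = 2 * cos (2 * pi / real l) * z i - z (i - 1)"
    and z0: "z 0 = - \<rho> * z 1" and zn: "z (Suc n) = - \<rho> * z n" and anti: "z 1 + z n = 0"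
    and i: "i \<le> Suc n"
  shows "z i = 0"
proof -
  define t where "t = pi / real l"
  define w where "w = 2 * t"
  have w_eq: "2 * pi / real l = w" by (simp add: w_def t_def)
  have t0: "0 < t" "3 * t \<le> pi" using l by (auto simp: t_def field_simps)
  have sinw: "sin w > 0" using t0 by (intro sin_gt_zero) (auto simp: w_def)
  \<comment> \<open>Both sides obey the same recurrence and agree at 0 and 1; the summand with
    \<open>\<rho>\<close> encodes the left boundary condition.\<close>
  have closed: "z i * sin w = z 1 * (sin (real i * w) + \<rho> * sin ((real i - 1) * w))"
    if "i \<le> Suc n" for i
    using that
  proof (induction i rule: less_induct)
    case (less i)
    consider "i = 0" | "i = 1" | j where "i = Suc j" "1 \<le> j" by (cases i) force+
    then show ?case
    proof cases
      case 1
      then show ?thesis by (simp add: z0)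
    next
      case 2
      then show ?thesis by simp
    next
      case 3
      have zj: "z j * sin w = z 1 * (sin (real j * w) + \<rho> * sin ((real j - 1) * w))"
        using less 3 by simp
      have zp: "z (j - 1) * sin w = z 1 * (sin ((real j - 1) * w) + \<rho> * sin ((real j - 2) * w))"
        using less.IH[of "j - 1"] less.prems 3 by (simp add: of_nat_diff)
      have s: "2 * cos w * sin x = sin (x + w) + sin (x - w)" for x
        by (simp add: sin_add sin_diff)
      have zi: "z i = 2 * cos w * z j - z (j - 1)"
        using rec[of j] 3 less.prems unfolding w_eq by simp
      have "z i * sin w = 2 * cos w * (z j * sin w) - z (j - 1) * sin w"
        unfolding zi by (simp add: algebra_simps)
      also have "\<dots> = z 1 * ((2 * cos w * sin (real j * w) - sin ((real j - 1) * w))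
          + \<rho> * (2 * cos w * sin ((real j - 1) * w) - sin ((real j - 2) * w)))"
        unfolding zj zp by (simp only: algebra_simps)
      also have "2 * cos w * sin (real j * w) - sin ((real j - 1) * w) = sin (real i * w)"
        unfolding s using 3 by (simp add: algebra_simps)
      also have "2 * cos w * sin ((real j - 1) * w) - sin ((real j - 2) * w) = sin ((real i - 1) * w)"
        unfolding s using 3 by (simp add: algebra_simps)
      finally show ?thesis .
    qed
  qed
  have "z 1 = 0"
  proof (rule ccontr)
    assume z1: "z 1 \<noteq> 0"
    define B where "B = sin ((real n + 1) * t) + \<rho> * sin ((real n - 1) * t)"
    have "z n = - z 1" using anti by linarith
    have "z 1 * (sin (real n * w) + \<rho> * sin ((real n - 1) * w)) = - z 1 * sin w"
      using closed[of n] \<open>z n = - z 1\<close> by simp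
    then have "z 1 * (sin (real n * w) + \<rho> * sin ((real n - 1) * w) + sin w) = 0"
      by (simp add: algebra_simps)
    then have e1: "sin (real n * w) + \<rho> * sin ((real n - 1) * w) + sin w = 0" using z1 by simp
    have "z (Suc n) = \<rho> * z 1" using zn \<open>z n = - z 1\<close> by simp
    then have "\<rho> * z 1 * sin w = z 1 * (sin ((real n + 1) * w) + \<rho> * sin (real n * w))"
      using closed[of "Suc n"] by (simp add: add.commute)
    then have "z 1 * (sin ((real n + 1) * w) + \<rho> * sin (real n * w) - \<rho> * sin w) = 0"
      by (simp add: algebra_simps)
    then have e2: "sin ((real n + 1) * w) + \<rho> * sin (real n * w) - \<rho> * sin w = 0" using z1 by simp
    have nw: "real n * w = (real n + 1) * t + (real n - 1) * t"
      "w = (real n + 1) * t - (real n - 1) * t"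
      "(real n - 1) * w = (real n - 1) * t + (real n - 1) * t"
      "(real n + 1) * w = (real n + 1) * t + (real n + 1) * t"
      by (simp_all add: w_def algebra_simps)
    \<comment> \<open>With \<open>n * w = p + q\<close> and \<open>w = p - q\<close>, antisymmetry
      and the right boundary condition factor as \<open>2 * cos q * B = 0\<close> and
      \<open>2 * cos p * B = 0\<close>. The cosines cannot both vanish, since
      \<open>sin (p - q) \<noteq> 0\<close>; hence \<open>B = 0\<close>.\<close>
    define p q where "p = (real n + 1) * t" and "q = (real n - 1) * t"
    have c1: "cos q * B = 0" and c2: "cos p * B = 0"
    proof -
      have "sin (p + q) + \<rho> * sin (q + q) + sin (p - q) = 0"
        using e1 nw unfolding p_def q_def by metis
      then have "2 * (cos q * (sin p + \<rho> * sin q)) = 0"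
        unfolding sin_add sin_diff by (simp add: algebra_simps)
      then show "cos q * B = 0" by (simp add: B_def p_def q_def)
      have "sin (p + p) + \<rho> * sin (p + q) - \<rho> * sin (p - q) = 0"
        using e2 nw unfolding p_def q_def by metis
      then have "2 * (cos p * (sin p + \<rho> * sin q)) = 0"
        unfolding sin_add sin_diff by (simp add: algebra_simps)
      then show "cos p * B = 0" by (simp add: B_def p_def q_def)
    qed
    have "B = 0"
    proof (rule ccontr)
      assume "B \<noteq> 0"
      then have "cos p = 0" "cos q = 0" using c1 c2 by auto
      then have "sin (p - q) = 0" by (simp add: sin_diff)
      moreover have "p - q = w" using nw(2) by (simp add: p_def q_def)
      ultimately show False using sinw by simp
    qed
    \<comment> \<open>Changing \<open>n\<close> by a multiple of \<open>l\<close> shifts both angles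
      by the same multiple of \<open>pi\<close> and alters \<open>B\<close> at most in sign. For a
      remainder \<open>r \<ge> 1\<close> both angles lie between 0 and \<open>pi\<close>, so the
      sines are nonnegative.\<close>
    define r where "r = n mod l"
    define k where "k = n div l"
    have nk: "real n = real k * real l + real r"
      unfolding r_def k_def by (metis div_mult_mod_eq of_nat_add of_nat_mult)
    have rl: "r < l" using l by (simp add: r_def)
    have lt: "real l * t = pi" using l by (simp add: t_def)
    have shift: "sin ((real n + c) * t) = (-1)^k * sin ((real r + c) * t)" for c
    proof -
      have "(real n + c) * t = (real r + c) * t + real k * pi"
        unfolding nk by (simp add: algebra_simps flip: lt)
      then show ?thesis by (simp add: sin_add)
    qed
    have "(-1)^k * (sin ((real r + 1) * t) + \<rho> * sin ((real r - 1) * t)) = 0"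
      using \<open>B = 0\<close> shift[of 1] shift[of "-1"] by (simp add: B_def algebra_simps)
    then have key: "sin ((real r + 1) * t) + \<rho> * sin ((real r - 1) * t) = 0" by simp
    show False
    proof (cases "r = 0")
      case True
      then have "(1 - \<rho>) * sin t = 0" using key by (simp add: algebra_simps)
      moreover have "sin t > 0" using t0 by (intro sin_gt_zero) auto
      ultimately show False using \<rho> by simp
    next
      case False
      have le: "(real r + 1) * t \<le> pi"
        unfolding lt[symmetric] using rl t0 by (intro mult_right_mono) auto
      have a: "0 \<le> sin ((real r + 1) * t)" using le t0 by (intro sin_ge_zero) auto
      have lt_pi: "(real r - 1) * t < pi"
        using le t0 by (simp add: algebra_simps)
      have b: "0 \<le> sin ((real r - 1) * t)"
        using lt_pi False t0 by (intro sin_ge_zero) auto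
      have "0 \<le> \<rho> * sin ((real r - 1) * t)" using b \<rho> by simp
      with key a have "sin ((real r + 1) * t) = 0" "\<rho> * sin ((real r - 1) * t) = 0" by linarith+
      then have s: "sin ((real r + 1) * t) = 0" "sin ((real r - 1) * t) = 0" using \<rho> by auto
      have "r = 1"
      proof (rule ccontr)
        assume "r \<noteq> 1"
        then have "0 < (real r - 1) * t" using False t0 by simp
        then show False using sin_gt_zero[OF _ lt_pi] s by simp
      qed
      then have "sin w = 0" using s(1) by (simp add: w_def)
      then show False using sinw by simp
    qed
  qed
  then show ?thesis using closed[OF i] sinw by simp
qed

abbreviation KP :: "nat \<Rightarrow> nat \<Rightarrow> nat \<Rightarrow> nat \<Rightarrow> bool" where
  "KP m n \<equiv> graph_join m (complete_graph m) n (path_graph n)"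

lemma KP_iff:
  "KP m n i j \<longleftrightarrow> i < m + n \<and> j < m + n \<and> i \<noteq> j \<and> (i < m \<or> j < m \<or> i + 1 = j \<or> j + 1 = i)"
  by (auto simp: graph_join_def complete_graph_def path_graph_def)

lemma KP_simple: "simple_graph (m + n) (KP m n)"
  by (auto simp: simple_graph_def KP_iff)

lemma KP_neighbour_sum_clique:
  assumes "i < m"
  shows "(\<Sum>j<m + n. adj (KP m n) i j * x j) = (\<Sum>j<m + n. x j) - x i"
proof -
  have "(\<Sum>j<m + n. adj (KP m n) i j * x j) = (\<Sum>j<m + n. x j - (if j = i then x i else 0))"
    using assms by (intro sum.cong refl) (auto simp: KP_iff)
  then show ?thesis using assms by (simp only: sum_subtractf) simp
qed

lemma KP_neighbour_sum_path:
  assumes "i < n"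
  shows "(\<Sum>j<m + n. adj (KP m n) (m + i) j * x j) = (\<Sum>j<m. x j)
    + (if 0 < i then x (m + i - 1) else 0) + (if i + 1 < n then x (m + i + 1) else 0)"
proof -
  \<comment> \<open>At \<open>i = 0\<close> the index \<open>m + i - 1\<close> is a clique vertex,
    or truncates to the vertex itself when \<open>m = 0\<close>; hence the guard
    \<open>0 < i\<close> on that summand.\<close>
  have "(\<Sum>j<m + n. adj (KP m n) (m + i) j * x j) = (\<Sum>j<m + n. (if j < m then x j else 0)
      + (if j = m + i - 1 then if 0 < i then x j else 0 else 0)
      + (if j = m + i + 1 then if i + 1 < n then x j else 0 else 0))"
    using assms by (intro sum.cong refl) (auto simp: KP_iff)
  also have "\<dots> = (\<Sum>j<m + n. if j < m then x j else 0)
      + (if 0 < i then x (m + i - 1) else 0) + (if i + 1 < n then x (m + i + 1) else 0)"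
    using assms by (simp only: sum.distrib) auto
  also have "(\<Sum>j<m + n. if j < m then x j else 0) = (\<Sum>j<m. x j)"
    by (rule sum.mono_neutral_cong_right) auto
  finally show ?thesis .
qed

lemma KP_deg_clique: "i < m \<Longrightarrow> deg (m + n) (KP m n) i = real (m + n) - 1"
  using KP_neighbour_sum_clique[of i m n "\<lambda>_. 1"] unfolding deg_eq_sum by simp

lemma KP_deg_path:
  "i < n \<Longrightarrow> deg (m + n) (KP m n) (m + i) = real m + of_bool (0 < i) + of_bool (i + 1 < n)"
  using KP_neighbour_sum_path[of i n m "\<lambda>_. 1"] unfolding deg_eq_sum by simp

text \<open>\<open>f\<close> stands for the first three powers. With \<open>2 \<le> n\<close> the
  ends of the path are distinct, so exactly two path vertices have degree
  \<open>m + 1\<close>.\<close>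

lemma KP_deg_sum:
  assumes "2 \<le> n"
  shows "(\<Sum>i<m + n. f (deg (m + n) (KP m n) i))
    = real m * f (real (m + n) - 1) + (real n - 2) * f (real m + 2) + 2 * (f (real m + 1) :: real)"
proof -
  obtain k where k: "n = Suc (Suc k)" using assms by (metis Suc_1 Suc_le_D add_2_eq_Suc le_add_diff_inverse)
  have split: "(\<Sum>i<m + n. g i) = (\<Sum>i<m. g i) + (\<Sum>i<n. g (m + i))" for g :: "nat \<Rightarrow> real" and n
    by (induction n) auto
  have ends: "(\<Sum>i<Suc (Suc k). g i) = g 0 + (\<Sum>i<k. g (Suc i)) + g (Suc k)" for g :: "nat \<Rightarrow> real" and k
    by (induction k) auto
  have "(\<Sum>i<m + n. f (deg (m + n) (KP m n) i))
      = (\<Sum>i<m. f (deg (m + n) (KP m n) i)) + (\<Sum>i<n. f (deg (m + n) (KP m n) (m + i)))"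
    by (rule split)
  also have "(\<Sum>i<m. f (deg (m + n) (KP m n) i)) = real m * f (real (m + n) - 1)"
    by (simp add: KP_deg_clique)
  also have "(\<Sum>i<n. f (deg (m + n) (KP m n) (m + i)))
      = (\<Sum>i<n. f (real m + of_bool (0 < i) + of_bool (i + 1 < n)))"
    by (intro sum.cong refl) (simp add: KP_deg_path)
  also have "\<dots> = f (real m + 1) + (\<Sum>i<k. f (real m + 2)) + f (real m + 1)"
    unfolding k ends by (simp add: add.commute)
  finally show ?thesis using k by simp
qed

text \<open>A clique row consists of \<open>1 - \<alpha>\<close> everywhere plus
  \<open>\<alpha> * N - 1\<close> on the diagonal. The form is therefore the left side plus
  \<open>1 - \<alpha>\<close> times the squared coordinate sum.\<close>

lemma KP_clique_form:
  assumes "\<And>i. i < m + n \<Longrightarrow> m \<le> i \<Longrightarrow> x i = 0" and \<alpha>: "\<alpha> < 1"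
  shows "(\<alpha> * real (m + n) - 1) * (\<Sum>i<m + n. (x i)\<^sup>2)
    \<le> (\<Sum>i<m + n. \<Sum>j<m + n. A_alpha \<alpha> (m + n) (KP m n) $$ (i, j) * x i * x j)"
proof -
  let ?N = "m + n" and ?A = "A_alpha \<alpha> (m + n) (KP m n)"
  have row: "(\<Sum>j<?N. ?A $$ (i, j) * x i * x j)
      = (\<alpha> * real ?N - 1) * (x i)\<^sup>2 + (1 - \<alpha>) * (x i * (\<Sum>j<?N. x j))" if "i < ?N" for i
  proof (cases "i < m")
    case True
    have "(\<Sum>j<?N. ?A $$ (i, j) * x i * x j) = x i * (\<Sum>j<?N. ?A $$ (i, j) * x j)"
      by (simp add: sum_distrib_left mult_ac)
    also have "\<dots> = x i * (\<alpha> * (real ?N - 1) * x i + (1 - \<alpha>) * ((\<Sum>j<?N. x j) - x i))"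
      unfolding A_alpha_apply[OF that] KP_neighbour_sum_clique[OF True] KP_deg_clique[OF True] ..
    finally show ?thesis by (simp add: algebra_simps power2_eq_square)
  qed (use assms that in simp)
  have "(\<Sum>i<?N. \<Sum>j<?N. ?A $$ (i, j) * x i * x j)
      = (\<Sum>i<?N. (\<alpha> * real ?N - 1) * (x i)\<^sup>2 + (1 - \<alpha>) * (x i * (\<Sum>j<?N. x j)))"
    by (intro sum.cong refl) (simp only: row lessThan_iff)
  also have "\<dots> = (\<alpha> * real ?N - 1) * (\<Sum>i<?N. (x i)\<^sup>2) + (1 - \<alpha>) * ((\<Sum>i<?N. x i) * (\<Sum>j<?N. x j))"
    by (simp only: sum.distrib sum_distrib_left[symmetric] sum_distrib_right[symmetric])
  finally show ?thesis using \<alpha> by simp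
qed

text \<open>Expressed through edge differences, the gap between the two sides is a sum of
  nonnegative terms: the squares weighted with \<open>m + 2\<close> minus the degree, and
  \<open>(1 - \<alpha>) * W / 2\<close> from the path edges. If it were 0, the end vertex
  \<open>m\<close>, of degree \<open>m + 1\<close>, would carry the value 0, and
  \<open>W = 0\<close> would spread this value along the path.\<close>

lemma KP_path_form:
  assumes zero: "\<And>i. i < m \<Longrightarrow> x i = 0" and nz: "\<exists>i<m + n. x i \<noteq> 0" and n: "2 \<le> n" and \<alpha>: "\<alpha> < 1"
  shows "(\<Sum>i<m + n. \<Sum>j<m + n. A_alpha \<alpha> (m + n) (KP m n) $$ (i, j) * x i * x j)
    < (2 + \<alpha> * real m) * (\<Sum>i<m + n. (x i)\<^sup>2)"
proof (rule ccontr)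
  let ?N = "m + n" and ?d = "deg (m + n) (KP m n)"
  let ?s = "\<Sum>i<m + n. (x i)\<^sup>2" and ?D = "\<Sum>i<m + n. deg (m + n) (KP m n) i * (x i)\<^sup>2"
  let ?a = "\<Sum>i<m + n. \<Sum>j<m + n. adj (KP m n) i j * x i * x j"
  define w where "w i j = of_bool (m \<le> i \<and> m \<le> j) * (adj (KP m n) i j * (x i - x j)\<^sup>2)" for i j
  define W where "W = (\<Sum>i<?N. \<Sum>j<?N. w i j)"
  assume "\<not> ?thesis"
  then have ge: "(2 + \<alpha> * real m) * ?s \<le> \<alpha> * ?D + (1 - \<alpha>) * ?a"
    unfolding A_alpha_form by simp
  have "(\<Sum>i<?N. \<Sum>j<?N. adj (KP m n) i j * (x i - x j)\<^sup>2)
      = (\<Sum>i<?N. \<Sum>j<?N. of_bool (i < m) * (x j)\<^sup>2 + of_bool (j < m) * (x i)\<^sup>2 + w i j)"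
    by (intro sum.cong refl) (auto simp: w_def KP_iff zero not_less)
  also have "\<dots> = (\<Sum>i<?N. of_bool (i < m)) * ?s + ?s * (\<Sum>j<?N. of_bool (j < m)) + W"
    unfolding W_def sum_product by (simp only: sum.distrib mult.commute)
  also have "(\<Sum>j<?N. of_bool (j < m)) = real m"
    by (simp add: sum_of_bool_eq Int_def, metis (no_types, lifting) Collect_cong card_Collect_less_nat trans_less_add1)
  finally have "2 * ?D - 2 * ?a = 2 * real m * ?s + W"
    unfolding edge_squares(2)[OF KP_simple] by (simp add: algebra_simps)
  then have a: "?a = ?D - real m * ?s - W / 2" by simp
  have "(real m + 2) * ?s - ?D + (1 - \<alpha>) * W / 2 \<le> 0"
    using ge unfolding a by (simp add: algebra_simps)
  then have le: "(\<Sum>i<?N. (real m + 2 - ?d i) * (x i)\<^sup>2) + (1 - \<alpha>) * W / 2 \<le> 0"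
    by (simp add: left_diff_distrib sum_subtractf sum_distrib_left algebra_simps)
  have nonneg1: "0 \<le> (real m + 2 - ?d i) * (x i)\<^sup>2" if "i < ?N" for i
  proof (cases "i < m")
    case False
    then obtain k where "i = m + k" "k < n" using \<open>i < ?N\<close> by (metis add_less_cancel_left le_Suc_ex not_less)
    then show ?thesis by (simp add: KP_deg_path)
  qed (simp add: zero)
  have wn: "0 \<le> w i j" for i j by (simp add: w_def)
  then have W0: "0 \<le> W" unfolding W_def by (intro sum_nonneg) auto
  have s0: "0 \<le> (\<Sum>i<?N. (real m + 2 - ?d i) * (x i)\<^sup>2)" using nonneg1 by (intro sum_nonneg) auto
  have bW: "0 \<le> (1 - \<alpha>) * W / 2" using W0 \<alpha> by simp
  have "(1 - \<alpha>) * W / 2 = 0" using le s0 bW by linarith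
  then have "W = 0" using \<alpha> by simp
  have "(\<Sum>i<?N. (real m + 2 - ?d i) * (x i)\<^sup>2) = 0" using le s0 bW by linarith
  then have "\<forall>i\<in>{..<?N}. (real m + 2 - ?d i) * (x i)\<^sup>2 = 0"
    by (subst (asm) sum_nonneg_eq_0_iff) (use nonneg1 in auto)
  from bspec[OF this, of "m + 0"] have first: "x m = 0"
    using n KP_deg_path[of 0 n m] by simp
  have step: "x (m + i) = x (m + Suc i)" if "Suc i < n" for i
  proof -
    have "w (m + i) (m + Suc i) \<le> (\<Sum>j<?N. w (m + i) j)"
      using that wn by (intro member_le_sum) auto
    also have "\<dots> \<le> W" unfolding W_def
      using that wn by (intro member_le_sum sum_nonneg) auto
    finally have "w (m + i) (m + Suc i) \<le> 0" using \<open>W = 0\<close> by simp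
    then show ?thesis using that by (simp add: w_def KP_iff)
  qed
  have "x (m + i) = 0" if "i < n" for i using that
    by (induction i) (use first step in auto)
  then have "\<forall>i<?N. x i = 0" using zero by (metis add_less_cancel_left le_Suc_ex not_less)
  with nz show False by blast
qed

lemma KP_no_eigenvector:
  assumes m: "1 \<le> m" and n: "2 \<le> n" and l: "3 \<le> l" and \<alpha>: "1/2 < \<alpha>" "\<alpha> < 1"
    and s: "s = \<alpha> * (real m + 2) + 2 * (1 - \<alpha>) * cos (2 * pi / real l)"
    and ne: "s \<noteq> \<alpha> * real (m + n) - 1"
    and eig: "\<And>i. i < m + n \<Longrightarrow> (\<Sum>j<m + n. A_alpha \<alpha> (m + n) (KP m n) $$ (i, j) * x j) = s * x i"
    and x0: "x 0 = 0" and i: "i < m + n"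
  shows "x i = 0"
proof -
  let ?N = "m + n"
  define b where "b = 1 - \<alpha>"
  have b: "0 < b" "\<alpha> + b = 1" "b < \<alpha>" using \<alpha> by (auto simp: b_def)
  have clique: "(\<alpha> * real ?N - 1 - s) * x i + b * (\<Sum>j<?N. x j) = 0" if "i < m" for i
  proof -
    have "\<alpha> * (real ?N - 1) * x i + b * ((\<Sum>j<?N. x j) - x i) = s * x i"
      using eig[of i] that unfolding b_def
      by (simp only: A_alpha_apply KP_neighbour_sum_clique KP_deg_clique trans_less_add1)
    then show ?thesis by (simp add: b_def algebra_simps)
  qed
  have sum0: "(\<Sum>j<?N. x j) = 0" using clique[of 0] m x0 b by simp
  then have zero: "x i = 0" if "i < m" for i using clique[OF that] ne by simp
  have row: "\<alpha> * (real m + of_bool (0 < i) + of_bool (i + 1 < n)) * x (m + i)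
      + b * ((if 0 < i then x (m + i - 1) else 0) + (if i + 1 < n then x (m + i + 1) else 0))
      = s * x (m + i)" if "i < n" for i
    using eig[of "m + i"] that zero
    unfolding b_def by (simp only: A_alpha_apply KP_neighbour_sum_path KP_deg_path nat_add_left_cancel_less) simp
  \<comment> \<open>An end vertex has degree \<open>m + 1\<close> instead of \<open>m + 2\<close>,
    so its equation lacks \<open>\<alpha>\<close> times its own value. This acts like an extra
    neighbour whose value, multiplied by \<open>b\<close>, is \<open>- \<alpha>\<close> times that
    of the end.\<close>
  define \<rho> where "\<rho> = \<alpha> / b"
  have \<rho>: "1 < \<rho>" "b * \<rho> = \<alpha>" using b by (auto simp: \<rho>_def field_simps)
  \<comment> \<open>The ghost values at both ends turn the equations at the end vertices into the inner recurrence.\<close>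
  define z where "z i = (if i = 0 then - \<rho> * x m else if i \<le> n then x (m + i - 1)
      else - \<rho> * x (m + n - 1))" for i
  have rec: "z (Suc i) = 2 * cos (2 * pi / real l) * z i - z (i - 1)" if i: "1 \<le> i" "i \<le> n" for i
  proof -
    obtain k where k: "i = Suc k" "k < n" using i by (cases i) auto
    have "b * z (i - 1) = (if 0 < k then b * x (m + k - 1) else - \<alpha> * x m)"
      using k \<rho>(2) by (auto simp: z_def)
    moreover have "b * z (Suc i) = (if k + 1 < n then b * x (m + k + 1) else - \<alpha> * x (m + k))"
    proof (cases "Suc k < n")
      case False
      then have "n = Suc k" using k by simp
      then show ?thesis using k \<rho>(2) by (auto simp: z_def)
    qed (use k in \<open>simp add: z_def\<close>)
    moreover have "z i = x (m + k)" using k by (simp add: z_def)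
    ultimately have "b * z (i - 1) + b * z (Suc i) = 2 * b * cos (2 * pi / real l) * z i"
      using row[OF k(2)] unfolding s b_def[symmetric]
      by (auto simp: algebra_simps split: if_splits)
    then have "b * (z (i - 1) + z (Suc i) - 2 * cos (2 * pi / real l) * z i) = 0"
      by (simp add: algebra_simps)
    then show ?thesis using b by simp
  qed
  \<comment> \<open>The column sums of the matrix are the degrees, so adding up all eigenvector
    equations equates this sum with \<open>s\<close> times the coordinate sum. On the path all
    degrees are \<open>m + 2\<close> except at the two ends, and this isolates the sum of the two
    end values.\<close>
  have total: "(\<Sum>i<?N. deg ?N (KP m n) i * x i) = 0"
  proof -
    have "(\<Sum>i<?N. s * x i) = (\<Sum>i<?N. \<alpha> * (deg ?N (KP m n) i * x i) + b * (\<Sum>j<?N. adj (KP m n) i j * x j))"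
      by (intro sum.cong refl) (simp only: eig[symmetric] A_alpha_apply lessThan_iff b_def mult.assoc)
    also have "\<dots> = \<alpha> * (\<Sum>i<?N. deg ?N (KP m n) i * x i) + b * (\<Sum>i<?N. deg ?N (KP m n) i * x i)"
      by (simp only: sum.distrib sum_distrib_left[symmetric] sum_adj_deg(2)[OF KP_simple])
    finally have "s * (\<Sum>i<?N. x i) = (\<alpha> + b) * (\<Sum>i<?N. deg ?N (KP m n) i * x i)"
      by (simp only: sum_distrib_left[symmetric] distrib_right)
    then show ?thesis using sum0 b by simp
  qed
  have anti: "z 1 + z n = 0"
  proof -
    have "(\<Sum>i<?N. deg ?N (KP m n) i * x i)
        = (\<Sum>i<?N. (real m + 2) * x i - (if i = m then x m else 0) - (if i = m + n - 1 then x i else 0))"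
    proof (intro sum.cong refl)
      fix i assume i: "i \<in> {..<?N}"
      show "deg ?N (KP m n) i * x i
          = (real m + 2) * x i - (if i = m then x m else 0) - (if i = m + n - 1 then x i else 0)"
      proof (cases "i < m")
        case True
        then show ?thesis using zero n by simp
      next
        case False
        then obtain k where "i = m + k" "k < n" using i by (metis add_less_cancel_left le_Suc_ex lessThan_iff not_less)
        then show ?thesis using n KP_deg_path[of k n m] by (auto simp: distrib_right)
      qed
    qed
    also have "\<dots> = (real m + 2) * (\<Sum>i<?N. x i) - x m - x (m + n - 1)"
      using n by (simp add: sum_subtractf sum_distrib_left[symmetric])
    finally have "x m + x (m + n - 1) = 0" using total sum0 by simp
    then show ?thesis using n by (simp add: z_def)
  qed
  have z0: "z 0 = - \<rho> * z 1" "z (Suc n) = - \<rho> * z n" using n by (auto simp: z_def)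
  have "z (Suc k) = 0" if "k < n" for k
    by (rule path_recurrence_trivial[OF l \<rho>(1) _ rec z0 anti]) (use n that in auto)
  then have path: "x (m + k) = 0" if "k < n" for k using that by (force simp: z_def)
  show ?thesis using i zero path by (metis add_less_cancel_left le_Suc_ex not_less)
qed

section \<open>Paths and cycles in graphs of maximal degree two\<close>

definition simple_walk :: "nat set \<Rightarrow> (nat \<Rightarrow> nat \<Rightarrow> bool) \<Rightarrow> nat list \<Rightarrow> bool" where
  "simple_walk R F xs \<longleftrightarrow> xs \<noteq> [] \<and> distinct xs \<and> set xs \<subseteq> R \<and>
     (\<forall>i. Suc i < length xs \<longrightarrow> F (xs ! i) (xs ! Suc i))"

lemma maximal_simple_walk:
  assumes "finite R" "a \<in> R"
  obtains xs where "simple_walk R F xs" "xs ! 0 = a"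
    "\<forall>j\<in>R. F (xs ! (length xs - 1)) j \<longrightarrow> j \<in> set xs"
proof -
  let ?P = "\<lambda>xs. simple_walk R F xs \<and> xs ! 0 = a"
  have "?P [a]" using assms by (simp add: simple_walk_def)
  moreover have bound: "length xs \<le> card R" if "?P xs" for xs
    using that assms(1) by (metis simple_walk_def card_mono distinct_card)
  then have "\<forall>xs. ?P xs \<longrightarrow> length xs < Suc (card R)" by (simp add: less_Suc_eq_le)
  ultimately obtain xs where xs: "?P xs" and max: "\<And>ys. ?P ys \<Longrightarrow> length ys \<le> length xs"
    using ex_has_greatest_nat[of ?P "[a]" length "Suc (card R)"] by blast
  have "j \<in> set xs" if j: "j \<in> R" "F (xs ! (length xs - 1)) j" for j
  proof (rule ccontr)
    assume nj: "j \<notin> set xs"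
    have "F ((xs @ [j]) ! i) ((xs @ [j]) ! Suc i)" if "Suc i < length (xs @ [j])" for i
    proof (cases "Suc i < length xs")
      case True
      then show ?thesis using xs by (simp add: nth_append simple_walk_def)
    next
      case False
      then have "length xs = Suc i" using that by simp
      then show ?thesis using j(2) by (simp add: nth_append)
    qed
    moreover have "xs \<noteq> []" using xs by (simp add: simple_walk_def)
    ultimately have "?P (xs @ [j])"
      using xs nj j(1) unfolding simple_walk_def by (auto simp: nth_append)
    from max[OF this] show False by simp
  qed
  with xs that show thesis by blast
qed

locale max_degree_2 =
  fixes R :: "nat set" and F :: "nat \<Rightarrow> nat \<Rightarrow> bool"
  assumes finite: "finite R" and symF: "\<And>i j. F i j = F j i" and irr: "\<And>i. \<not> F i i"
    and deg2: "\<And>i. i \<in> R \<Longrightarrow> card {j \<in> R. F i j} \<le> 2"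
begin

lemma neighbours_eq:
  assumes "i \<in> R" "p \<in> R" "q \<in> R" "p \<noteq> q" "F i p" "F i q" "j \<in> R" "F i j"
  shows "j = p \<or> j = q"
proof -
  have "{p, q} = {j \<in> R. F i j}"
    by (rule card_seteq) (use assms deg2[of i] finite in auto)
  then show ?thesis using assms by blast
qed

lemma inner_neighbours:
  assumes w: "simple_walk R F xs" and i: "Suc (Suc i) < length xs" and j: "j \<in> R" "F (xs ! Suc i) j"
  shows "j = xs ! i \<or> j = xs ! Suc (Suc i)"
proof (rule neighbours_eq[of "xs ! Suc i"])
  show "xs ! Suc i \<in> R" "xs ! i \<in> R" "xs ! Suc (Suc i) \<in> R"
    using w i by (auto simp: simple_walk_def)
  show "xs ! i \<noteq> xs ! Suc (Suc i)" using w i by (simp add: simple_walk_def nth_eq_iff_index_eq)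
  show "F (xs ! Suc i) (xs ! i)" "F (xs ! Suc i) (xs ! Suc (Suc i))"
    using w i symF by (auto simp: simple_walk_def)
qed (use j in auto)

text \<open>Maximality puts the neighbour on the walk. It cannot be an inner vertex other than the
  predecessor, because the two walk neighbours of an inner vertex exhaust its degree.\<close>

lemma last_neighbours:
  assumes w: "simple_walk R F xs" and max: "\<forall>j\<in>R. F (xs ! (length xs - 1)) j \<longrightarrow> j \<in> set xs"
    and j: "j \<in> R" "F (xs ! (length xs - 1)) j"
  shows "2 \<le> length xs \<and> (j = xs ! (length xs - 2) \<or> 3 \<le> length xs \<and> j = xs ! 0)"
proof -
  define k where "k = length xs - 1"
  have len: "length xs = Suc k" using w by (simp add: k_def simple_walk_def)
  obtain p where p: "p \<le> k" "xs ! p = j" using max j len by (auto simp: in_set_conv_nth less_Suc_eq_le)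
  have Fkp: "F (xs ! k) (xs ! p)" using j p by (simp add: k_def)
  then have "p \<noteq> k" using irr by auto
  then have pk: "p < k" using p by simp
  show ?thesis
  proof (cases "p = k - 1 \<or> p = 0")
    case True
    then show ?thesis using pk p len
      by (cases "k = 1") (auto simp: numeral_2_eq_2 numeral_3_eq_3)
  next
    case False
    then obtain i where i: "p = Suc i" "Suc (Suc i) < k" using pk by (cases p) auto
    have "xs ! k = xs ! i \<or> xs ! k = xs ! Suc (Suc i)"
      by (rule inner_neighbours[OF w]) (use i len w Fkp symF in \<open>auto simp: simple_walk_def\<close>)
    then show ?thesis using w i len by (auto simp: simple_walk_def nth_eq_iff_index_eq)
  qed
qed

text \<open>The start has no neighbour besides its successor, so the walk cannot close up. It ends
  in another vertex of degree one, and its vertices form a whole component of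
  \<open>R\<close>.\<close>

lemma walk_from_end:
  assumes w: "simple_walk R F xs" and max: "\<forall>j\<in>R. F (xs ! (length xs - 1)) j \<longrightarrow> j \<in> set xs"
    and one: "card {j \<in> R. F (xs ! 0) j} = 1"
  shows "2 \<le> length xs" and "card {j \<in> R. F (xs ! (length xs - 1)) j} = 1"
    and "\<And>i j. i < length xs \<Longrightarrow> j \<in> R \<Longrightarrow> F (xs ! i) j \<Longrightarrow>
      \<exists>p<length xs. j = xs ! p \<and> (p + 1 = i \<or> i + 1 = p)"
proof -
  have ne: "xs \<noteq> []" using w by (simp add: simple_walk_def)
  obtain c where c: "{j \<in> R. F (xs ! 0) j} = {c}" using one by (auto simp: card_1_singleton_iff)
  show len: "2 \<le> length xs"
  proof (rule ccontr)
    assume "\<not> ?thesis"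
    moreover have "length xs \<noteq> 0" using ne by simp
    ultimately have "length xs = 1" by linarith
    then have "c \<in> set xs" using max c by auto
    then have "c = xs ! 0" using \<open>length xs = 1\<close> by (auto simp: in_set_conv_nth)
    then show False using c irr by auto
  qed
  have in_R: "xs ! i \<in> R" if "i < length xs" for i using w that by (auto simp: simple_walk_def)
  have step: "F (xs ! i) (xs ! Suc i)" if "Suc i < length xs" for i
    using w that by (auto simp: simple_walk_def)
  have c1: "c = xs ! 1" using c step[of 0] in_R[of 1] len by auto
  have last: "j = xs ! (length xs - 2)" if "j \<in> R" "F (xs ! (length xs - 1)) j" for j
  proof (rule ccontr)
    assume "j \<noteq> xs ! (length xs - 2)"
    then have 3: "3 \<le> length xs" "j = xs ! 0" using last_neighbours[OF w max that] by auto
    have "F (xs ! 0) (xs ! (length xs - 1))"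
      using that(2) 3(2) symF[of "xs ! 0" "xs ! (length xs - 1)"] by simp
    moreover have "xs ! (length xs - 1) \<in> R" using ne by (intro in_R) simp
    ultimately have "xs ! (length xs - 1) = xs ! 1" using c c1 by blast
    then show False using w 3 by (auto simp: simple_walk_def nth_eq_iff_index_eq)
  qed
  have "F (xs ! (length xs - 1)) (xs ! (length xs - 2))"
  proof -
    have "Suc (length xs - 2) = length xs - 1" using len by simp
    then have "F (xs ! (length xs - 2)) (xs ! (length xs - 1))"
      using step[of "length xs - 2"] len by simp
    then show ?thesis by (rule symF[THEN iffD1])
  qed
  then have "{j \<in> R. F (xs ! (length xs - 1)) j} = {xs ! (length xs - 2)}"
    using last in_R[of "length xs - 2"] len by fastforce
  then show "card {j \<in> R. F (xs ! (length xs - 1)) j} = 1" by simp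
  show "\<exists>p<length xs. j = xs ! p \<and> (p + 1 = i \<or> i + 1 = p)"
    if i: "i < length xs" "j \<in> R" "F (xs ! i) j" for i j
  proof -
    consider "i = 0" | "0 < i" "i = length xs - 1" | k where "i = Suc k" "Suc (Suc k) < length xs"
      using i by (cases i) force+
    then show ?thesis
    proof cases
      case 1
      then show ?thesis using i c c1 len by (intro exI[of _ 1]) auto
    next
      case 2
      then have "j = xs ! (length xs - 2)" using i last by simp
      then show ?thesis using len 2 by (intro exI[of _ "length xs - 2"]) auto
    next
      case 3
      then consider "j = xs ! k" | "j = xs ! Suc (Suc k)" using inner_neighbours[OF w 3(2)] i by auto
      then show ?thesis using 3 by cases (auto intro: exI[of _ k] exI[of _ "Suc (Suc k)"])
    qed
  qed
qed

text \<open>The last vertex has two neighbours, and besides its predecessor only the start of the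
  walk is available.\<close>

lemma walk_closes:
  assumes w: "simple_walk R F xs" and max: "\<forall>j\<in>R. F (xs ! (length xs - 1)) j \<longrightarrow> j \<in> set xs"
    and two: "\<And>i. i \<in> set xs \<Longrightarrow> card {j \<in> R. F i j} = 2"
  shows "3 \<le> length xs" and "F (xs ! (length xs - 1)) (xs ! 0)"
proof -
  have ne: "xs \<noteq> []" using w by (simp add: simple_walk_def)
  obtain p q where pq: "{j \<in> R. F (xs ! (length xs - 1)) j} = {p, q}" "p \<noteq> q"
    using two[of "xs ! (length xs - 1)"] ne by (auto simp: card_2_iff)
  then have "p \<in> R" "F (xs ! (length xs - 1)) p" "q \<in> R" "F (xs ! (length xs - 1)) q" by auto
  from last_neighbours[OF w max this(1,2)] last_neighbours[OF w max this(3,4)] pq(2)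
  have "3 \<le> length xs" "p = xs ! 0 \<or> q = xs ! 0" by auto
  then show "3 \<le> length xs" "F (xs ! (length xs - 1)) (xs ! 0)" using pq by auto
qed

lemma cycle_neighbours:
  assumes w: "simple_walk R F xs" and len: "3 \<le> length xs"
    and closed: "F (xs ! (length xs - 1)) (xs ! 0)"
    and i: "i < length xs" and j: "j \<in> R"
  shows "F (xs ! i) j \<longleftrightarrow> j = xs ! (if i = 0 then length xs - 1 else i - 1) \<or>
    j = xs ! (if Suc i = length xs then 0 else Suc i)"
proof -
  define p where "p = (if i = 0 then length xs - 1 else i - 1)"
  define q where "q = (if Suc i = length xs then 0 else Suc i)"
  have pq: "p < length xs" "q < length xs" "p \<noteq> q" using i len by (auto simp: p_def q_def)
  have in_R: "xs ! i \<in> R" if "i < length xs" for i using w that by (auto simp: simple_walk_def)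
  have step: "F (xs ! i) (xs ! Suc i)" if "Suc i < length xs" for i
    using w that by (auto simp: simple_walk_def)
  have Fq: "F (xs ! i) (xs ! q)"
  proof (cases "Suc i = length xs")
    case True
    then have "i = length xs - 1" by simp
    then show ?thesis using closed True by (simp add: q_def)
  qed (use step[of i] i in \<open>simp add: q_def\<close>)
  have Fp: "F (xs ! i) (xs ! p)"
    using step[of "i - 1"] closed i symF by (cases i) (auto simp: p_def)
  have ne: "xs ! p \<noteq> xs ! q" using w pq by (simp add: simple_walk_def nth_eq_iff_index_eq)
  have "F (xs ! i) j \<longleftrightarrow> j = xs ! p \<or> j = xs ! q"
    using neighbours_eq[OF in_R[OF i] in_R[OF pq(1)] in_R[OF pq(2)] ne Fp Fq j] Fp Fq by blast
  then show ?thesis by (simp add: p_def q_def)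
qed

end

text \<open>A shift by one leaves the sum \<open>S\<close> over a period unchanged, so the
  recurrence summed over a period gives \<open>2 * c * S = 2 * S\<close>.\<close>

lemma periodic_sum_zero:
  fixes G :: "real \<Rightarrow> real"
  assumes rec: "\<And>x. G (x + 1) + G (x - 1) = 2 * c * G x" and per: "\<And>x. G (x + real l) = G x"
    and c: "c \<noteq> 1"
  shows "(\<Sum>i<l. G (real i)) = 0"
proof -
  have up: "(\<Sum>i<k. G (real i + 1)) = (\<Sum>i<k. G (real i)) + G (real k) - G 0" for k
    by (induction k) (auto simp: add.commute)
  have down: "(\<Sum>i<k. G (real i - 1)) = (\<Sum>i<k. G (real i)) + G (-1) - G (real k - 1)" for k
    by (induction k) auto
  have "2 * c * (\<Sum>i<l. G (real i)) = (\<Sum>i<l. G (real i + 1)) + (\<Sum>i<l. G (real i - 1))"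
    by (simp add: sum_distrib_left rec flip: sum.distrib)
  also have "\<dots> = 2 * (\<Sum>i<l. G (real i))"
    unfolding up down using per[of 0] per[of "-1"] by (simp add: add.commute)
  finally have "(c - 1) * (\<Sum>i<l. G (real i)) = 0" by (simp add: algebra_simps)
  then show ?thesis using c by simp
qed

text \<open>\<open>G\<close> will be a cosine or a sine wave, extended by 0 off the cycle. Cycle
  vertices satisfy the equation by the recurrence, other vertices of \<open>R\<close> have no
  neighbour on the cycle, and universal ones see a full period, which sums to 0. Real arguments
  admit the position -1 at the seam of the cycle.\<close>

lemma cycle_eigenvector:
  fixes G :: "real \<Rightarrow> real"
  assumes F: "simple_graph N F" and R: "R \<subseteq> {..<N}"
    and univ: "\<And>u j. u < N \<Longrightarrow> u \<notin> R \<Longrightarrow> j < N \<Longrightarrow> j \<noteq> u \<Longrightarrow> F u j"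
    and d2: "max_degree_2 R F" and w: "simple_walk R F ys" and len: "3 \<le> length ys"
    and closed: "F (ys ! (length ys - 1)) (ys ! 0)"
    and dg: "\<And>i. i \<in> set ys \<Longrightarrow> deg N F i = d"
    and rec: "\<And>x. G (x + 1) + G (x - 1) = 2 * c * G x" and per: "\<And>x. G (x + real (length ys)) = G x"
    and c: "c \<noteq> 1" and v: "v < N"
  defines "x \<equiv> \<lambda>v. \<Sum>i<length ys. of_bool (ys ! i = v) * G (real i)"
  shows "(\<Sum>j<N. A_alpha \<alpha> N F $$ (v, j) * x j) = (\<alpha> * d + 2 * (1 - \<alpha>) * c) * x v"
proof -
  let ?l = "length ys"
  interpret max_degree_2 R F by (rule d2)
  have ysR: "ys ! i \<in> R" "ys ! i < N" if "i < ?l" for i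
    using w R nth_mem[OF that] unfolding simple_walk_def by blast+
  have dist: "ys ! i = ys ! j \<longleftrightarrow> i = j" if "i < ?l" "j < ?l" for i j
    using w that by (simp add: simple_walk_def nth_eq_iff_index_eq)
  have x_nth: "x (ys ! p) = G (real p)" if p: "p < ?l" for p
  proof -
    have "x (ys ! p) = (\<Sum>i<?l. if i = p then G (real i) else 0)"
      unfolding x_def using p by (intro sum.cong refl) (auto simp: dist)
    then show ?thesis using p by simp
  qed
  have x_zero: "x v = 0" if "v \<notin> set ys" for v
    unfolding x_def using that by (intro sum.neutral) auto
  have "(\<Sum>j<N. adj F v j * x j) = (\<Sum>j<N. \<Sum>i<?l. adj F v j * (of_bool (ys ! i = j) * G (real i)))"
    unfolding x_def by (simp only: sum_distrib_left)
  also have "\<dots> = (\<Sum>i<?l. \<Sum>j<N. adj F v j * (of_bool (ys ! i = j) * G (real i)))"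
    by (rule sum.swap)
  also have "\<dots> = (\<Sum>i<?l. \<Sum>j<N. if j = ys ! i then adj F v (ys ! i) * G (real i) else 0)"
    by (intro sum.cong refl) auto
  also have "\<dots> = (\<Sum>i<?l. adj F v (ys ! i) * G (real i))"
    using ysR by (intro sum.cong refl) (simp only: sum.delta finite_lessThan lessThan_iff if_True)
  finally have nb: "(\<Sum>j<N. adj F v j * x j) = (\<Sum>i<?l. adj F v (ys ! i) * G (real i))" .
  consider p where "p < ?l" "v = ys ! p" | "v \<in> R" "v \<notin> set ys" | "v \<notin> R"
    by (metis in_set_conv_nth)
  then show ?thesis
  proof cases
    case 1
    define pp where "pp = (if p = 0 then ?l - 1 else p - 1)"
    define qq where "qq = (if Suc p = ?l then 0 else Suc p)"
    have pq: "pp < ?l" "qq < ?l" "pp \<noteq> qq" using 1 len by (auto simp: pp_def qq_def)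
    have "(\<Sum>i<?l. adj F v (ys ! i) * G (real i))
        = (\<Sum>i<?l. (if i = pp then G (real i) else 0) + (if i = qq then G (real i) else 0))"
    proof (intro sum.cong refl)
      fix i assume "i \<in> {..<?l}"
      then have i: "i < ?l" by simp
      have "F v (ys ! i) \<longleftrightarrow> i = pp \<or> i = qq"
        using cycle_neighbours[OF w len closed 1(1) ysR(1)[OF i]] i pq
        unfolding 1(2) pp_def[symmetric] qq_def[symmetric] by (simp add: dist)
      then show "adj F v (ys ! i) * G (real i)
          = (if i = pp then G (real i) else 0) + (if i = qq then G (real i) else 0)"
        using pq by auto
    qed
    also have "\<dots> = G (real pp) + G (real qq)" using pq by (simp add: sum.distrib)
    also have "G (real pp) = G (real p - 1)"
      using per[of "-1"] len by (cases p) (auto simp: pp_def of_nat_diff)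
    also have "G (real qq) = G (real p + 1)"
      using per[of 0] by (auto simp: qq_def add.commute simp flip: of_nat_Suc)
    finally have "(\<Sum>j<N. adj F v j * x j) = 2 * c * G (real p)"
      using nb rec[of "real p"] by simp
    then show ?thesis unfolding A_alpha_apply[OF v] using dg[of v] 1
      by (simp add: x_nth algebra_simps)
  next
    case 2
    have "\<not> F v (ys ! i)" if i: "i < ?l" for i
    proof
      assume "F v (ys ! i)"
      then have "F (ys ! i) v" using symF by simp
      then have "v = ys ! (if i = 0 then ?l - 1 else i - 1) \<or> v = ys ! (if Suc i = ?l then 0 else Suc i)"
        using cycle_neighbours[OF w len closed i 2(1)] by simp
      moreover have "(if i = 0 then ?l - 1 else i - 1) < ?l" "(if Suc i = ?l then 0 else Suc i) < ?l"
        using i by auto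
      ultimately have "v \<in> set ys" using nth_mem by blast
      with 2 show False by simp
    qed
    then have "(\<Sum>j<N. adj F v j * x j) = 0" unfolding nb by (intro sum.neutral) auto
    then show ?thesis unfolding A_alpha_apply[OF v] using x_zero[OF 2(2)] by simp
  next
    case 3
    then have "v \<notin> set ys" using w by (auto simp: simple_walk_def)
    have "F v (ys ! i)" if "i < ?l" for i
      using univ[OF v 3] ysR[OF that] 3 by metis
    then have "(\<Sum>j<N. adj F v j * x j) = (\<Sum>i<?l. G (real i))" unfolding nb by (intro sum.cong refl) simp
    also have "\<dots> = 0" by (rule periodic_sum_zero[OF rec per c])
    finally show ?thesis unfolding A_alpha_apply[OF v] using x_zero[OF \<open>v \<notin> set ys\<close>] by simp
  qed
qed

text \<open>For integers \<open>t * (t + 1)\<close> is nonnegative, and these products add up to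
  \<open>2 - 2 = 0\<close>, so each of them vanishes.\<close>

lemma two_minus_ones:
  fixes t :: "'a \<Rightarrow> int"
  assumes fin: "finite R" and s1: "(\<Sum>i\<in>R. t i) = -2" and s2: "(\<Sum>i\<in>R. (t i)\<^sup>2) = 2"
  shows "\<And>i. i \<in> R \<Longrightarrow> t i = 0 \<or> t i = -1" and "card {i \<in> R. t i = -1} = 2"
proof -
  have nonneg: "0 \<le> t i * (t i + 1)" for i
    by (cases "0 \<le> t i") (auto simp: zero_le_mult_iff)
  have "(\<Sum>i\<in>R. t i * (t i + 1)) = 0"
    using s1 s2 by (simp add: algebra_simps power2_eq_square sum.distrib)
  then show t: "t i = 0 \<or> t i = -1" if "i \<in> R" for i
    using sum_nonneg_eq_0_iff[OF fin, of "\<lambda>i. t i * (t i + 1)"] nonneg that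
    by (force simp: add_eq_0_iff)
  have "(\<Sum>i\<in>R. t i) = (\<Sum>i\<in>R. - of_bool (t i = -1))"
    by (intro sum.cong refl) (use t in auto)
  also have "\<dots> = - int (card {i \<in> R. t i = -1})"
    using fin by (simp add: sum_negf sum_of_bool_eq Int_def)
  finally show "card {i \<in> R. t i = -1} = 2" using s1 by simp
qed

section \<open>Recovering the join from \<open>m\<close> universal vertices\<close>

lemma graph_isoI:
  assumes g: "bij_betw g {0..<N} {0..<M}"
    and E: "\<And>i j. i < N \<Longrightarrow> j < N \<Longrightarrow> E i j \<longleftrightarrow> F (g i) (g j)"
  shows "graph_iso M F N E"
proof -
  define f where "f = inv_into {0..<N} g"
  have f: "bij_betw f {0..<M} {0..<N}" unfolding f_def by (rule bij_betw_inv_into[OF g])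
  have "F i j \<longleftrightarrow> E (f i) (f j)" if "i \<in> {0..<M}" "j \<in> {0..<M}" for i j
  proof -
    have "g (f i) = i" "g (f j) = j"
      using that unfolding f_def by (auto intro: bij_betw_inv_into_right[OF g])
    moreover have "f i < N" "f j < N" using bij_betwE[OF f] that by auto
    ultimately show ?thesis using E by metis
  qed
  with f show ?thesis unfolding graph_iso_def by blast
qed

lemma KP_iso_if_path:
  assumes F: "simple_graph (m + n) F" and U: "U \<subseteq> {..<m + n}" "card U = m"
    and univ: "\<And>u j. u \<in> U \<Longrightarrow> j < m + n \<Longrightarrow> j \<noteq> u \<Longrightarrow> F u j"
    and xs: "distinct xs" "set xs = {..<m + n} - U"
    and path: "\<And>i j. i < length xs \<Longrightarrow> j < length xs \<Longrightarrow>
      F (xs ! i) (xs ! j) \<longleftrightarrow> i + 1 = j \<or> j + 1 = i"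
  shows "graph_iso (m + n) F (m + n) (KP m n)"
proof -
  have finU: "finite U" using U finite_subset by blast
  obtain us where us: "set us = U" "distinct us" using finite_distinct_list[OF finU] by blast
  define ws where "ws = us @ xs"
  have ws: "distinct ws" "set ws = {..<m + n}" using us xs U by (auto simp: ws_def)
  have lus: "length us = m" using distinct_card[OF us(2)] us(1) U(2) by simp
  have lws: "length ws = m + n" using distinct_card[OF ws(1)] ws(2) by simp
  have lxs: "length xs = n" using lus lws by (simp add: ws_def)
  have bij: "bij_betw ((!) ws) {0..<m + n} {0..<m + n}"
    unfolding atLeast0LessThan by (rule bij_betw_nth[OF ws(1)]) (simp_all only: lws ws(2))
  show ?thesis
  proof (rule graph_isoI[OF bij])
    fix i j assume ij: "i < m + n" "j < m + n"
    have neq: "ws ! i = ws ! j \<longleftrightarrow> i = j" using ws(1) ij lws by (simp add: nth_eq_iff_index_eq)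
    have lt: "ws ! i < m + n" "ws ! j < m + n" using nth_mem[of i ws] nth_mem[of j ws] ws(2) lws ij by simp_all
    show "KP m n i j \<longleftrightarrow> F (ws ! i) (ws ! j)"
    proof (cases "i < m \<or> j < m")
      case True
      have "F (ws ! i) (ws ! j) \<longleftrightarrow> i \<noteq> j"
      proof (cases "i < m")
        case True
        then have "ws ! i \<in> U" using us lus by (auto simp: ws_def nth_append)
        from univ[OF this lt(2)] show ?thesis using neq simple_graph_irrefl[OF F, of "ws ! i"] by auto
      next
        case False
        then have "ws ! j \<in> U" using us lus \<open>i < m \<or> j < m\<close> by (auto simp: ws_def nth_append)
        from univ[OF this lt(1)] show ?thesis
          using neq simple_graph_irrefl[OF F, of "ws ! i"] simple_graph_sym[OF F, of "ws ! i" "ws ! j"]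
          by auto
      qed
      then show ?thesis using True ij by (auto simp: KP_iff)
    next
      case False
      then have "F (ws ! i) (ws ! j) \<longleftrightarrow> (i - m) + 1 = j - m \<or> (j - m) + 1 = i - m"
        using path[of "i - m" "j - m"] ij lus lxs by (auto simp: ws_def nth_append)
      then show ?thesis using False ij by (auto simp: KP_iff)
    qed
  qed
qed

lemma KP_iso_if_universal:
  assumes m: "1 \<le> m" and n: "2 \<le> n" and \<alpha>: "1/2 < \<alpha>" "\<alpha> < 1"
    and F: "simple_graph (m + n) F"
    and spec: "A_alpha_spectrum \<alpha> (m + n) F = A_alpha_spectrum \<alpha> (m + n) (KP m n)"
    and U: "U \<subseteq> {..<m + n}" "card U = m"
    and univ: "\<And>u j. u \<in> U \<Longrightarrow> j < m + n \<Longrightarrow> j \<noteq> u \<Longrightarrow> F u j"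
  shows "graph_iso (m + n) F (m + n) (KP m n)"
proof -
  let ?N = "m + n"
  define R where "R = {..<?N} - U"
  have finU: "finite U" using U finite_subset by blast
  have R: "finite R" "R \<subseteq> {..<?N}" "card R = n"
    using U finU by (auto simp: R_def card_Diff_subset)
  have a0: "0 < \<alpha>" using \<alpha> by simp
  note inv = cospectral_invariants[OF KP_simple F a0 spec]
  have degU: "deg ?N F u = real ?N - 1" if u: "u \<in> U" for u
  proof -
    have "{j \<in> {0..<?N}. F u j} = {..<?N} - {u}"
      using univ[OF u] simple_graph_irrefl[OF F] by auto
    then have "Defs.degree ?N F u = ?N - 1" using U u by (simp add: Defs.degree_def subset_iff)
    then show ?thesis using m by (simp add: of_nat_diff)
  qed
  have split: "(\<Sum>i<?N. f (deg ?N F i)) = real m * f (real ?N - 1) + (\<Sum>i\<in>R. f (deg ?N F i))"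
    for f :: "real \<Rightarrow> real"
  proof -
    have "(\<Sum>i<?N. f (deg ?N F i)) = (\<Sum>i\<in>R. f (deg ?N F i)) + (\<Sum>i\<in>U. f (deg ?N F i))"
      unfolding R_def by (rule sum.subset_diff) (use U in auto)
    then show ?thesis using U degU by simp
  qed
  have S1: "(\<Sum>i\<in>R. deg ?N F i) = (real n - 2) * (real m + 2) + 2 * (real m + 1)"
    using inv(2) split[of "\<lambda>x. x"] KP_deg_sum[OF n, of "\<lambda>x. x" m] by simp
  have S2: "(\<Sum>i\<in>R. (deg ?N F i)\<^sup>2) = (real n - 2) * (real m + 2)\<^sup>2 + 2 * (real m + 1)\<^sup>2"
    using inv(3) split[of "\<lambda>x. x\<^sup>2"] KP_deg_sum[OF n, of "\<lambda>x. x\<^sup>2" m] by simp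
  \<comment> \<open>On \<open>R\<close> this is the degree inside \<open>R\<close> minus 2, because
    all \<open>m\<close> vertices of \<open>U\<close> are neighbours.\<close>
  define t where "t i = int (Defs.degree ?N F i) - int m - 2" for i
  have "real_of_int (\<Sum>i\<in>R. t i) = (\<Sum>i\<in>R. deg ?N F i - (real m + 2))"
    by (simp add: t_def algebra_simps)
  also have "\<dots> = -2" using R by (simp only: sum_subtractf S1) (simp add: algebra_simps)
  finally have t1: "(\<Sum>i\<in>R. t i) = -2" by linarith
  have "real_of_int (\<Sum>i\<in>R. (t i)\<^sup>2) = (\<Sum>i\<in>R. (deg ?N F i - (real m + 2))\<^sup>2)"
    by (simp add: t_def algebra_simps)
  also have "\<dots> = (\<Sum>i\<in>R. (deg ?N F i)\<^sup>2 - 2 * (real m + 2) * deg ?N F i + (real m + 2)\<^sup>2)"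
    by (intro sum.cong refl) (simp add: power2_eq_square algebra_simps)
  also have "\<dots> = 2"
    using R by (simp only: sum.distrib sum_subtractf S2 sum_distrib_left[symmetric] S1)
      (simp add: power2_eq_square algebra_simps)
  finally have t2: "(\<Sum>i\<in>R. (t i)\<^sup>2) = 2" by linarith
  note t = two_minus_ones[OF R(1) t1 t2]
  have nbR: "Defs.degree ?N F i = m + card {j \<in> R. F i j}" if i: "i \<in> R" for i
  proof -
    have "{j \<in> {0..<?N}. F i j} = U \<union> {j \<in> R. F i j}"
      using U univ simple_graph_sym[OF F, of i] i by (auto simp: R_def)
    moreover have "card (U \<union> {j \<in> R. F i j}) = card U + card {j \<in> R. F i j}"
      by (rule card_Un_disjoint) (use finU R in \<open>auto simp: R_def\<close>)
    ultimately show ?thesis using U by (simp add: Defs.degree_def)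
  qed
  have tR: "t i = int (card {j \<in> R. F i j}) - 2" if "i \<in> R" for i
    using nbR[OF that] by (simp add: t_def)
  have d2: "max_degree_2 R F"
  proof
    show "card {j \<in> R. F i j} \<le> 2" if "i \<in> R" for i using t(1)[OF that] tR[OF that] by auto
  qed (use R simple_graph_sym[OF F] simple_graph_irrefl[OF F] in auto)
  interpret max_degree_2 R F by (rule d2)
  obtain a b where ab: "{i \<in> R. t i = -1} = {a, b}" "a \<noteq> b" using t(2) by (auto simp: card_2_iff)
  have one: "card {j \<in> R. F i j} = 1 \<longleftrightarrow> i = a \<or> i = b" if "i \<in> R" for i
  proof -
    have "i \<in> {i \<in> R. t i = -1} \<longleftrightarrow> i = a \<or> i = b" unfolding ab(1) by blast
    then show ?thesis using tR[OF that] that by force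
  qed
  have two: "card {j \<in> R. F i j} = 2" if "i \<in> R" "i \<noteq> a" "i \<noteq> b" for i
    using t(1)[OF that(1)] tR[OF that(1)] one[OF that(1)] that(2,3) by force
  have aR: "a \<in> R" "b \<in> R" using ab(1) by blast+
  obtain xs where xs: "simple_walk R F xs" "xs ! 0 = a"
    "\<forall>j\<in>R. F (xs ! (length xs - 1)) j \<longrightarrow> j \<in> set xs"
    using maximal_simple_walk[OF R(1) aR(1)] by blast
  have "card {j \<in> R. F (xs ! 0) j} = 1" using one[OF aR(1)] xs(2) by simp
  note pe = walk_from_end[OF xs(1,3) this]
  have xsd: "distinct xs" "set xs \<subseteq> R" "xs \<noteq> []" using xs(1) by (auto simp: simple_walk_def)
  have lastR: "xs ! (length xs - 1) \<in> R" using xsd by (meson diff_less length_greater_0_conv less_numeral_extra(1) nth_mem subsetD)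
  have "xs ! (length xs - 1) \<noteq> a"
    using xs(2)[symmetric] xsd pe(1) by (simp add: nth_eq_iff_index_eq)
  then have "xs ! (length xs - 1) = b" using one[OF lastR] pe(2) by auto
  then have ab_xs: "a \<in> set xs" "b \<in> set xs"
    using xs(2) xsd by (metis length_greater_0_conv nth_mem, metis diff_less length_greater_0_conv less_numeral_extra(1) nth_mem)
  have closed_xs: "j \<in> set xs" if "i \<in> set xs" "j \<in> R" "F i j" for i j
    using that pe(3) by (metis in_set_conv_nth)
  show ?thesis
  proof (cases "set xs = R")
    case True
    have "F (xs ! i) (xs ! j) \<longleftrightarrow> i + 1 = j \<or> j + 1 = i" if ij: "i < length xs" "j < length xs" for i j
    proof
      assume "F (xs ! i) (xs ! j)"
      moreover have "xs ! j \<in> R" using xsd(2) nth_mem[OF ij(2)] by blast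
      ultimately obtain p where "p < length xs" "xs ! j = xs ! p" "p + 1 = i \<or> i + 1 = p"
        using pe(3)[OF ij(1), of "xs ! j"] by blast
      then show "i + 1 = j \<or> j + 1 = i" using xsd ij by (auto simp: nth_eq_iff_index_eq)
    next
      assume "i + 1 = j \<or> j + 1 = i"
      then show "F (xs ! i) (xs ! j)"
        using xs(1) ij simple_graph_sym[OF F] by (auto simp: simple_walk_def)
    qed
    from KP_iso_if_path[OF F U univ xsd(1) True[unfolded R_def] this] show ?thesis .
  next
    case False
    \<comment> \<open>Both vertices of degree one lie on \<open>xs\<close>, which is closed under
      adjacency in \<open>R\<close>. A maximal walk from \<open>w\<close> therefore meets only
      vertices of degree two, and closes to a cycle disjoint from the path.\<close>
    then obtain w where w: "w \<in> R" "w \<notin> set xs" using xsd by auto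
    obtain ys where ys: "simple_walk R F ys" "ys ! 0 = w"
      "\<forall>j\<in>R. F (ys ! (length ys - 1)) j \<longrightarrow> j \<in> set ys"
      using maximal_simple_walk[OF R(1) w(1)] by blast
    have ysd: "distinct ys" "set ys \<subseteq> R" "ys \<noteq> []" using ys(1) by (auto simp: simple_walk_def)
    have notin: "ys ! i \<notin> set xs" if "i < length ys" for i
      using that
    proof (induction i)
      case 0
      then show ?case using w ys by simp
    next
      case (Suc i)
      have "F (ys ! Suc i) (ys ! i)" using ys(1) Suc.prems simple_graph_sym[OF F] by (auto simp: simple_walk_def)
      moreover have "ys ! i \<in> R" using ysd(2) nth_mem[of i ys] Suc.prems by auto
      ultimately show ?case using closed_xs[of "ys ! Suc i" "ys ! i"] Suc by auto
    qed
    have disj: "set xs \<inter> set ys = {}"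
    proof (rule ccontr)
      assume "set xs \<inter> set ys \<noteq> {}"
      then obtain v where v: "v \<in> set xs" "v \<in> set ys" by blast
      then obtain i where "i < length ys" "ys ! i = v" by (auto simp: in_set_conv_nth)
      then show False using notin v by blast
    qed
    have ys2: "card {j \<in> R. F i j} = 2" if "i \<in> set ys" for i
      using two[of i] that ysd disj ab_xs by auto
    note cy = walk_closes[OF ys(1,3) ys2]
    define l where "l = length ys"
    have l3: "3 \<le> l" using cy(1) by (simp add: l_def)
    have "card (set xs \<union> set ys) \<le> card R" using xsd ysd R by (intro card_mono) auto
    then have ln: "l + 2 \<le> n"
      using disj xsd ysd pe(1) R by (simp add: card_Un_disjoint distinct_card l_def)
    define om where "om = 2 * pi / real l"
    have om: "0 < om" "om < pi" using l3 by (auto simp: om_def field_simps)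
    have lom: "real l * om = 2 * pi" using l3 by (simp add: om_def)
    define s where "s = \<alpha> * (real m + 2) + 2 * (1 - \<alpha>) * cos om"
    have dg: "deg ?N F i = real m + 2" if "i \<in> set ys" for i
      using nbR[of i] ys2[OF that] ysd that by auto
    have cos1: "cos om \<noteq> 1" using om cos_monotone_0_pi[of 0 om] by simp
    define x where "x v = (\<Sum>i<length ys. of_bool (ys ! i = v) * cos (real i * om))" for v
    define y where "y v = (\<Sum>i<length ys. of_bool (ys ! i = v) * sin (real i * om))" for v
    have univ': "F u j" if "u < ?N" "u \<notin> R" "j < ?N" "j \<noteq> u" for u j
      using univ that by (simp add: R_def)
    have ex: "(\<Sum>j<?N. A_alpha \<alpha> ?N F $$ (v, j) * x j) = s * x v" if "v < ?N" for v
      unfolding x_def s_def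
    proof (rule cycle_eigenvector[OF F R(2) univ' d2 ys(1) cy dg _ _ cos1 that])
      show "cos ((z + 1) * om) + cos ((z - 1) * om) = 2 * cos om * cos (z * om)" for z
        by (simp add: distrib_right left_diff_distrib cos_add cos_diff)
      show "cos ((z + real (length ys)) * om) = cos (z * om)" for z
        using lom by (simp add: distrib_right cos_add l_def)
    qed
    have ey: "(\<Sum>j<?N. A_alpha \<alpha> ?N F $$ (v, j) * y j) = s * y v" if "v < ?N" for v
      unfolding y_def s_def
    proof (rule cycle_eigenvector[OF F R(2) univ' d2 ys(1) cy dg _ _ cos1 that])
      show "sin ((z + 1) * om) + sin ((z - 1) * om) = 2 * cos om * sin (z * om)" for z
        by (simp add: distrib_right left_diff_distrib sin_add sin_diff)
      show "sin ((z + real (length ys)) * om) = sin (z * om)" for z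
        using lom by (simp add: distrib_right sin_add l_def)
    qed
    have nth: "(\<Sum>i<length ys. of_bool (ys ! i = ys ! p) * g i) = (g p :: real)"
      if p: "p < length ys" for g p
    proof -
      have "(\<Sum>i<length ys. of_bool (ys ! i = ys ! p) * g i) = (\<Sum>i<length ys. if i = p then g i else 0)"
        using p ysd by (intro sum.cong refl) (auto simp: nth_eq_iff_index_eq)
      then show ?thesis using p by simp
    qed
    have p01: "0 < length ys" "1 < length ys" using l3 by (auto simp: l_def)
    have indep: "c = 0 \<and> d = 0" if "\<And>i. i < ?N \<Longrightarrow> c * x i + d * y i = 0" for c d
    proof -
      have ysN: "ys ! p < ?N" if "p < length ys" for p
        using ysd(2) R(2) nth_mem[OF that] by blast
      have c: "c = 0" using that[OF ysN[OF p01(1)]] unfolding x_def y_def nth[OF p01(1)] by simp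
      have "d * sin om = 0" using that[OF ysN[OF p01(2)]] c unfolding x_def y_def nth[OF p01(2)] by simp
      then show ?thesis using c sin_gt_zero[OF om] by simp
    qed
    obtain lF uF where lF: "eigenbasis ?N (A_alpha \<alpha> ?N F) lF uF"
      "A_alpha_spectrum \<alpha> ?N F = image_mset lF (mset_set {..<?N})"
      using A_alpha_eigenbasis[OF F] .
    obtain lG uG where lG: "eigenbasis ?N (A_alpha \<alpha> ?N (KP m n)) lG uG"
      "A_alpha_spectrum \<alpha> ?N (KP m n) = image_mset lG (mset_set {..<?N})"
      using A_alpha_eigenbasis[OF KP_simple] .
    define K where "K = {k \<in> {..<?N}. lG k = s}"
    have "2 \<le> card {k \<in> {..<?N}. lF k = s}"
      by (rule eigenbasis.card_eigenvalue_ge_2[OF lF(1) ex ey indep])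
    then have K: "2 \<le> card K"
      using card_eq_of_image_mset_eq[OF spec[unfolded lF(2) lG(2)], of "\<lambda>x. x = s"] by (simp add: K_def)
    obtain z where z: "\<exists>i<?N. z i \<noteq> 0"
      "\<And>w. w \<in> {\<lambda>j. of_bool (j = 0)} \<Longrightarrow> (\<Sum>i<?N. w i * z i) = 0"
      "\<And>k. k < ?N \<Longrightarrow> k \<notin> K \<Longrightarrow> eigenbasis.coef ?N uG z k = 0"
      by (rule eigenbasis.exists_vector[OF lG(1), of K "{\<lambda>j. of_bool (j = 0)}"])
        (use K in \<open>auto simp: K_def\<close>)
    have "(\<Sum>i<?N. of_bool (i = 0) * z i) = (\<Sum>i<?N. if i = 0 then z i else 0)"
      by (intro sum.cong refl) auto
    then have z0: "z 0 = 0" using z(2)[of "\<lambda>j. of_bool (j = 0)"] m by simp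
    have ez: "(\<Sum>j<?N. A_alpha \<alpha> ?N (KP m n) $$ (i, j) * z j) = s * z i" if "i < ?N" for i
      by (rule eigenbasis.eigenvector_if_coef[OF lG(1) _ that]) (use z(3) in \<open>auto simp: K_def\<close>)
    \<comment> \<open>The path has at least two vertices, hence \<open>l + 2 \<le> n\<close>. With
      only \<alpha> > 1/2 known, bounding the cosine by 1 requires \<open>n \<ge> 6\<close>. The
      value \<open>n = 5\<close> is left for triangles alone, where the exact cosine
      \<open>- 1 / 2\<close> helps.\<close>
    have "s < \<alpha> * real ?N - 1"
    proof (cases "l = 3")
      case True
      then have "om = pi - pi / 3" by (simp add: om_def field_simps)
      then have "cos om = - cos (pi / 3)" using cos_pi_minus[of "pi / 3"] by metis
      then have "cos om = - 1 / 2" by (simp add: cos_60)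
      moreover have "5 \<le> n" using ln True by simp
      then have "\<alpha> * 5 \<le> \<alpha> * real n" using a0 by (intro mult_left_mono) auto
      ultimately show ?thesis unfolding s_def using a0 by (simp add: algebra_simps)
    next
      case False
      then have "6 \<le> n" using ln l3 by simp
      then have "6 * \<alpha> \<le> \<alpha> * real n" using a0 by simp
      moreover have "(1 - \<alpha>) * cos om \<le> 1 - \<alpha>" using \<alpha> by (intro mult_left_le) auto
      moreover have "a + 2 * \<alpha> + 2 * b < a + c - 1" if "6 * \<alpha> \<le> c" "b \<le> 1 - \<alpha>" for a b c
        using that \<alpha> by linarith
      ultimately have "\<alpha> * real m + 2 * \<alpha> + 2 * ((1 - \<alpha>) * cos om) < \<alpha> * real m + \<alpha> * real n - 1"
        by blast
      then show ?thesis by (simp add: s_def algebra_simps)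
    qed
    then have ne: "s \<noteq> \<alpha> * real ?N - 1" by simp
    have "z i = 0" if "i < ?N" for i
      by (rule KP_no_eigenvector[OF m n l3 \<alpha> _ ne ez z0 that]) (simp add: s_def om_def)
    with z(1) show ?thesis by blast
  qed
qed

section \<open>Universal vertices of a cospectral graph\<close>

lemma universal_iff:
  assumes F: "simple_graph N F" and u: "u < N"
  shows "deg N F u \<le> real N - 1" and "deg N F u = real N - 1 \<longleftrightarrow> (\<forall>j<N. j \<noteq> u \<longrightarrow> F u j)"
proof -
  let ?S = "{j \<in> {0..<N}. F u j}" and ?T = "{0..<N} - {u}"
  have sub: "?S \<subseteq> ?T" using simple_graph_irrefl[OF F] by auto
  have T: "card ?T = N - 1" using u by simp
  have le: "card ?S \<le> card ?T" using sub by (intro card_mono) auto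
  then show "deg N F u \<le> real N - 1" using u unfolding Defs.degree_def T by linarith
  have "deg N F u = real N - 1 \<longleftrightarrow> card ?S = card ?T"
    using u unfolding Defs.degree_def T by linarith
  also have "\<dots> \<longleftrightarrow> ?S = ?T"
  proof
    assume "card ?S = card ?T"
    show "?S = ?T" by (rule card_subset_eq[OF _ sub \<open>card ?S = card ?T\<close>]) simp
  qed (rule arg_cong)
  also have "\<dots> \<longleftrightarrow> ?T \<subseteq> ?S" using sub by blast
  also have "\<dots> \<longleftrightarrow> (\<forall>j<N. j \<noteq> u \<longrightarrow> F u j)" by (auto simp: subset_iff)
  finally show "deg N F u = real N - 1 \<longleftrightarrow> (\<forall>j<N. j \<noteq> u \<longrightarrow> F u j)" .
qed

lemma unit_functional:
  fixes x :: "nat \<Rightarrow> real"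
  assumes "i < N"
  shows "(\<Sum>j<N. of_bool (i = j) * x j) = x i"
proof -
  have "(\<Sum>j<N. of_bool (i = j) * x j) = (\<Sum>j<N. if j = i then x j else 0)"
    by (intro sum.cong refl) auto
  then show ?thesis using assms by simp
qed

text \<open>The \<open>m\<close> eigenvalues at least \<open>?c\<close> leave a nonzero vector under
  fewer than \<open>m\<close> linear conditions. Sum zero lets \<open>form_sum_zero_ge\<close> kill
  its entries off the universal vertices; the other conditions kill the rest.\<close>

lemma many_universal_vertices:
  assumes m: "2 \<le> m" and \<alpha>: "1/2 < \<alpha>" "\<alpha> < 1" and F: "simple_graph (m + n) F"
    and spec: "A_alpha_spectrum \<alpha> (m + n) F = A_alpha_spectrum \<alpha> (m + n) (KP m n)"
  shows "m \<le> card {u \<in> {..<m + n}. deg (m + n) F u = real (m + n) - 1}"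
proof (rule ccontr)
  let ?N = "m + n" and ?c = "\<alpha> * real (m + n) - 1"
  define V where "V = {u \<in> {..<?N}. deg ?N F u = real ?N - 1}"
  assume "\<not> m \<le> card {u \<in> {..<m + n}. deg (m + n) F u = real (m + n) - 1}"
  then have less: "card V < m" by (simp add: V_def)
  obtain lF uF where lF: "eigenbasis ?N (A_alpha \<alpha> ?N F) lF uF"
    "A_alpha_spectrum \<alpha> ?N F = image_mset lF (mset_set {..<?N})"
    using A_alpha_eigenbasis[OF F] .
  obtain lG uG where lG: "eigenbasis ?N (A_alpha \<alpha> ?N (KP m n)) lG uG"
    "A_alpha_spectrum \<alpha> ?N (KP m n) = image_mset lG (mset_set {..<?N})"
    using A_alpha_eigenbasis[OF KP_simple] .
  define K where "K = {k \<in> {..<?N}. ?c \<le> lF k}"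
  have "card {..<m} \<le> card {k \<in> {..<?N}. ?c \<le> lG k}"
  proof (rule eigenbasis.card_eigenvalues_ge[OF lG(1)])
    fix x :: "nat \<Rightarrow> real"
    assume "\<And>i. i < ?N \<Longrightarrow> i \<notin> {..<m} \<Longrightarrow> x i = 0"
    then show "?c * (\<Sum>i<?N. (x i)\<^sup>2)
        \<le> (\<Sum>i<?N. \<Sum>j<?N. A_alpha \<alpha> ?N (KP m n) $$ (i, j) * x i * x j)"
      by (intro KP_clique_form \<alpha>(2)) auto
  qed auto
  then have cK: "m \<le> card K"
    using card_eq_of_image_mset_eq[OF spec[unfolded lF(2) lG(2)], of "\<lambda>x. ?c \<le> x"] by (simp add: K_def)
  \<comment> \<open>The entry at \<open>v\<close> needs no condition of its own: once all others
    vanish, sum zero settles it. So at most \<open>card V\<close> conditions are imposed, or just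
    one if \<open>V\<close> is empty; then \<open>v\<close> is arbitrary and
    \<open>2 \<le> m\<close> makes the count work.\<close>
  define v where "v = (SOME v. v \<in> V)"
  define W where "W = insert (\<lambda>_. 1) ((\<lambda>i j. of_bool (i = j) :: real) ` (V - {v}))"
  have finV: "finite V" by (simp add: V_def)
  have "card W \<le> Suc (card (V - {v}))"
    unfolding W_def using card_image_le[of "V - {v}" "\<lambda>i j. of_bool (i = j) :: real"] finV
    by (simp add: card_insert_if)
  also have "\<dots> < m"
  proof (cases "V = {}")
    case False
    then have "v \<in> V" unfolding v_def by (simp add: some_in_eq)
    then have "card (V - {v}) = card V - 1" "card V > 0" using finV by (auto simp: card_gt_0_iff)
    then show ?thesis using less by simp
  qed (use m in simp)
  finally have "card W < card K" using cK by simp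
  moreover have "finite W" using finV by (simp add: W_def)
  ultimately obtain z where z: "\<exists>i<?N. z i \<noteq> 0" "\<And>w. w \<in> W \<Longrightarrow> (\<Sum>i<?N. w i * z i) = 0"
    "\<And>k. k < ?N \<Longrightarrow> k \<notin> K \<Longrightarrow> eigenbasis.coef ?N uF z k = 0"
    using eigenbasis.exists_vector[OF lF(1), of K W] by (auto simp: K_def)
  have sum0: "(\<Sum>i<?N. z i) = 0" using z(2)[of "\<lambda>_. 1"] by (simp add: W_def)
  have "?c * (\<Sum>i<?N. (z i)\<^sup>2) \<le> (\<Sum>i<?N. \<Sum>j<?N. A_alpha \<alpha> ?N F $$ (i, j) * z i * z j)"
    by (rule eigenbasis.quadratic_form_ge[OF lF(1)]) (use z(3) in \<open>auto simp: K_def\<close>)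
  from form_sum_zero_ge[OF F \<alpha> sum0 this]
  have outside: "z i = 0" if "i < ?N" "i \<notin> V" for i
    using that universal_iff(1)[OF F that(1)] by (force simp: V_def)
  have inside: "z i = 0" if "i \<in> V" "i \<noteq> v" for i
  proof -
    have "(\<lambda>j. of_bool (i = j)) \<in> W" using that by (auto simp: W_def)
    from z(2)[OF this] show ?thesis using that unit_functional[of i ?N z] by (simp add: V_def)
  qed
  have "z v = 0" if "v < ?N"
  proof -
    have "(\<Sum>i<?N. z i) = (\<Sum>i<?N. if i = v then z i else 0)"
      by (intro sum.cong refl) (use outside inside in auto)
    then show ?thesis using sum0 that by simp
  qed
  then have "\<forall>i<?N. z i = 0" using outside inside by metis
  with z(1) show False by blast
qed

text \<open>Two vertices of degree at least 6 span a plane on which the form is at least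
  \<open>6 * \<alpha> - (1 - \<alpha>)\<close> times the squared norm, and this reaches
  \<open>2 + \<alpha>\<close> as soon as \<alpha> \<ge> 1/2: hence the number 6. In the fan, two
  eigenvalues of that size would leave a vector vanishing at the hub, against
  \<open>KP_path_form\<close>.\<close>

lemma one_large_degree:
  assumes n: "2 \<le> n" and \<alpha>: "1/2 < \<alpha>" "\<alpha> < 1" and F: "simple_graph (1 + n) F"
    and spec: "A_alpha_spectrum \<alpha> (1 + n) F = A_alpha_spectrum \<alpha> (1 + n) (KP 1 n)"
    and uv: "u < 1 + n" "v < 1 + n" "u \<noteq> v"
    and large: "6 \<le> deg (1 + n) F u" "6 \<le> deg (1 + n) F v"
  shows False
proof -
  let ?N = "1 + n" and ?c = "2 + \<alpha>"
  obtain lF uF where lF: "eigenbasis ?N (A_alpha \<alpha> ?N F) lF uF"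
    "A_alpha_spectrum \<alpha> ?N F = image_mset lF (mset_set {..<?N})"
    using A_alpha_eigenbasis[OF F] .
  obtain lG uG where lG: "eigenbasis ?N (A_alpha \<alpha> ?N (KP 1 n)) lG uG"
    "A_alpha_spectrum \<alpha> ?N (KP 1 n) = image_mset lG (mset_set {..<?N})"
    using A_alpha_eigenbasis[OF KP_simple] .
  have "card {u, v} \<le> card {k \<in> {..<?N}. ?c \<le> lF k}"
  proof (rule eigenbasis.card_eigenvalues_ge[OF lF(1)])
    fix x :: "nat \<Rightarrow> real"
    assume zero: "\<And>i. i < ?N \<Longrightarrow> i \<notin> {u, v} \<Longrightarrow> x i = 0"
    have two: "(\<Sum>i<?N. f i) = f u + f v" if "\<And>i. i < ?N \<Longrightarrow> i \<notin> {u, v} \<Longrightarrow> f i = 0" for f :: "nat \<Rightarrow> real"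
    proof -
      have "(\<Sum>i<?N. f i) = (\<Sum>i\<in>{u, v}. f i)"
        by (rule sum.mono_neutral_right) (use that uv in auto)
      then show ?thesis using uv by simp
    qed
    have s: "(\<Sum>i<?N. (x i)\<^sup>2) = (x u)\<^sup>2 + (x v)\<^sup>2" by (rule two) (simp add: zero)
    have d: "(\<Sum>i<?N. deg ?N F i * (x i)\<^sup>2) = deg ?N F u * (x u)\<^sup>2 + deg ?N F v * (x v)\<^sup>2"
      by (rule two) (simp add: zero)
    have "(\<Sum>i<?N. \<Sum>j<?N. adj F i j * x i * x j)
        = (\<Sum>j<?N. adj F u j * x u * x j) + (\<Sum>j<?N. adj F v j * x v * x j)"
      by (rule two) (simp add: zero)
    also have "(\<Sum>j<?N. adj F u j * x u * x j) = adj F u v * x u * x v"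
      by (subst two) (simp_all add: zero simple_graph_irrefl[OF F])
    also have "(\<Sum>j<?N. adj F v j * x v * x j) = adj F u v * x u * x v"
      using simple_graph_sym[OF F, of u v] by (subst two) (simp_all add: zero simple_graph_irrefl[OF F])
    finally have a: "(\<Sum>i<?N. \<Sum>j<?N. adj F i j * x i * x j) = adj F u v * (2 * x u * x v)" by simp
    have "- ((x u)\<^sup>2 + (x v)\<^sup>2) \<le> 2 * x u * x v"
      using sum_power2_ge_zero[of "x u + x v" 0] by (simp add: power2_sum)
    then have ge: "- ((x u)\<^sup>2 + (x v)\<^sup>2) \<le> adj F u v * (2 * x u * x v)"
      by (cases "F u v") auto
    have "6 * (x u)\<^sup>2 \<le> deg ?N F u * (x u)\<^sup>2" "6 * (x v)\<^sup>2 \<le> deg ?N F v * (x v)\<^sup>2"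
      using large by (auto intro: mult_right_mono)
    then have "\<alpha> * (6 * ((x u)\<^sup>2 + (x v)\<^sup>2)) \<le> \<alpha> * (deg ?N F u * (x u)\<^sup>2 + deg ?N F v * (x v)\<^sup>2)"
      using \<alpha> by (intro mult_left_mono) auto
    moreover have "(1 - \<alpha>) * (- ((x u)\<^sup>2 + (x v)\<^sup>2)) \<le> (1 - \<alpha>) * (adj F u v * (2 * x u * x v))"
      using \<alpha> ge by (intro mult_left_mono) auto
    moreover have "0 \<le> (6 * \<alpha> - 3) * ((x u)\<^sup>2 + (x v)\<^sup>2)" using \<alpha> by simp
    ultimately show "?c * (\<Sum>i<?N. (x i)\<^sup>2) \<le> (\<Sum>i<?N. \<Sum>j<?N. A_alpha \<alpha> ?N F $$ (i, j) * x i * x j)"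
      unfolding A_alpha_form s d a by (simp add: algebra_simps)
  qed (use uv in auto)
  then have "2 \<le> card {k \<in> {..<?N}. ?c \<le> lF k}" using uv by simp
  moreover define K where "K = {k \<in> {..<?N}. ?c \<le> lG k}"
  ultimately have K: "2 \<le> card K"
    using card_eq_of_image_mset_eq[OF spec[unfolded lF(2) lG(2)], of "\<lambda>x. ?c \<le> x"] by simp
  let ?w = "\<lambda>j. of_bool (0 = j) :: real"
  obtain z where z: "\<exists>i<?N. z i \<noteq> 0" "\<And>w. w \<in> {?w} \<Longrightarrow> (\<Sum>i<?N. w i * z i) = 0"
    "\<And>k. k < ?N \<Longrightarrow> k \<notin> K \<Longrightarrow> eigenbasis.coef ?N uG z k = 0"
    by (rule eigenbasis.exists_vector[OF lG(1), of K "{?w}"]) (use K in \<open>auto simp: K_def\<close>)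
  have "z 0 = 0" using z(2)[of ?w] unit_functional[of 0 ?N z] by simp
  then have z0: "z i = 0" if "i < 1" for i using that by simp
  have "?c * (\<Sum>i<?N. (z i)\<^sup>2) \<le> (\<Sum>i<?N. \<Sum>j<?N. A_alpha \<alpha> ?N (KP 1 n) $$ (i, j) * z i * z j)"
    by (rule eigenbasis.quadratic_form_ge[OF lG(1)]) (use z(3) in \<open>auto simp: K_def\<close>)
  with KP_path_form[OF z0 z(1) n \<alpha>(2)] show False by simp
qed

section \<open>Triangle counts\<close>

lemma triangles_at_le_pairs:
  assumes F: "simple_graph N F"
  shows "triangles_at N F v \<le> deg N F v * (deg N F v - 1)"
proof -
  have "(\<Sum>l<N. adj F v j * adj F j l * adj F l v) \<le> adj F v j * (deg N F v - 1)" if j: "j < N" for j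
  proof (cases "F v j")
    case True
    have "(\<Sum>l<N. adj F v j * adj F j l * adj F l v) \<le> (\<Sum>l<N. adj F v l - (if l = j then 1 else 0))"
      using True simple_graph_irrefl[OF F, of j] simple_graph_sym[OF F, of v]
      by (intro sum_mono) auto
    also have "\<dots> = deg N F v - 1" using j by (simp only: sum_subtractf deg_eq_sum) simp
    finally show ?thesis using True by simp
  qed simp
  then have "triangles_at N F v \<le> (\<Sum>j<N. adj F v j * (deg N F v - 1))"
    unfolding triangles_at_def by (intro sum_mono) auto
  also have "\<dots> = deg N F v * (deg N F v - 1)"
    unfolding sum_distrib_right[symmetric] deg_eq_sum[symmetric] ..
  finally show ?thesis .
qed

text \<open>The count runs over directed edges among the neighbours of \<open>v\<close>. None of
  them touches \<open>v\<close> or \<open>w\<close>, and as these two are not adjacent, the edges at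
  them are subtracted without overlap.\<close>

lemma triangles_at_le_edges:
  assumes F: "simple_graph N F" and vw: "v < N" "w < N" "v \<noteq> w" "\<not> F v w"
  shows "triangles_at N F v \<le> (\<Sum>i<N. deg N F i) - 2 * deg N F v - 2 * deg N F w"
proof -
  have "triangles_at N F v \<le> (\<Sum>j<N. \<Sum>l<N. adj F j l - adj F j l * of_bool (j = v) - adj F j l * of_bool (l = v)
      - adj F j l * of_bool (j = w) - adj F j l * of_bool (l = w))"
    unfolding triangles_at_def
  proof (intro sum_mono)
    fix j l
    show "adj F v j * adj F j l * adj F l v \<le> adj F j l - adj F j l * of_bool (j = v)
      - adj F j l * of_bool (l = v) - adj F j l * of_bool (j = w) - adj F j l * of_bool (l = w)"
      using vw simple_graph_irrefl[OF F, of v] simple_graph_irrefl[OF F, of w] simple_graph_irrefl[OF F, of j]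
        simple_graph_sym[OF F, of v w] simple_graph_sym[OF F, of l v]
      by (cases "F j l"; cases "j = v"; cases "l = v"; cases "j = w"; cases "l = w") auto
  qed
  also have "\<dots> = (\<Sum>i<N. deg N F i) - 2 * deg N F v - 2 * deg N F w"
  proof -
    have total: "(\<Sum>j<N. \<Sum>l<N. adj F j l) = (\<Sum>i<N. deg N F i)" unfolding deg_eq_sum ..
    have b: "(\<Sum>i<N. deg N F i * of_bool (i = u)) = deg N F u" if "u < N" for u
    proof -
      have "(\<Sum>i<N. deg N F i * of_bool (i = u)) = (\<Sum>i<N. if i = u then deg N F i else 0)"
        by (intro sum.cong refl) auto
      then show ?thesis using that by simp
    qed
    show ?thesis
      unfolding sum_subtractf total sum_adj_deg(1)[OF F, of "\<lambda>i. of_bool (i = v)"]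
        sum_adj_deg(1)[OF F, of "\<lambda>i. of_bool (i = w)"]
        sum_adj_deg(2)[OF F, of "\<lambda>i. of_bool (i = v)"]
        sum_adj_deg(2)[OF F, of "\<lambda>i. of_bool (i = w)"] b[OF vw(1)] b[OF vw(2)] by simp
  qed
  finally show ?thesis .
qed

text \<open>The hub forms a triangle with each of the \<open>n - 1\<close> path edges, and each
  triangle is counted twice at each of its three corners.\<close>

lemma KP_triangles:
  assumes n: "2 \<le> n"
  shows "6 * real n - 6 \<le> (\<Sum>i<1 + n. triangles_at (1 + n) (KP 1 n) i)"
proof -
  let ?N = "1 + n"
  define E where "E = KP 1 n"
  have E: "simple_graph ?N E" unfolding E_def by (rule KP_simple)
  have iff: "E i j \<longleftrightarrow> i < ?N \<and> j < ?N \<and> i \<noteq> j \<and> (i = 0 \<or> j = 0 \<or> i + 1 = j \<or> j + 1 = i)" for i j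
    by (auto simp: E_def KP_iff)
  have S1: "(\<Sum>i<?N. deg ?N E i) = 4 * real n - 2"
    using KP_deg_sum[OF n, of "\<lambda>x. x" 1] unfolding E_def by simp
  have d0: "deg ?N E 0 = real n" using KP_deg_clique[of 0 1 n] unfolding E_def by simp
  have "(\<Sum>j<?N. \<Sum>l<?N. adj E j l - adj E j l * of_bool (j = 0) - adj E j l * of_bool (l = 0))
      \<le> triangles_at ?N E 0"
    unfolding triangles_at_def
  proof (intro sum_mono)
    fix j l
    show "adj E j l - adj E j l * of_bool (j = 0) - adj E j l * of_bool (l = 0)
        \<le> adj E 0 j * adj E j l * adj E l 0"
      by (cases "E j l"; cases "j = 0"; cases "l = 0") (auto simp: iff)
  qed
  moreover have b: "(\<Sum>i<?N. deg ?N E i * of_bool (i = 0)) = deg ?N E 0"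
  proof -
    have "(\<Sum>i<?N. deg ?N E i * of_bool (i = 0)) = (\<Sum>i<?N. if i = 0 then deg ?N E i else 0)"
      by (intro sum.cong refl) auto
    then show ?thesis by simp
  qed
  have "(\<Sum>j<?N. \<Sum>l<?N. adj E j l - adj E j l * of_bool (j = 0) - adj E j l * of_bool (l = 0))
      = (\<Sum>i<?N. deg ?N E i) - 2 * deg ?N E 0"
    unfolding sum_subtractf sum_adj_deg(1)[OF E, of "\<lambda>i. of_bool (i = 0)"]
      sum_adj_deg(2)[OF E, of "\<lambda>i. of_bool (i = 0)"] b deg_eq_sum[symmetric] by simp
  ultimately have T0: "2 * real n - 2 \<le> triangles_at ?N E 0" unfolding S1 d0 by linarith
  have "(\<Sum>j<?N. of_bool (j = 0) :: real) = (\<Sum>j<?N. if j = 0 then 1 else 0)"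
    by (intro sum.cong refl) auto
  then have one: "(\<Sum>j<?N. of_bool (j = 0) :: real) = 1" by simp
  have Ti: "2 * (deg ?N E i - 1) \<le> triangles_at ?N E i" if i: "i < ?N" "i \<noteq> 0" for i
  proof -
    \<comment> \<open>At a path vertex the triangles through the hub are enough: one of
      \<open>j\<close>, \<open>l\<close> is 0, the other a neighbour of \<open>i\<close> on the
      path.\<close>
    have "(\<Sum>j<?N. \<Sum>l<?N. of_bool (j = 0) * (adj E i l - of_bool (l = 0))
        + of_bool (l = 0) * (adj E i j - of_bool (j = 0))) \<le> triangles_at ?N E i"
      unfolding triangles_at_def
    proof (intro sum_mono)
      fix j l assume "j \<in> {..<?N}" "l \<in> {..<?N}"
      then show "of_bool (j = 0) * (adj E i l - of_bool (l = 0))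
          + of_bool (l = 0) * (adj E i j - of_bool (j = 0)) \<le> adj E i j * adj E j l * adj E l i"
        using i by (cases "j = 0"; cases "l = 0") (auto simp: iff)
    qed
    also have "(\<Sum>j<?N. \<Sum>l<?N. of_bool (j = 0) * (adj E i l - of_bool (l = 0))
        + of_bool (l = 0) * (adj E i j - of_bool (j = 0)))
      = (\<Sum>j<?N. of_bool (j = 0)) * (\<Sum>l<?N. adj E i l - of_bool (l = 0))
        + (\<Sum>j<?N. adj E i j - of_bool (j = 0)) * (\<Sum>l<?N. of_bool (l = 0))"
      unfolding sum_product by (simp only: sum.distrib mult.commute)
    finally show ?thesis unfolding sum_subtractf deg_eq_sum[symmetric] one by simp
  qed
  have "(\<Sum>i<?N. triangles_at ?N E i) = triangles_at ?N E 0 + (\<Sum>i\<in>{..<?N} - {0}. triangles_at ?N E i)"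
    by (rule sum.remove) auto
  moreover have "(\<Sum>i\<in>{..<?N} - {0}. 2 * (deg ?N E i - 1)) \<le> (\<Sum>i\<in>{..<?N} - {0}. triangles_at ?N E i)"
    using Ti by (intro sum_mono) auto
  moreover have "(\<Sum>i<?N. deg ?N E i) = deg ?N E 0 + (\<Sum>i\<in>{..<?N} - {0}. deg ?N E i)"
    by (rule sum.remove) auto
  moreover have "(\<Sum>i\<in>{..<?N} - {0}. 2 * (deg ?N E i - 1))
      = 2 * (\<Sum>i\<in>{..<?N} - {0}. deg ?N E i) - 2 * real n"
    by (simp add: sum_subtractf sum_distrib_left[symmetric] right_diff_distrib)
  ultimately show ?thesis unfolding E_def[symmetric] using S1 d0 T0 by linarith
qed

text \<open>Here \<open>n\<^sup>2 + 9 n - 10 - D\<^sup>2\<close>, \<open>4 n - 2 - D\<close> and \<open>Z\<close> are the power sums of the degrees other than the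
  largest degree \<open>D\<close>. The bounds \<open>A\<close> and \<open>B\<close> come from \<open>(d - c) (d - c - 1) \<ge> 0\<close> and
  \<open>(d - c) (d - c - 1) (k - d) \<ge> 0\<close>.\<close>
lemma small_degree_moments:
  fixes n D Z :: int
  assumes n: "2 \<le> n" "n \<le> 10" and D: "0 \<le> D" "D \<le> n - 1"
    and A: "\<And>c. 0 \<le> (n^2 + 9 * n - 10 - D^2) - (2 * c + 1) * (4 * n - 2 - D) + c * (c + 1) * n"
    and Y: "\<And>k. k = 5 \<or> k = D \<Longrightarrow> n^2 + 9 * n - 10 - D^2 \<le> k * (4 * n - 2 - D)"
    and B: "\<And>c k. k = 5 \<or> k = D \<Longrightarrow> Z \<le> (k + 2 * c + 1) * (n^2 + 9 * n - 10 - D^2)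
      - (c * (c + 1) + k * (2 * c + 1)) * (4 * n - 2 - D) + k * c * (c + 1) * n"
    and disj: "n^3 + 27 * n - 38 - D^3 - Z \<le> 0 \<or>
      n^3 + 27 * n - 38 - D^3 - Z < (n^2 + 9 * n - 10 - D^2) - D - 6 * n + 6"
  shows "n = 4 \<and> D = 3 \<or> n = 5 \<and> D = 4 \<or> n = 6 \<and> D = 5"
proof -
  \<comment> \<open>The degrees lie between 0 and 5, so roots \<open>c\<close>, \<open>c + 1\<close>
    with \<open>c \<le> 4\<close> cover them. Both caps 5 and \<open>D\<close> are used, as either
    may be the smaller one.\<close>
  note facts = A[of 0] A[of 1] A[of 2] A[of 3] A[of 4] Y[of 5] Y[of D] disj
    B[of 5 0] B[of 5 1] B[of 5 2] B[of 5 3] B[of 5 4] B[of D 0] B[of D 1] B[of D 2] B[of D 3]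
  have ns: "n = 2 \<or> n = 3 \<or> n = 4 \<or> n = 5 \<or> n = 6 \<or> n = 7 \<or> n = 8 \<or> n = 9 \<or> n = 10"
    using n by arith
  have Ds: "D = 0 \<or> D = 1 \<or> D = 2 \<or> D = 3 \<or> D = 4 \<or> D = 5 \<or> D = 6 \<or> D = 7 \<or> D = 8 \<or> D = 9"
    using n D by arith
  show ?thesis
    using ns
  proof (elim disjE)
    assume "n = 2"
    then show ?thesis using Ds D facts by (elim disjE) simp_all
  next
    assume "n = 3"
    then show ?thesis using Ds D facts by (elim disjE) simp_all
  next
    assume "n = 4"
    then show ?thesis using Ds D facts by (elim disjE) simp_all
  next
    assume "n = 5"
    then show ?thesis using Ds D facts by (elim disjE) simp_all
  next
    assume "n = 6"
    then show ?thesis using Ds D facts by (elim disjE) simp_all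
  next
    assume "n = 7"
    then show ?thesis using Ds D facts by (elim disjE) simp_all
  next
    assume "n = 8"
    then show ?thesis using Ds D facts by (elim disjE) simp_all
  next
    assume "n = 9"
    then show ?thesis using Ds D facts by (elim disjE) simp_all
  next
    assume "n = 10"
    then show ?thesis using Ds D facts by (elim disjE) simp_all
  qed
qed

text \<open>The moments for \<open>n = 5\<close> and \<open>D = 4\<close>; the unknowns count the
  other vertices by degree.\<close>

lemma five_degrees:
  fixes a0 a1 a2 a3 a4 :: nat assumes "a0+a1+a2+a3+a4 = 5" "a1+2*a2+3*a3+4*a4=14" "a1+4*a2+9*a3+16*a4=44"
 shows "(a4=1\<and>a3=3\<and>a2=0\<and>a1=1\<and>a0=0)\<or>(a4=2\<and>a3=0\<and>a2=3\<and>a1=0\<and>a0=0)"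
proof -
  \<comment> \<open>These sum \<open>k * (k - 2)\<close>, \<open>(k - 1) * (k - 2) / 2\<close> and
    \<open>k * (k - 1) / 2\<close> over the degrees \<open>k\<close>, dropping the terms with
    \<open>k < 3\<close>.\<close>
  have r: "16 \<le> 3*a3+8*a4" "a3+3*a4 \<le> 6" "3*a3+6*a4\<le>15" using assms by linarith+
  then have "a4 = 0 \<or> a4 = 1 \<or> a4 = 2" by linarith
  then have "a4 = 1 \<and> a3 = 3 \<or> a4 = 2 \<and> a3 = 0"
  proof (elim disjE)
    assume "a4 = 1"
    with r have "8 \<le> 3 * a3" "a3 \<le> 3" by simp_all
    then have "a3 = 3" by presburger
    with \<open>a4 = 1\<close> show ?thesis by simp
  qed (use r in simp_all)
  then show ?thesis
  proof (elim disjE conjE)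
    assume "a4 = 1" "a3 = 3"
    moreover from this assms have "a2 = 0" "a1 = 1" "a0 = 0" by linarith+
    ultimately show ?thesis by simp
  next
    assume "a4 = 2" "a3 = 0"
    moreover from this assms have "a2 = 3" "a1 = 0" "a0 = 0" by linarith+
    ultimately show ?thesis by simp
  qed
qed
text \<open>The same elimination for \<open>n = 6\<close> and \<open>D = 5\<close>.\<close>

lemma six_degrees:
  fixes a0 a1 a2 a3 a4 a5 :: nat assumes "a0+a1+a2+a3+a4+a5 = 6" "a1+2*a2+3*a3+4*a4+5*a5=17" "a1+4*a2+9*a3+16*a4+25*a5=55"
 shows "(a5=1\<and>a4=0\<and>a3=2\<and>a2=3\<and>a1=0\<and>a0=0)\<or>(a5=0\<and>a4=2\<and>a3=2\<and>a2=1\<and>a1=1\<and>a0=0)"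
proof -
  have r: "21 \<le> 3*a3+8*a4+15*a5" "a3+3*a4+6*a5 \<le> 8" "3*a3+6*a4+10*a5 \<le> 19" using assms by linarith+
  then have "a5 = 0 \<or> a5 = 1" by linarith
  then have "a5 = 1 \<and> a4 = 0 \<and> a3 = 2 \<or> a5 = 0 \<and> a4 = 2 \<and> a3 = 2"
  proof
    assume "a5 = 0" with r have "21 \<le> 3*a3+8*a4" "a3+3*a4 \<le> 8" "3*a3+6*a4 \<le> 19" by simp_all
    moreover from this have "a4 = 0 \<or> a4 = 1 \<or> a4 = 2" by linarith
    ultimately have "a4 = 2 \<and> a3 = 2"
    proof (elim disjE)
      assume "a4 = 1" "21 \<le> 3*a3+8*a4" "3*a3+6*a4 \<le> 19"
      then have "3 * a3 = 13" by simp
      then show ?thesis by presburger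
    next
      assume "a4 = 2" "21 \<le> 3*a3+8*a4" "a3+3*a4 \<le> 8"
      then have "5 \<le> 3 * a3" "a3 \<le> 2" by simp_all
      then have "a3 = 2" by presburger
      with \<open>a4 = 2\<close> show ?thesis by simp
    qed simp
    with \<open>a5 = 0\<close> show ?thesis by simp
  next
    assume "a5 = 1" with r have "6 \<le> 3*a3+8*a4" "a3+3*a4 \<le> 2" by simp_all
    then have "a4 = 0 \<and> a3 = 2" by simp
    with \<open>a5 = 1\<close> show ?thesis by simp
  qed
  then show ?thesis
  proof (elim disjE conjE)
    assume "a5 = 1" "a4 = 0" "a3 = 2"
    moreover from this assms have "a2 = 3" "a1 = 0" "a0 = 0" by linarith+
    ultimately show ?thesis by simp
  next
    assume "a5 = 0" "a4 = 2" "a3 = 2"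
    moreover from this assms have "a2 = 1" "a1 = 1" "a0 = 0" by linarith+
    ultimately show ?thesis by simp
  qed
qed
lemma degree_moments:
  fixes d :: "'a \<Rightarrow> int" and n D :: int
  assumes fin: "finite S" and card: "int (card S) = n" and n: "2 \<le> n" and D: "0 \<le> D" "D \<le> n - 1"
    and d: "\<And>i. i \<in> S \<Longrightarrow> 0 \<le> d i \<and> d i \<le> 5 \<and> d i \<le> D"
    and s1: "(\<Sum>i\<in>S. d i) = 4 * n - 2 - D"
    and s2: "(\<Sum>i\<in>S. (d i)\<^sup>2) = n\<^sup>2 + 9 * n - 10 - D\<^sup>2"
    and disj: "n^3 + 27 * n - 38 - D^3 - (\<Sum>i\<in>S. (d i)^3) \<le> 0 \<or>
      n^3 + 27 * n - 38 - D^3 - (\<Sum>i\<in>S. (d i)^3) < (n\<^sup>2 + 9 * n - 10 - D\<^sup>2) - D - 6 * n + 6"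
  shows "n = 5 \<and> D = 4 \<or> n = 6 \<and> D = 5"
proof -
  define Z where "Z = (\<Sum>i\<in>S. (d i)^3)"
  have consecutive: "0 \<le> (x - c) * (x - c - 1)" for x c :: int
    by (cases "x \<le> c") (auto simp: zero_le_mult_iff)
  have A: "0 \<le> (n^2 + 9 * n - 10 - D^2) - (2 * c + 1) * (4 * n - 2 - D) + c * (c + 1) * n" for c
  proof -
    have "0 \<le> (\<Sum>i\<in>S. (d i - c) * (d i - c - 1))" using consecutive by (intro sum_nonneg) auto
    also have "\<dots> = (\<Sum>i\<in>S. (d i)\<^sup>2 - (2 * c + 1) * d i + c * (c + 1))"
      by (intro sum.cong refl) (simp add: power2_eq_square algebra_simps)
    also have "\<dots> = (\<Sum>i\<in>S. (d i)\<^sup>2) - (2 * c + 1) * (\<Sum>i\<in>S. d i) + c * (c + 1) * n"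
      unfolding sum.distrib sum_subtractf sum_distrib_left[symmetric] sum_constant card
      by (simp add: algebra_simps)
    finally show ?thesis unfolding s1 s2 .
  qed
  have Y: "n^2 + 9 * n - 10 - D^2 \<le> k * (4 * n - 2 - D)" if "k = 5 \<or> k = D" for k
  proof -
    have "(\<Sum>i\<in>S. (d i)\<^sup>2) \<le> (\<Sum>i\<in>S. k * d i)"
      using that d by (intro sum_mono) (auto simp: power2_eq_square intro!: mult_right_mono)
    then show ?thesis unfolding s2 sum_distrib_left[symmetric] s1 .
  qed
  have B: "Z \<le> (k + 2 * c + 1) * (n^2 + 9 * n - 10 - D^2)
      - (c * (c + 1) + k * (2 * c + 1)) * (4 * n - 2 - D) + k * c * (c + 1) * n"
    if k: "k = 5 \<or> k = D" for c k
  proof -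
    have "0 \<le> (\<Sum>i\<in>S. ((d i - c) * (d i - c - 1)) * (k - d i))"
      using d k by (intro sum_nonneg mult_nonneg_nonneg[OF consecutive]) auto
    also have "\<dots> = (\<Sum>i\<in>S. (k + 2 * c + 1) * (d i)\<^sup>2 - (c * (c + 1) + k * (2 * c + 1)) * d i
        + k * c * (c + 1) - (d i)^3)"
      by (intro sum.cong refl) (simp add: power2_eq_square power3_eq_cube algebra_simps)
    also have "\<dots> = (k + 2 * c + 1) * (\<Sum>i\<in>S. (d i)\<^sup>2) - (c * (c + 1) + k * (2 * c + 1)) * (\<Sum>i\<in>S. d i)
        + k * c * (c + 1) * n - Z"
      unfolding Z_def sum.distrib sum_subtractf sum_distrib_left[symmetric] sum_constant card
      by (simp add: algebra_simps)
    finally show ?thesis unfolding s1 s2 by simp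
  qed
  have disjZ: "n^3 + 27 * n - 38 - D^3 - Z \<le> 0 \<or>
      n^3 + 27 * n - 38 - D^3 - Z < (n^2 + 9 * n - 10 - D^2) - D - 6 * n + 6"
    using disj unfolding Z_def .
  have "n \<le> 10"
  proof (rule ccontr)
    assume "\<not> n \<le> 10"
    \<comment> \<open>\<open>h6\<close> and \<open>h5\<close> replace \<open>D\<close> by its
      largest possible value \<open>a\<close>. The stronger demand for refuting both parts of
      \<open>disjZ\<close> is then \<open>3 * a^2 - 29 * a - 10 \<ge> 0\<close>, which holds from
      \<open>a = 10\<close> on; this is where the range \<open>n \<le> 10\<close> comes
      from.\<close>
    define a where "a = n - 1"
    have a: "10 \<le> a" "D \<le> a" "n = a + 1" using \<open>\<not> n \<le> 10\<close> D by (auto simp: a_def)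
    have "(d i)^3 \<le> 5 * (d i)\<^sup>2" if "i \<in> S" for i
      using mult_right_mono[of "d i" 5 "(d i)\<^sup>2"] d[OF that]
      by (simp add: power2_eq_square power3_eq_cube mult.assoc)
    then have "Z \<le> (\<Sum>i\<in>S. 5 * (d i)\<^sup>2)" unfolding Z_def by (intro sum_mono)
    then have Z: "Z \<le> 5 * n^2 + 45 * n - 50 - 5 * D^2"
      unfolding sum_distrib_left[symmetric] s2 by (simp add: algebra_simps)
    have aa: "10 * a \<le> a * a" "10 * D \<le> a * D" "0 \<le> D * D" using a D by (auto intro: mult_right_mono)
    have "0 \<le> (a - D) * (a * a + a * D + D * D - 6 * a - 6 * D - 1)"
      using aa a D by (intro mult_nonneg_nonneg) linarith+
    then have h6: "D^3 - 6 * D^2 - D \<le> a^3 - 6 * a^2 - a"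
      by (simp add: algebra_simps power2_eq_square power3_eq_cube)
    have "0 \<le> (a - D) * (a * a + a * D + D * D - 5 * a - 5 * D)"
      using aa a D by (intro mult_nonneg_nonneg) linarith+
    then have h5: "D^3 - 5 * D^2 \<le> a^3 - 5 * a^2"
      by (simp add: algebra_simps power2_eq_square power3_eq_cube)
    have n2: "n^2 = a^2 + 2 * a + 1" "n^3 = a^3 + 3 * a^2 + 3 * a + 1"
      using a(3) by (simp_all add: power2_eq_square power3_eq_cube algebra_simps)
    have a2: "10 * a \<le> a^2" using aa(1) by (simp add: power2_eq_square)
    have "0 < n^3 + 27 * n - 38 - D^3 - Z"
      using Z h5 a2 a n2 by linarith
    moreover have "(n^2 + 9 * n - 10 - D^2) - D - 6 * n + 6 \<le> n^3 + 27 * n - 38 - D^3 - Z"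
      using Z h6 a2 a n2 by linarith
    ultimately show False using disjZ by linarith
  qed
  then have cases: "n = 4 \<and> D = 3 \<or> n = 5 \<and> D = 4 \<or> n = 6 \<and> D = 5"
    using small_degree_moments[OF n _ D A Y B disjZ] by blast
  \<comment> \<open>Here the degree sum is 11 and the square sum 33. So every degree is 0 or 3, but
    11 is not divisible by 3.\<close>
  have "\<not> (n = 4 \<and> D = 3)"
  proof
    assume nD: "n = 4 \<and> D = 3"
    have "(\<Sum>i\<in>S. d i * (3 - d i)) = (\<Sum>i\<in>S. 3 * d i - (d i)\<^sup>2)"
      by (intro sum.cong refl) (simp add: algebra_simps power2_eq_square)
    also have "\<dots> = 3 * (\<Sum>i\<in>S. d i) - (\<Sum>i\<in>S. (d i)\<^sup>2)"
      unfolding sum_subtractf sum_distrib_left ..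
    finally have "(\<Sum>i\<in>S. d i * (3 - d i)) = 3 * (\<Sum>i\<in>S. d i) - (\<Sum>i\<in>S. (d i)\<^sup>2)" .
    then have "(\<Sum>i\<in>S. d i * (3 - d i)) = 0" using s1 s2 nD by simp
    moreover have "0 \<le> d i * (3 - d i)" if "i \<in> S" for i using d[OF that] nD by simp
    ultimately have "\<forall>i\<in>S. d i * (3 - d i) = 0" using fin by (simp add: sum_nonneg_eq_0_iff)
    then have "3 dvd d i" if "i \<in> S" for i using that by force
    then have "3 dvd (\<Sum>i\<in>S. d i)" by (rule dvd_sum)
    then show False using s1 nD by simp
  qed
  with cases show ?thesis by blast
qed

lemma fan_has_universal_vertex:
  assumes n: "2 \<le> n" and \<alpha>: "1/2 < \<alpha>" "\<alpha> < 1" and F: "simple_graph (1 + n) F"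
    and spec: "A_alpha_spectrum \<alpha> (1 + n) F = A_alpha_spectrum \<alpha> (1 + n) (KP 1 n)"
  shows "\<exists>u<1 + n. deg (1 + n) F u = real n"
proof (rule ccontr)
  let ?N = "1 + n"
  define dg where "dg = Defs.degree ?N F"
  assume no: "\<not> ?thesis"
  have small: "dg i \<le> n - 1" "dg i < n" if "i < ?N" for i
  proof -
    have "dg i \<le> n" "dg i \<noteq> n"
      using universal_iff(1)[OF F that] no that unfolding dg_def by auto
    then show "dg i \<le> n - 1" "dg i < n" by linarith+
  qed
  have a0: "0 < \<alpha>" using \<alpha> by simp
  note inv = cospectral_invariants[OF KP_simple F a0 spec]
  have S1: "(\<Sum>i<?N. real (dg i)) = 4 * real n - 2"
    using inv(2) KP_deg_sum[OF n, of "\<lambda>x. x" 1] unfolding dg_def by simp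
  have S2: "(\<Sum>i<?N. (real (dg i))\<^sup>2) = (real n)\<^sup>2 + 9 * real n - 10"
    using inv(3) KP_deg_sum[OF n, of "\<lambda>x. x\<^sup>2" 1] unfolding dg_def by simp
  have S3: "(\<Sum>i<?N. (deg ?N (KP 1 n) i)^3) = (real n)^3 + 27 * real n - 38"
    using KP_deg_sum[OF n, of "\<lambda>x. x^3" 1] by simp
  define T where "T = (\<Sum>i<?N. triangles_at ?N F i)"
  define dS where "dS = (real n)^3 + 27 * real n - 38 - (\<Sum>i<?N. (real (dg i))^3)"
  \<comment> \<open>This eliminates \<alpha>. The third trace reads
    \<open>\<alpha>^3 * dS = b^3 * (T - G)\<close> with \<open>b < \<alpha>\<close>; if
    \<open>dS\<close> were positive and at least \<open>T - G\<close>, the left side would be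
    larger.\<close>
  have disj: "dS \<le> 0 \<or> dS < B - 6 * real n + 6" if "T \<le> B" for B
  proof (rule ccontr)
    assume neg: "\<not> ?thesis"
    define b where "b = 1 - \<alpha>"
    define G where "G = (\<Sum>i<?N. triangles_at ?N (KP 1 n) i)"
    have "\<alpha>^3 * (\<Sum>i<?N. (real (dg i))^3) + b^3 * T = \<alpha>^3 * ((real n)^3 + 27 * real n - 38) + b^3 * G"
      using inv(4) unfolding S3 dg_def T_def b_def G_def .
    then have eq: "\<alpha>^3 * dS = b^3 * (T - G)" by (simp add: dS_def algebra_simps)
    have "T - G \<le> dS" using KP_triangles[OF n] neg that unfolding G_def by linarith
    then have "b^3 * (T - G) \<le> b^3 * dS" using \<alpha> by (intro mult_left_mono) (auto simp: b_def)
    moreover have "b^3 < \<alpha>^3" using \<alpha> by (intro power_strict_mono) (auto simp: b_def)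
    then have "b^3 * dS < \<alpha>^3 * dS" using neg by (intro mult_strict_right_mono) auto
    ultimately show False using eq by linarith
  qed
  obtain v where v: "v < ?N" "\<And>i. i < ?N \<Longrightarrow> dg i \<le> dg v"
  proof -
    have "Max (dg ` {..<?N}) \<in> dg ` {..<?N}" by (intro Max_in) auto
    then obtain v where "v < ?N" "dg v = Max (dg ` {..<?N})" by auto
    then show thesis by (intro that[of v]) auto
  qed
  define S where "S = {..<?N} - {v}"
  have fS: "finite S" "card S = n" using v by (auto simp: S_def)
  have split: "(\<Sum>i<?N. f i) = f v + (\<Sum>i\<in>S. f i)" for f :: "nat \<Rightarrow> real"
    unfolding S_def by (rule sum.remove) (use v in auto)
  have le5: "dg i \<le> 5" if "i \<in> S" for i
  proof (rule ccontr)
    assume "\<not> dg i \<le> 5"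
    then show False
      using one_large_degree[OF n \<alpha> F spec, of v i] v(1) v(2)[of i] that by (auto simp: S_def dg_def)
  qed
  have X: "(\<Sum>i\<in>S. real (dg i)) = 4 * real n - 2 - real (dg v)"
    using S1 split[of "\<lambda>i. real (dg i)"] by simp
  have Y: "(\<Sum>i\<in>S. (real (dg i))\<^sup>2) = (real n)\<^sup>2 + 9 * real n - 10 - (real (dg v))\<^sup>2"
    using S2 split[of "\<lambda>i. (real (dg i))\<^sup>2"] by simp
  have dS: "dS = (real n)^3 + 27 * real n - 38 - (real (dg v))^3 - (\<Sum>i\<in>S. (real (dg i))^3)"
    using split[of "\<lambda>i. (real (dg i))^3"] by (simp add: dS_def)
  have T1: "triangles_at ?N F i \<le> real (dg i) * (real (dg i) - 1)" for i
    using triangles_at_le_pairs[OF F, of i] by (simp add: dg_def)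
  \<comment> \<open>As \<open>i\<close> is not universal it has a non-neighbour, whose degree is at
    least \<open>\<delta>\<close>.\<close>
  have T2: "triangles_at ?N F i \<le> 4 * real n - 2 - 2 * real (dg i) - 2 * \<delta>"
    if i: "i < ?N" and \<delta>: "\<And>j. j < ?N \<Longrightarrow> \<delta> \<le> real (dg j)" for i \<delta>
  proof -
    have "deg ?N F i \<noteq> real ?N - 1" using small(2)[OF i] by (auto simp: dg_def)
    then obtain w where w: "w < ?N" "i \<noteq> w" "\<not> F i w" using universal_iff(2)[OF F i] by auto
    from triangles_at_le_edges[OF F i w] \<delta>[OF w(1)] S1 show ?thesis by (simp add: dg_def)
  qed
  \<comment> \<open>A crude bound: edges at \<open>v\<close> with \<open>\<delta> = 0\<close>, pairs
    of neighbours elsewhere. It depends only on \<open>n\<close>, the largest degree and the first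
    two moments.\<close>
  have "T \<le> (4 * real n - 2 - 2 * real (dg v)) + (\<Sum>i\<in>S. real (dg i) * (real (dg i) - 1))"
    unfolding T_def split using T2[OF v(1), of 0] T1 by (intro add_mono sum_mono) auto
  also have "(\<Sum>i\<in>S. real (dg i) * (real (dg i) - 1)) = (\<Sum>i\<in>S. (real (dg i))\<^sup>2) - (\<Sum>i\<in>S. real (dg i))"
    by (simp add: sum_subtractf algebra_simps power2_eq_square)
  finally have "T \<le> (real n)\<^sup>2 + 9 * real n - 10 - (real (dg v))\<^sup>2 - real (dg v)" unfolding X Y by linarith
  from disj[OF this]
  have disj_real: "dS \<le> 0 \<or> dS < (real n)\<^sup>2 + 9 * real n - 10 - (real (dg v))\<^sup>2 - real (dg v) - 6 * real n + 6" .
  have "int n = 5 \<and> int (dg v) = 4 \<or> int n = 6 \<and> int (dg v) = 5"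
  proof (rule degree_moments[OF fS(1)])
    show "int (card S) = int n" "2 \<le> int n" "0 \<le> int (dg v)" using fS n by auto
    show "int (dg v) \<le> int n - 1" using small[OF v(1)] by linarith
    show "0 \<le> int (dg i) \<and> int (dg i) \<le> 5 \<and> int (dg i) \<le> int (dg v)" if "i \<in> S" for i
      using le5[OF that] v(2)[of i] that by (auto simp: S_def)
    have "real_of_int (\<Sum>i\<in>S. int (dg i)) = real_of_int (4 * int n - 2 - int (dg v))" using X by simp
    then show "(\<Sum>i\<in>S. int (dg i)) = 4 * int n - 2 - int (dg v)" by (simp only: of_int_eq_iff)
    have "real_of_int (\<Sum>i\<in>S. (int (dg i))\<^sup>2) = real_of_int ((int n)\<^sup>2 + 9 * int n - 10 - (int (dg v))\<^sup>2)"
      using Y by simp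
    then show "(\<Sum>i\<in>S. (int (dg i))\<^sup>2) = (int n)\<^sup>2 + 9 * int n - 10 - (int (dg v))\<^sup>2"
      by (simp only: of_int_eq_iff)
    let ?e = "(int n)^3 + 27 * int n - 38 - (int (dg v))^3 - (\<Sum>i\<in>S. (int (dg i))^3)"
    let ?r = "((int n)\<^sup>2 + 9 * int n - 10 - (int (dg v))\<^sup>2) - int (dg v) - 6 * int n + 6"
    have "real_of_int ?e = dS" by (simp add: dS)
    moreover have "real_of_int ?r
        = (real n)\<^sup>2 + 9 * real n - 10 - (real (dg v))\<^sup>2 - real (dg v) - 6 * real n + 6" by simp
    ultimately have "real_of_int ?e \<le> real_of_int 0 \<or> real_of_int ?e < real_of_int ?r"
      using disj_real by (simp only: of_int_0)
    then show "?e \<le> 0 \<or> ?e < ?r" by (simp only: of_int_le_iff of_int_less_iff)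
  qed
  then have nD: "n = 5 \<and> dg v = 4 \<or> n = 6 \<and> dg v = 5" by linarith
  define a where "a k = card {i \<in> S. dg i = k}" for k
  have count: "(\<Sum>i\<in>S. f (dg i)) = (\<Sum>k\<le>5. of_nat (a k) * f k)" for f :: "nat \<Rightarrow> 'b :: semiring_1"
    unfolding a_def by (rule sum_fun_comp) (use fS le5 in auto)
  have six: "(\<Sum>k\<le>5. g k) = g 0 + g 1 + g 2 + g 3 + g 4 + g 5" for g :: "nat \<Rightarrow> 'b :: comm_monoid_add"
    by (simp add: eval_nat_numeral add_ac)
  have c0: "a 0 + a 1 + a 2 + a 3 + a 4 + a 5 = n"
    using count[of "\<lambda>_. 1 :: nat"] fS unfolding six by simp
  have "real (a 1 + 2 * a 2 + 3 * a 3 + 4 * a 4 + 5 * a 5) = 4 * real n - 2 - real (dg v)"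
    using X unfolding count[of real] six by simp
  then have c1: "a 1 + 2 * a 2 + 3 * a 3 + 4 * a 4 + 5 * a 5 + dg v + 2 = 4 * n" by linarith
  have c2: "real (a 1 + 4 * a 2 + 9 * a 3 + 16 * a 4 + 25 * a 5)
      = (real n)\<^sup>2 + 9 * real n - 10 - (real (dg v))\<^sup>2"
    using Y unfolding count[of "\<lambda>k. (real k)\<^sup>2"] six by simp
  have c3: "(\<Sum>i\<in>S. (real (dg i))^3) = a 1 + 8 * a 2 + 27 * a 3 + 64 * a 4 + 125 * a 5"
    unfolding count[of "\<lambda>k. (real k)^3"] six by simp
  have degs: "a (dg i) \<noteq> 0" if "i \<in> S" for i
    using that fS unfolding a_def by (auto simp: card_eq_0_iff)
  \<comment> \<open>For \<open>n = 5\<close> the crude bound excludes neither of the remaining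
    degree sequences. Here every vertex of largest degree gets the edge bound, improved by a lower
    bound \<open>\<delta>\<close> for all degrees.\<close>
  have Tbound: "T \<le> t + (\<Sum>k\<le>5. real (a k) * (if k = dg v then t else real k * (real k - 1)))"
    if t: "t = 4 * real n - 2 - 2 * real (dg v) - 2 * \<delta>" and \<delta>: "\<And>j. j < ?N \<Longrightarrow> \<delta> \<le> real (dg j)" for t \<delta>
  proof -
    have "triangles_at ?N F i \<le> (if dg i = dg v then t else real (dg i) * (real (dg i) - 1))"
      if "i \<in> S" for i
      using T1[of i] T2[of i \<delta>] that \<delta> t by (auto simp: S_def)
    then have "T \<le> t + (\<Sum>i\<in>S. if dg i = dg v then t else real (dg i) * (real (dg i) - 1))"
      unfolding T_def split using T2[OF v(1) \<delta>] t by (intro add_mono sum_mono) auto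
    also have "(\<Sum>i\<in>S. if dg i = dg v then t else real (dg i) * (real (dg i) - 1))
        = (\<Sum>k\<le>5. real (a k) * (if k = dg v then t else real k * (real k - 1)))"
      by (rule count)
    finally show ?thesis .
  qed
  from nD show False
  proof (elim disjE conjE)
    assume nD: "n = 5" "dg v = 4"
    have "a 5 = 0"
    proof (rule ccontr)
      assume "a 5 \<noteq> 0"
      then obtain i where "i \<in> S" "dg i = 5" unfolding a_def by (auto simp: card_eq_0_iff)
      then show False using v(2)[of i] nD by (simp add: S_def)
    qed
    have "a 1 + 4 * a 2 + 9 * a 3 + 16 * a 4 = 44" using c2 nD \<open>a 5 = 0\<close> by simp
    then have sol: "(a 4 = 1 \<and> a 3 = 3 \<and> a 2 = 0 \<and> a 1 = 1 \<and> a 0 = 0) \<or>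
        (a 4 = 2 \<and> a 3 = 0 \<and> a 2 = 3 \<and> a 1 = 0 \<and> a 0 = 0)"
      using c0 c1 nD \<open>a 5 = 0\<close> by (intro five_degrees) simp_all
    then show False
    proof (elim disjE)
      assume s: "a 4 = 1 \<and> a 3 = 3 \<and> a 2 = 0 \<and> a 1 = 1 \<and> a 0 = 0"
      \<comment> \<open>Degrees 4, 4, 3, 3, 3, 1: with \<open>\<delta> = 1\<close> the bound is
        \<open>T \<le> 34\<close>, and \<open>dS = 12\<close> is not below
        \<open>34 - 30 + 6\<close>.\<close>
      have "1 \<le> real (dg j)" if "j < ?N" for j
      proof (cases "j = v")
        case False
        then have "dg j \<noteq> 0" using degs[of j] s that by (metis DiffI S_def lessThan_iff singletonD)
        then show ?thesis by simp
      qed (use nD in simp)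
      from disj[OF Tbound[OF _ this]] show False
        unfolding six dS c3 using nD s \<open>a 5 = 0\<close> by simp
    next
      assume s: "a 4 = 2 \<and> a 3 = 0 \<and> a 2 = 3 \<and> a 1 = 0 \<and> a 0 = 0"
      \<comment> \<open>Degrees 4, 4, 4, 2, 2, 2: with \<open>\<delta> = 2\<close> the bound is
        \<open>T \<le> 24\<close>, and \<open>dS = 6\<close> is not below
        \<open>24 - 30 + 6\<close>.\<close>
      have "2 \<le> real (dg j)" if "j < ?N" for j
      proof (cases "j = v")
        case False
        then have "dg j \<noteq> 0" "dg j \<noteq> 1" using degs[of j] s that by (metis DiffI S_def lessThan_iff singletonD)+
        then show ?thesis by simp
      qed (use nD in simp)
      from disj[OF Tbound[OF _ this]] show False
        unfolding six dS c3 using nD s \<open>a 5 = 0\<close> by simp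
    qed
  next
    assume nD: "n = 6" "dg v = 5"
    have "a 1 + 4 * a 2 + 9 * a 3 + 16 * a 4 + 25 * a 5 = 55" using c2 nD by simp
    then have sol: "(a 5 = 1 \<and> a 4 = 0 \<and> a 3 = 2 \<and> a 2 = 3 \<and> a 1 = 0 \<and> a 0 = 0) \<or>
        (a 5 = 0 \<and> a 4 = 2 \<and> a 3 = 2 \<and> a 2 = 1 \<and> a 1 = 1 \<and> a 0 = 0)"
      using c0 c1 nD by (intro six_degrees) simp_all
    \<comment> \<open>Now \<open>\<delta> = 0\<close> suffices. Degrees 5, 5, 3, 3, 2, 2, 2 give
      \<open>T \<le> 42\<close> and \<open>dS = 12\<close>, not below 12; degrees 5, 4, 4, 3, 3, 2,
      1 give \<open>T \<le> 50\<close> and \<open>dS = 24\<close>, not below 20.\<close>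
    have "0 \<le> real (dg j)" for j by simp
    from disj[OF Tbound[OF _ this]] sol show False
      unfolding six dS c3 using nD by auto
  qed
qed

theorem theorem3p12:
  fixes m n :: nat and \<alpha> :: real
  assumes "m \<ge> 1" and "n \<ge> 1" and "1/2 < \<alpha>" and "\<alpha> < 1"
  shows "determined_by_A_alpha_spectrum \<alpha> (m + n)
           (graph_join m (complete_graph m) n (path_graph n))"
  unfolding determined_by_A_alpha_spectrum_def
proof (intro allI impI, elim conjE)
  fix M F
  assume F: "simple_graph M F" and spec: "A_alpha_spectrum \<alpha> M F = A_alpha_spectrum \<alpha> (m + n) (KP m n)"
  have a0: "0 < \<alpha>" using assms by simp
  note inv = cospectral_invariants[OF KP_simple F a0 spec]
  have M: "M = m + n" by (rule inv(1))
  note F = F[unfolded M] and spec = spec[unfolded M]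
  have "graph_iso (m + n) F (m + n) (KP m n)"
  proof (cases "n = 1")
    case True
    \<comment> \<open>With a single path vertex the join is complete, and the degree sum alone
      forces a cospectral graph to be complete.\<close>
    have KPdeg: "deg (m + n) (KP m n) i = real (m + n) - 1" if "i < m + n" for i
    proof (cases "i < m")
      case False
      then have "i = m + 0" using that True by simp
      then show ?thesis using KP_deg_path[of 0 n m] True by simp
    qed (rule KP_deg_clique)
    have "(\<Sum>i<m + n. real (m + n) - 1 - deg (m + n) F i) = 0"
      using inv(2) KPdeg unfolding M by (simp add: sum_subtractf)
    moreover have "0 \<le> real (m + n) - 1 - deg (m + n) F i" if "i < m + n" for i
      using universal_iff(1)[OF F that] by simp
    ultimately have "\<forall>i\<in>{..<m + n}. real (m + n) - 1 - deg (m + n) F i = 0"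
      by (subst (asm) sum_nonneg_eq_0_iff) auto
    then have univ: "F i j" if "i < m + n" "j < m + n" "j \<noteq> i" for i j
      using universal_iff(2)[OF F that(1)] that by simp
    show ?thesis
    proof (rule graph_isoI[of id])
      fix i j assume "i < m + n" "j < m + n"
      then show "KP m n i j \<longleftrightarrow> F (id i) (id j)"
        using univ[of i j] simple_graph_irrefl[OF F, of i] True
        by (auto simp: KP_iff less_Suc_eq)
    qed simp
  next
    case False
    then have n: "2 \<le> n" using assms by simp
    define V where "V = {u \<in> {..<m + n}. deg (m + n) F u = real (m + n) - 1}"
    have "m \<le> card V"
    proof (cases "m = 1")
      case True
      then obtain u where "u < m + n" "deg (m + n) F u = real n"
        using fan_has_universal_vertex[OF n assms(3,4)] F spec by blast
      then have "u \<in> V" using True by (simp add: V_def)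
      then have "V \<noteq> {}" "finite V" by (auto simp: V_def)
      then show ?thesis using True by (simp add: Suc_le_eq card_gt_0_iff)
    next
      case False
      then show ?thesis
        using many_universal_vertices[OF _ assms(3,4) F spec] assms(1) by (simp add: V_def)
    qed
    \<comment> \<open>The join has more than \<open>m\<close> universal vertices when
      \<open>n\<close> is 2 or 3, so \<open>m\<close> of them are selected.\<close>
    then obtain U where U: "U \<subseteq> V" "card U = m" by (meson obtain_subset_with_card_n)
    show ?thesis
    proof (rule KP_iso_if_universal[OF assms(1) n assms(3,4) F spec _ U(2)])
      show "U \<subseteq> {..<m + n}" using U by (auto simp: V_def)
      show "F u j" if "u \<in> U" "j < m + n" "j \<noteq> u" for u j
        using U that universal_iff(2)[OF F, of u] by (auto simp: V_def)
    qed
  qed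
  then show "graph_iso M F (m + n) (KP m n)" unfolding M .
qed

end
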